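(* Let $p,q\in\Bbbk^\times$ and let $r,s$ be positive integers with $\gcd(r,s)=1$, $q^r=p^s$ and $pq\neq 1$, and assume that $H_{p,q}$ is not a polynomial identity ring. Then for every integer $n\geq 1$ there exists a faithful irreducible representation of $A_p^n(r,s)$.
   Context: $\Bbbk$ is an uncountable, algebraically closed field of characteristic zero. $H=H_{p,q}=\Bbbk\langle x,y,z\mid zx-p^{-1}xz,\ zy-pyz,\ yx-qxy-z\rangle$. Put $\Omega=(yx-p^{-1}xy)^r z^s\in H$, a central element, and define $A_p(r,s)=H/(\Omega-1)H$. Define $A_p^1(r,s)=A_p(r,s)$ and inductively $A_p^n(r,s)=A_p^{n-1}(r,s)\otimes_{\Bbbk}A_p(r,s)$ for $n\geq 2$. *)

theory Defs
  imports
    "HOL-Algebra.Algebra"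
    "HOL-Algebra.Algebraic_Closure_Type"
    "HOL-Library.Poly_Mapping"
    "HOL-Library.Countable_Set"
begin

section \<open>Algebras over a field\<close>

text \<open>
  Associative unital algebras over a field \<open>'k\<close> are represented by the record type
  \<open>('k, 'a) module\<close>: a ring together with a scalar multiplication. The locale
  \<open>algebra\<close> of HOL-Algebra is not used because it is restricted to commutative algebras.
\<close>

text \<open>
  The monoid algebra: finitely supported functions on the monoid \<open>M\<close>, with the convolution
  product. The basis element of \<open>m\<close> is \<open>Poly_Mapping.single m 1\<close>.
\<close>

definition monoid_algebra ::
    "('m, 'e) monoid_scheme \<Rightarrow> ('k::field, 'm \<Rightarrow>\<^sub>0 'k) module" where
  "monoid_algebra M =
    \<lparr>carrier = {f. Poly_Mapping.keys f \<subseteq> carrier M},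
     monoid.mult = (\<lambda>f g. \<Sum>a\<in>Poly_Mapping.keys f. \<Sum>b\<in>Poly_Mapping.keys g.
        Poly_Mapping.single (a \<otimes>\<^bsub>M\<^esub> b) (Poly_Mapping.lookup f a * Poly_Mapping.lookup g b)),
     one = Poly_Mapping.single \<one>\<^bsub>M\<^esub> 1,
     ring.zero = 0,
     add = (+),
     module.smult = (\<lambda>c. Poly_Mapping.map ((*) c))\<rparr>"

definition free_algebra :: "('k::field, 'v list \<Rightarrow>\<^sub>0 'k) module" where
  "free_algebra = monoid_algebra \<lparr>carrier = UNIV, monoid.mult = (@), one = []\<rparr>"

definition free_gen :: "'v \<Rightarrow> ('v list \<Rightarrow>\<^sub>0 'k::field)" where
  "free_gen v = Poly_Mapping.single [v] 1"

text \<open>The ring \<open>R Quot I\<close>, with the scalar multiplication \<open>c (I + x) = I + c x\<close>.\<close>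

definition quot_algebra :: "('k, 'a) module \<Rightarrow> 'a set \<Rightarrow> ('k, 'a set) module" where
  "quot_algebra R I =
    \<lparr>carrier = carrier (R Quot I),
     monoid.mult = monoid.mult (R Quot I),
     one = one (R Quot I),
     ring.zero = ring.zero (R Quot I),
     add = add (R Quot I),
     module.smult = (\<lambda>c S. \<Union>x\<in>S. I +>\<^bsub>R\<^esub> (c \<odot>\<^bsub>R\<^esub> x))\<rparr>"


section \<open>Tensor products and tensor powers\<close>

text \<open>
  The tensor product over \<open>'k\<close> is the vector space with basis \<open>carrier A \<times> carrier B\<close> modulo
  the subspace spanned by the bilinearity relations. That vector space is the monoid algebra of
  the multiplicative monoid \<open>A \<times>\<times> B\<close>, and multiplying a bilinearity relation by a basis
  element yields again a bilinearity relation; hence the span is the two-sided ideal generated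
  by these relations, and the product of the quotient is
  \<open>(a \<otimes> b) (a' \<otimes> b') = a a' \<otimes> b b'\<close>.
\<close>

definition bilinear_relations ::
    "('k::field, 'a) module \<Rightarrow> ('k, 'b) module \<Rightarrow> ('a \<times> 'b \<Rightarrow>\<^sub>0 'k) set" where
  "bilinear_relations A B =
    (let e = (\<lambda>a b. Poly_Mapping.single (a, b) (1::'k)) in
      {e (a \<oplus>\<^bsub>A\<^esub> a') b - e a b - e a' b | a a' b.
          a \<in> carrier A \<and> a' \<in> carrier A \<and> b \<in> carrier B}
      \<union> {e a (b \<oplus>\<^bsub>B\<^esub> b') - e a b - e a b' | a b b'.
          a \<in> carrier A \<and> b \<in> carrier B \<and> b' \<in> carrier B}
      \<union> {e (c \<odot>\<^bsub>A\<^esub> a) b - Poly_Mapping.map ((*) c) (e a b) | c a b.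
          a \<in> carrier A \<and> b \<in> carrier B}
      \<union> {e a (c \<odot>\<^bsub>B\<^esub> b) - Poly_Mapping.map ((*) c) (e a b) | c a b.
          a \<in> carrier A \<and> b \<in> carrier B})"

definition tensor ::
    "('k::field, 'a) module \<Rightarrow> ('k, 'b) module \<Rightarrow> ('k, ('a \<times> 'b \<Rightarrow>\<^sub>0 'k) set) module" where
  "tensor A B =
    (let F = monoid_algebra (A \<times>\<times> B)
     in quot_algebra F (Idl\<^bsub>F\<^esub> (bilinear_relations A B)))"

text \<open>
  Each application of \<open>tensor\<close> changes the type of the elements, so the recursion
  \<open>A\<^sup>n = A\<^sup>n\<^sup>-\<^sup>1 \<otimes> A\<close> has no direct rendering as a primitive recursion.
  Therefore the elements are renamed at each step, along an injection \<open>\<phi>\<close> into one fixed type.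
\<close>

definition relabel :: "('a \<Rightarrow> 'b) \<Rightarrow> ('k, 'a) module \<Rightarrow> ('k, 'b) module" where
  "relabel \<phi> A =
    (let \<psi> = inv_into (carrier A) \<phi> in
      \<lparr>carrier = \<phi> ` carrier A,
       monoid.mult = (\<lambda>u v. \<phi> (\<psi> u \<otimes>\<^bsub>A\<^esub> \<psi> v)),
       one = \<phi> \<one>\<^bsub>A\<^esub>,
       ring.zero = \<phi> \<zero>\<^bsub>A\<^esub>,
       add = (\<lambda>u v. \<phi> (\<psi> u \<oplus>\<^bsub>A\<^esub> \<psi> v)),
       module.smult = (\<lambda>c u. \<phi> (c \<odot>\<^bsub>A\<^esub> \<psi> u))\<rparr>)"

text \<open>\<open>Comb [(c\<^sub>1, u\<^sub>1, a\<^sub>1), \<dots>]\<close> names the tensor \<open>c\<^sub>1 u\<^sub>1 \<otimes> a\<^sub>1 + \<dots>\<close>.\<close>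

datatype ('k, 'a) nested = Base 'a | Comb "('k \<times> ('k, 'a) nested \<times> 'a) list"

text \<open>
  An element of a tensor product is a coset \<open>S\<close> of formal combinations of pairs; \<open>tensor_name S\<close>
  is one combination chosen from it. Distinct cosets are disjoint, hence get distinct names.
\<close>

definition tensor_name ::
    "(('k, 'a) nested \<times> 'a \<Rightarrow>\<^sub>0 'k::field) set \<Rightarrow> ('k, 'a) nested" where
  "tensor_name S = Comb (SOME xs. (\<Sum>(c, u)\<leftarrow>xs. Poly_Mapping.single u c) \<in> S)"

text \<open>
  \<open>tensor_power A n\<close> is the \<open>n\<close>-fold tensor power for \<open>n \<ge> 1\<close>; the value at \<open>0\<close> is arbitrary.
\<close>

primrec tensor_power ::
    "('k::field, 'a) module \<Rightarrow> nat \<Rightarrow> ('k, ('k, 'a) nested) module" where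
  "tensor_power A 0 = relabel Base A"
| "tensor_power A (Suc n) =
    (if n = 0 then relabel Base A
     else relabel tensor_name (tensor (tensor_power A n) A))"


subsection \<open>These constructions yield algebras, and the renaming maps are isomorphisms\<close>

lemma poly_mapping_sum_single:
  "(f :: 'm \<Rightarrow>\<^sub>0 'k::comm_monoid_add)
     = (\<Sum>a\<in>Poly_Mapping.keys f. Poly_Mapping.single a (Poly_Mapping.lookup f a))"
  by (rule poly_mapping_eqI)
     (auto simp: lookup_sum lookup_single when_def not_in_keys_iff_lookup_eq_zero)

lemma monoid_algebra_mult_superset:
  fixes f g :: "'m \<Rightarrow>\<^sub>0 'k::field"
  assumes "finite S" "finite T" "Poly_Mapping.keys f \<subseteq> S" "Poly_Mapping.keys g \<subseteq> T"
  shows "f \<otimes>\<^bsub>monoid_algebra M\<^esub> g = (\<Sum>a\<in>S. \<Sum>b\<in>T.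
    Poly_Mapping.single (a \<otimes>\<^bsub>M\<^esub> b) (Poly_Mapping.lookup f a * Poly_Mapping.lookup g b))"
proof -
  have "f \<otimes>\<^bsub>monoid_algebra M\<^esub> g = (\<Sum>a\<in>Poly_Mapping.keys f. \<Sum>b\<in>T.
    Poly_Mapping.single (a \<otimes>\<^bsub>M\<^esub> b) (Poly_Mapping.lookup f a * Poly_Mapping.lookup g b))"
    unfolding monoid_algebra_def monoid.simps
    by (intro sum.cong refl sum.mono_neutral_left assms)
       (auto simp: in_keys_iff)
  also have "\<dots> = (\<Sum>a\<in>S. \<Sum>b\<in>T.
    Poly_Mapping.single (a \<otimes>\<^bsub>M\<^esub> b) (Poly_Mapping.lookup f a * Poly_Mapping.lookup g b))"
    by (intro sum.mono_neutral_left assms) (auto simp: in_keys_iff)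
  finally show ?thesis .
qed

lemma monoid_algebra_mult_single:
  "Poly_Mapping.single a c \<otimes>\<^bsub>monoid_algebra M\<^esub> Poly_Mapping.single b d
     = Poly_Mapping.single (a \<otimes>\<^bsub>M\<^esub> b) (c * d :: 'k::field)"
  by (subst monoid_algebra_mult_superset[of "{a}" "{b}"]) auto

lemma monoid_algebra_distrib:
  fixes f g h :: "'m \<Rightarrow>\<^sub>0 'k::field"
  shows "(f + g) \<otimes>\<^bsub>monoid_algebra M\<^esub> h = f \<otimes>\<^bsub>monoid_algebra M\<^esub> h + g \<otimes>\<^bsub>monoid_algebra M\<^esub> h"
    and "h \<otimes>\<^bsub>monoid_algebra M\<^esub> (f + g) = h \<otimes>\<^bsub>monoid_algebra M\<^esub> f + h \<otimes>\<^bsub>monoid_algebra M\<^esub> g"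
proof -
  let ?S = "Poly_Mapping.keys f \<union> Poly_Mapping.keys g \<union> Poly_Mapping.keys (f + g)"
  let ?T = "Poly_Mapping.keys h"
  have sup: "u \<otimes>\<^bsub>monoid_algebra M\<^esub> h = (\<Sum>a\<in>?S. \<Sum>b\<in>?T. Poly_Mapping.single (a \<otimes>\<^bsub>M\<^esub> b) (Poly_Mapping.lookup u a * Poly_Mapping.lookup h b))"
    "h \<otimes>\<^bsub>monoid_algebra M\<^esub> u = (\<Sum>a\<in>?T. \<Sum>b\<in>?S. Poly_Mapping.single (a \<otimes>\<^bsub>M\<^esub> b) (Poly_Mapping.lookup h a * Poly_Mapping.lookup u b))"
    if "u \<in> {f, g, f + g}" for u
    using that by (intro monoid_algebra_mult_superset; auto)+
  show "(f + g) \<otimes>\<^bsub>monoid_algebra M\<^esub> h = f \<otimes>\<^bsub>monoid_algebra M\<^esub> h + g \<otimes>\<^bsub>monoid_algebra M\<^esub> h"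
    by (simp add: sup lookup_add distrib_right single_add sum.distrib)
  show "h \<otimes>\<^bsub>monoid_algebra M\<^esub> (f + g) = h \<otimes>\<^bsub>monoid_algebra M\<^esub> f + h \<otimes>\<^bsub>monoid_algebra M\<^esub> g"
    by (simp add: sup lookup_add distrib_left single_add sum.distrib)
qed

lemma monoid_algebra_mult_zero:
  "0 \<otimes>\<^bsub>monoid_algebra M\<^esub> h = (0 :: 'm \<Rightarrow>\<^sub>0 'k::field)"
  "h \<otimes>\<^bsub>monoid_algebra M\<^esub> 0 = (0 :: 'm \<Rightarrow>\<^sub>0 'k::field)"
  by (simp_all add: monoid_algebra_def)

lemma monoid_algebra_mult_sum:
  fixes h :: "'m \<Rightarrow>\<^sub>0 'k::field"
  shows "(\<Sum>i\<in>I. F i) \<otimes>\<^bsub>monoid_algebra M\<^esub> h = (\<Sum>i\<in>I. F i \<otimes>\<^bsub>monoid_algebra M\<^esub> h)"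
    and "h \<otimes>\<^bsub>monoid_algebra M\<^esub> (\<Sum>i\<in>I. F i) = (\<Sum>i\<in>I. h \<otimes>\<^bsub>monoid_algebra M\<^esub> F i)"
  by (induction I rule: infinite_finite_induct; simp add: monoid_algebra_mult_zero monoid_algebra_distrib)+

lemma ring_monoid_algebra:
  assumes "Group.monoid M"
  shows "ring (monoid_algebra M :: ('k::field, _) module)"
proof -
  interpret Group.monoid M by fact
  let ?R = "monoid_algebra M :: ('k, _) module"
  have carr: "carrier ?R = {f. Poly_Mapping.keys f \<subseteq> carrier M}"
    and ops: "\<one>\<^bsub>?R\<^esub> = Poly_Mapping.single \<one>\<^bsub>M\<^esub> 1" "\<zero>\<^bsub>?R\<^esub> = 0" "add ?R = (+)"
    by (simp_all add: monoid_algebra_def)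
  have mclosed: "f \<otimes>\<^bsub>?R\<^esub> g \<in> carrier ?R" if "f \<in> carrier ?R" "g \<in> carrier ?R" for f g
  proof -
    have "Poly_Mapping.keys (f \<otimes>\<^bsub>?R\<^esub> g) \<subseteq> (\<Union>a\<in>Poly_Mapping.keys f. \<Union>b\<in>Poly_Mapping.keys g. {a \<otimes>\<^bsub>M\<^esub> b})"
      unfolding monoid_algebra_def monoid.simps
      by (intro order.trans[OF keys_sum] UN_mono order_refl) (auto split: if_splits)
    then show ?thesis using that by (fastforce simp: carr)
  qed
  show ?thesis
  proof (rule ringI)
    show "abelian_group ?R"
    proof (rule abelian_groupI)
      fix f assume f: "f \<in> carrier ?R"
      show "\<exists>g\<in>carrier ?R. g \<oplus>\<^bsub>?R\<^esub> f = \<zero>\<^bsub>?R\<^esub>"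
        using f by (intro bexI[of _ "- f"]) (auto simp: carr ops in_keys_iff)
    next
      fix f g assume "f \<in> carrier ?R" "g \<in> carrier ?R"
      then show "f \<oplus>\<^bsub>?R\<^esub> g \<in> carrier ?R"
        using keys_add[of f g] by (auto simp: carr ops)
    qed (auto simp: carr ops add_ac)
  next
    show "Group.monoid ?R"
    proof (rule monoidI)
      show "\<one>\<^bsub>?R\<^esub> \<in> carrier ?R" by (simp add: carr ops)
    next
      fix f g h assume A: "f \<in> carrier ?R" "g \<in> carrier ?R" "h \<in> carrier ?R"
      show "f \<otimes>\<^bsub>?R\<^esub> g \<otimes>\<^bsub>?R\<^esub> h = f \<otimes>\<^bsub>?R\<^esub> (g \<otimes>\<^bsub>?R\<^esub> h)"
        by (subst (1 2) poly_mapping_sum_single[of f], subst (1 2) poly_mapping_sum_single[of g],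
            subst (1 2) poly_mapping_sum_single[of h])
           (use A in \<open>auto simp: carr monoid_algebra_mult_sum monoid_algebra_mult_single
              mult.assoc m_assoc subset_iff intro!: sum.cong\<close>)
    next
      fix f assume A: "f \<in> carrier ?R"
      show "\<one>\<^bsub>?R\<^esub> \<otimes>\<^bsub>?R\<^esub> f = f"
        unfolding ops
        by (subst (2) poly_mapping_sum_single[of f], subst (1) poly_mapping_sum_single[of f])
           (use A in \<open>auto simp: carr monoid_algebra_mult_sum monoid_algebra_mult_single
              subset_iff intro!: sum.cong\<close>)
      show "f \<otimes>\<^bsub>?R\<^esub> \<one>\<^bsub>?R\<^esub> = f"
        unfolding ops
        by (subst (2) poly_mapping_sum_single[of f], subst (1) poly_mapping_sum_single[of f])
           (use A in \<open>auto simp: carr monoid_algebra_mult_sum monoid_algebra_mult_single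
              subset_iff intro!: sum.cong\<close>)
    qed (fact mclosed)
  qed (auto simp: ops monoid_algebra_distrib)
qed

definition k_algebra :: "('k::field, 'a) module \<Rightarrow> bool" where
  "k_algebra A \<longleftrightarrow> ring A \<and> module (ring_of_type_algebra :: 'k ring) A \<and>
    (\<forall>c. \<forall>a\<in>carrier A. \<forall>b\<in>carrier A.
      (c \<odot>\<^bsub>A\<^esub> a) \<otimes>\<^bsub>A\<^esub> b = c \<odot>\<^bsub>A\<^esub> (a \<otimes>\<^bsub>A\<^esub> b) \<and> a \<otimes>\<^bsub>A\<^esub> (c \<odot>\<^bsub>A\<^esub> b) = c \<odot>\<^bsub>A\<^esub> (a \<otimes>\<^bsub>A\<^esub> b))"

lemma k_algebraI:
  fixes A :: "('k::field, 'a) module"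
  assumes "ring A"
    and "\<And>c a. a \<in> carrier A \<Longrightarrow> c \<odot>\<^bsub>A\<^esub> a \<in> carrier A"
    and "\<And>c d a. a \<in> carrier A \<Longrightarrow> (c + d) \<odot>\<^bsub>A\<^esub> a = c \<odot>\<^bsub>A\<^esub> a \<oplus>\<^bsub>A\<^esub> d \<odot>\<^bsub>A\<^esub> a"
    and "\<And>c a b. a \<in> carrier A \<Longrightarrow> b \<in> carrier A \<Longrightarrow> c \<odot>\<^bsub>A\<^esub> (a \<oplus>\<^bsub>A\<^esub> b) = c \<odot>\<^bsub>A\<^esub> a \<oplus>\<^bsub>A\<^esub> c \<odot>\<^bsub>A\<^esub> b"
    and "\<And>c d a. a \<in> carrier A \<Longrightarrow> (c * d) \<odot>\<^bsub>A\<^esub> a = c \<odot>\<^bsub>A\<^esub> (d \<odot>\<^bsub>A\<^esub> a)"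
    and "\<And>a. a \<in> carrier A \<Longrightarrow> 1 \<odot>\<^bsub>A\<^esub> a = a"
    and "\<And>c a b. a \<in> carrier A \<Longrightarrow> b \<in> carrier A \<Longrightarrow> (c \<odot>\<^bsub>A\<^esub> a) \<otimes>\<^bsub>A\<^esub> b = c \<odot>\<^bsub>A\<^esub> (a \<otimes>\<^bsub>A\<^esub> b)"
    and "\<And>c a b. a \<in> carrier A \<Longrightarrow> b \<in> carrier A \<Longrightarrow> a \<otimes>\<^bsub>A\<^esub> (c \<odot>\<^bsub>A\<^esub> b) = c \<odot>\<^bsub>A\<^esub> (a \<otimes>\<^bsub>A\<^esub> b)"
  shows "k_algebra A"
  unfolding k_algebra_def
  using assms cring_from_type_algebra[where 'a = 'k]
  by (auto intro!: moduleI ring.is_abelian_group simp: ring_of_type_algebra_def)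

lemma k_algebraD:
  fixes A :: "('k::field, 'a) module"
  assumes "k_algebra A"
  shows "ring A"
    and "\<And>c a. a \<in> carrier A \<Longrightarrow> c \<odot>\<^bsub>A\<^esub> a \<in> carrier A"
    and "\<And>c d a. a \<in> carrier A \<Longrightarrow> (c + d) \<odot>\<^bsub>A\<^esub> a = c \<odot>\<^bsub>A\<^esub> a \<oplus>\<^bsub>A\<^esub> d \<odot>\<^bsub>A\<^esub> a"
    and "\<And>c a b. a \<in> carrier A \<Longrightarrow> b \<in> carrier A \<Longrightarrow> c \<odot>\<^bsub>A\<^esub> (a \<oplus>\<^bsub>A\<^esub> b) = c \<odot>\<^bsub>A\<^esub> a \<oplus>\<^bsub>A\<^esub> c \<odot>\<^bsub>A\<^esub> b"
    and "\<And>c d a. a \<in> carrier A \<Longrightarrow> (c * d) \<odot>\<^bsub>A\<^esub> a = c \<odot>\<^bsub>A\<^esub> (d \<odot>\<^bsub>A\<^esub> a)"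
    and "\<And>a. a \<in> carrier A \<Longrightarrow> 1 \<odot>\<^bsub>A\<^esub> a = a"
    and "\<And>c a b. a \<in> carrier A \<Longrightarrow> b \<in> carrier A \<Longrightarrow> (c \<odot>\<^bsub>A\<^esub> a) \<otimes>\<^bsub>A\<^esub> b = c \<odot>\<^bsub>A\<^esub> (a \<otimes>\<^bsub>A\<^esub> b)"
    and "\<And>c a b. a \<in> carrier A \<Longrightarrow> b \<in> carrier A \<Longrightarrow> a \<otimes>\<^bsub>A\<^esub> (c \<odot>\<^bsub>A\<^esub> b) = c \<odot>\<^bsub>A\<^esub> (a \<otimes>\<^bsub>A\<^esub> b)"
  using assms
  by (auto simp: k_algebra_def module_def module_axioms_def ring_of_type_algebra_def)

lemma lookup_smult: "Poly_Mapping.lookup (Poly_Mapping.map ((*) c) f) a = (c::'k::field) * Poly_Mapping.lookup f a"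
  by (simp add: Poly_Mapping.map.rep_eq when_def)

lemma k_algebra_monoid_algebra:
  assumes "Group.monoid M"
  shows "k_algebra (monoid_algebra M :: ('k::field, _) module)"
proof (rule k_algebraI)
  let ?R = "monoid_algebra M :: ('k, _) module"
  have ops: "add ?R = (+)" "module.smult ?R = (\<lambda>c. Poly_Mapping.map ((*) c))"
    by (simp_all add: monoid_algebra_def)
  show "ring ?R" by (rule ring_monoid_algebra) fact
  have keys: "Poly_Mapping.keys (Poly_Mapping.map ((*) c) f) \<subseteq> Poly_Mapping.keys f" for c :: 'k and f
    by (auto simp: in_keys_iff lookup_smult)
  fix c d :: 'k and f g
  show "c \<odot>\<^bsub>?R\<^esub> f \<in> carrier ?R" if "f \<in> carrier ?R"
    using that keys[of c f] by (auto simp: monoid_algebra_def)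
  show "(c + d) \<odot>\<^bsub>?R\<^esub> f = c \<odot>\<^bsub>?R\<^esub> f \<oplus>\<^bsub>?R\<^esub> d \<odot>\<^bsub>?R\<^esub> f"
    by (intro poly_mapping_eqI) (simp add: ops lookup_smult lookup_add algebra_simps)
  show "c \<odot>\<^bsub>?R\<^esub> (f \<oplus>\<^bsub>?R\<^esub> g) = c \<odot>\<^bsub>?R\<^esub> f \<oplus>\<^bsub>?R\<^esub> c \<odot>\<^bsub>?R\<^esub> g"
    by (intro poly_mapping_eqI) (simp add: ops lookup_smult lookup_add algebra_simps)
  show "(c * d) \<odot>\<^bsub>?R\<^esub> f = c \<odot>\<^bsub>?R\<^esub> (d \<odot>\<^bsub>?R\<^esub> f)"
    by (intro poly_mapping_eqI) (simp add: ops lookup_smult algebra_simps)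
  show "1 \<odot>\<^bsub>?R\<^esub> f = f"
    by (intro poly_mapping_eqI) (simp add: ops lookup_smult)
  have 1: "(c \<odot>\<^bsub>?R\<^esub> f) \<otimes>\<^bsub>?R\<^esub> g = (\<Sum>a\<in>Poly_Mapping.keys f. \<Sum>b\<in>Poly_Mapping.keys g.
    Poly_Mapping.single (a \<otimes>\<^bsub>M\<^esub> b) (c * (Poly_Mapping.lookup f a * Poly_Mapping.lookup g b)))"
    unfolding ops by (subst monoid_algebra_mult_superset[OF finite_keys finite_keys keys order_refl]) (simp add: lookup_smult mult_ac)
  have 2: "f \<otimes>\<^bsub>?R\<^esub> (c \<odot>\<^bsub>?R\<^esub> g) = (\<Sum>a\<in>Poly_Mapping.keys f. \<Sum>b\<in>Poly_Mapping.keys g.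
    Poly_Mapping.single (a \<otimes>\<^bsub>M\<^esub> b) (c * (Poly_Mapping.lookup f a * Poly_Mapping.lookup g b)))"
    unfolding ops by (subst monoid_algebra_mult_superset[OF finite_keys finite_keys order_refl keys]) (simp add: lookup_smult mult_ac)
  have 3: "c \<odot>\<^bsub>?R\<^esub> (f \<otimes>\<^bsub>?R\<^esub> g) = (\<Sum>a\<in>Poly_Mapping.keys f. \<Sum>b\<in>Poly_Mapping.keys g.
    Poly_Mapping.single (a \<otimes>\<^bsub>M\<^esub> b) (c * (Poly_Mapping.lookup f a * Poly_Mapping.lookup g b)))"
    by (intro poly_mapping_eqI) (simp add: monoid_algebra_def lookup_smult lookup_sum sum_distrib_left lookup_single when_def if_distrib cong: if_cong)
  show "(c \<odot>\<^bsub>?R\<^esub> f) \<otimes>\<^bsub>?R\<^esub> g = c \<odot>\<^bsub>?R\<^esub> (f \<otimes>\<^bsub>?R\<^esub> g)" "f \<otimes>\<^bsub>?R\<^esub> (c \<odot>\<^bsub>?R\<^esub> g) = c \<odot>\<^bsub>?R\<^esub> (f \<otimes>\<^bsub>?R\<^esub> g)"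
    using 1 2 3 by simp_all
qed

lemma smult_quot_algebra:
  assumes "k_algebra R" "ideal I R" "x \<in> carrier R"
  shows "c \<odot>\<^bsub>quot_algebra R I\<^esub> (I +>\<^bsub>R\<^esub> x) = I +>\<^bsub>R\<^esub> (c \<odot>\<^bsub>R\<^esub> x)"
proof -
  interpret ideal I R by fact
  note kD = k_algebraD[OF assms(1)]
  have I_sm: "c \<odot>\<^bsub>R\<^esub> i \<in> I" if "i \<in> I" for i
  proof -
    have "c \<odot>\<^bsub>R\<^esub> i = (c \<odot>\<^bsub>R\<^esub> \<one>\<^bsub>R\<^esub>) \<otimes>\<^bsub>R\<^esub> i"
      using that kD(7)[of "\<one>\<^bsub>R\<^esub>" i c] a_Hcarr by simp
    then show ?thesis using I_l_closed[OF that kD(2)[of "\<one>\<^bsub>R\<^esub>" c]] by simp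
  qed
  have *: "I +>\<^bsub>R\<^esub> (c \<odot>\<^bsub>R\<^esub> y) = I +>\<^bsub>R\<^esub> (c \<odot>\<^bsub>R\<^esub> x)" if "y \<in> I +>\<^bsub>R\<^esub> x" for y
  proof -
    from that obtain i where i: "i \<in> I" "y = i \<oplus>\<^bsub>R\<^esub> x" by (auto simp: a_r_coset_def')
    then have "c \<odot>\<^bsub>R\<^esub> y = c \<odot>\<^bsub>R\<^esub> i \<oplus>\<^bsub>R\<^esub> c \<odot>\<^bsub>R\<^esub> x" using kD(4) a_Hcarr assms(3) by simp
    then have "c \<odot>\<^bsub>R\<^esub> y \<in> I +>\<^bsub>R\<^esub> (c \<odot>\<^bsub>R\<^esub> x)" using I_sm[OF i(1)] by (auto simp: a_r_coset_def')
    then show ?thesis using a_repr_independence' kD(2) assms(3) by metis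
  qed
  have "x \<in> I +>\<^bsub>R\<^esub> x" using a_rcos_self assms(3) by simp
  then have "(\<Union>y\<in>I +>\<^bsub>R\<^esub> x. I +>\<^bsub>R\<^esub> (c \<odot>\<^bsub>R\<^esub> x)) = I +>\<^bsub>R\<^esub> (c \<odot>\<^bsub>R\<^esub> x)"
    unfolding UN_constant by (metis empty_iff)
  moreover have "(\<Union>y\<in>I +>\<^bsub>R\<^esub> x. I +>\<^bsub>R\<^esub> (c \<odot>\<^bsub>R\<^esub> y))
      = (\<Union>y\<in>I +>\<^bsub>R\<^esub> x. I +>\<^bsub>R\<^esub> (c \<odot>\<^bsub>R\<^esub> x))"
    by (rule SUP_cong[OF refl]) (rule *)
  ultimately show ?thesis unfolding quot_algebra_def module.simps by (simp only:)
qed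

lemma k_algebra_quot_algebra:
  assumes "k_algebra R" "ideal I R"
  shows "k_algebra (quot_algebra R I)"
proof -
  interpret ideal I R by fact
  note kD = k_algebraD[OF assms(1)]
  let ?Q = "quot_algebra R I"
  note sm = smult_quot_algebra[OF assms]
  have Q: "carrier ?Q = (\<lambda>x. I +>\<^bsub>R\<^esub> x) ` carrier R"
    by (auto simp: quot_algebra_def FactRing_simps)
  have m: "(I +>\<^bsub>R\<^esub> x) \<otimes>\<^bsub>?Q\<^esub> (I +>\<^bsub>R\<^esub> y) = I +>\<^bsub>R\<^esub> (x \<otimes>\<^bsub>R\<^esub> y)"
    and a: "(I +>\<^bsub>R\<^esub> x) \<oplus>\<^bsub>?Q\<^esub> (I +>\<^bsub>R\<^esub> y) = I +>\<^bsub>R\<^esub> (x \<oplus>\<^bsub>R\<^esub> y)"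
    if "x \<in> carrier R" "y \<in> carrier R" for x y
    using that by (simp_all add: quot_algebra_def FactRing_def rcoset_mult_add a_rcos_sum)
  have eqs: "carrier ?Q = carrier (R Quot I)" "monoid.mult ?Q = monoid.mult (R Quot I)"
      "add ?Q = add (R Quot I)" "\<one>\<^bsub>?Q\<^esub> = \<one>\<^bsub>R Quot I\<^esub>" "\<zero>\<^bsub>?Q\<^esub> = \<zero>\<^bsub>R Quot I\<^esub>"
    by (simp_all add: quot_algebra_def)
  interpret Q: ring "R Quot I" by (fact quotient_is_ring)
  have "ring ?Q"
    by (intro ringI abelian_groupI monoidI; unfold eqs)
       (auto simp: Q.m_assoc Q.add.m_ac Q.l_distr Q.r_distr intro: Q.add.l_inv_ex)
  then show ?thesis
    by (rule k_algebraI; unfold Q; elim imageE; simp add: m a sm kD(2-8))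
qed

lemma inj_on_tensor_name:
  assumes "ideal I (monoid_algebra M)"
  shows "inj_on tensor_name (carrier (quot_algebra (monoid_algebra M) I))"
proof (rule inj_onI)
  let ?F = "monoid_algebra M"
  let ?ev = "\<lambda>xs. \<Sum>(c, u)\<leftarrow>xs. Poly_Mapping.single u c"
  interpret ideal I ?F by fact
  fix S T
  assume S: "S \<in> carrier (quot_algebra ?F I)" and T: "T \<in> carrier (quot_algebra ?F I)"
    and eq: "tensor_name S = tensor_name T"
  have mem: "\<exists>xs. ?ev xs \<in> U" if "U \<in> carrier (quot_algebra ?F I)" for U
  proof -
    from that obtain f where f: "f \<in> U"
      by (auto simp: quot_algebra_def FactRing_simps intro: a_rcos_self)
    obtain as where as: "set as = Poly_Mapping.keys f" "distinct as"
      using finite_distinct_list[OF finite_keys] by metis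
    have "?ev (map (\<lambda>a. (Poly_Mapping.lookup f a, a)) as) = f"
      by (subst (2) poly_mapping_sum_single)
         (simp add: as(1)[symmetric] sum_list_distinct_conv_sum_set[OF as(2)] o_def)
    then have "?ev (map (\<lambda>a. (Poly_Mapping.lookup f a, a)) as) \<in> U"
      using f by (simp only:)
    then show ?thesis by (rule exI)
  qed
  from eq have "(SOME xs. ?ev xs \<in> S) = (SOME xs. ?ev xs \<in> T)"
    by (simp add: tensor_name_def)
  then have "S \<inter> T \<noteq> {}"
    using someI_ex[OF mem[OF S]] someI_ex[OF mem[OF T]] by auto
  then show "S = T"
    using a_rcos_disjoint S T
    by (auto simp: quot_algebra_def FactRing_def pairwise_def disjnt_def)
qed

lemma relabel_iso:
  assumes "k_algebra A" and "inj_on \<phi> (carrier A)"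
  shows "k_algebra (relabel \<phi> A)"
    and "\<phi> \<in> ring_iso A (relabel \<phi> A)"
    and "\<And>c a. a \<in> carrier A \<Longrightarrow> \<phi> (c \<odot>\<^bsub>A\<^esub> a) = c \<odot>\<^bsub>relabel \<phi> A\<^esub> \<phi> a"
proof -
  note kD = k_algebraD[OF assms(1)]
  interpret A: ring A by (fact kD(1))
  note inv = inv_into_f_f[OF assms(2)]
  show iso: "\<phi> \<in> ring_iso A (relabel \<phi> A)"
    by (rule ring_iso_memI) (simp_all add: relabel_def Let_def inv bij_betw_def assms(2))
  show sm: "\<And>c a. a \<in> carrier A \<Longrightarrow> \<phi> (c \<odot>\<^bsub>A\<^esub> a) = c \<odot>\<^bsub>relabel \<phi> A\<^esub> \<phi> a"
    by (simp add: relabel_def Let_def inv)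
  have hom: "\<phi> \<in> ring_hom A (relabel \<phi> A)" and im: "carrier (relabel \<phi> A) = \<phi> ` carrier A"
    using iso by (auto simp: ring_iso_def bij_betw_def)
  have "relabel \<phi> A \<lparr>carrier := \<phi> ` carrier A, ring.zero := \<phi> \<zero>\<^bsub>A\<^esub>\<rparr> = relabel \<phi> A"
    by (simp add: relabel_def Let_def)
  then have ring: "ring (relabel \<phi> A)"
    using A.ring_hom_imp_img_ring[OF hom] by (simp only:)
  note h = ring_hom_mult[OF hom, symmetric] ring_hom_add[OF hom, symmetric]
  show "k_algebra (relabel \<phi> A)"
    using ring
    by (rule k_algebraI; unfold im; elim imageE; simp add: h sm[symmetric] kD(2-8))
qed

lemma ideal_bilinear:
  fixes A :: "('k::field, 'a) module" and B :: "('k, 'b) module"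
  assumes "k_algebra A" "k_algebra B"
  shows "ideal (Idl\<^bsub>monoid_algebra (A \<times>\<times> B)\<^esub> (bilinear_relations A B)) (monoid_algebra (A \<times>\<times> B))"
proof -
  note A = k_algebraD[OF assms(1)] and B = k_algebraD[OF assms(2)]
  let ?R = "monoid_algebra (A \<times>\<times> B) :: ('k, _) module"
  interpret A: ring A by (fact A(1))
  interpret B: ring B by (fact B(1))
  have mon: "Group.monoid (A \<times>\<times> B)"
    by (rule DirProd_monoid) unfold_locales
  interpret R: ring ?R by (rule ring_monoid_algebra) fact
  note kR = k_algebraD[OF k_algebra_monoid_algebra[OF mon]]
  have s: "Poly_Mapping.single (a, b) c \<in> carrier ?R" if "a \<in> carrier A" "b \<in> carrier B" for a b c
    using that by (simp add: monoid_algebra_def)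
  have d: "f - g \<in> carrier ?R" if "f \<in> carrier ?R" "g \<in> carrier ?R" for f g
    using that keys_diff[of f g] by (auto simp: monoid_algebra_def)
  have "bilinear_relations A B \<subseteq> carrier ?R"
    unfolding bilinear_relations_def Let_def
    by (auto intro!: d s A(2) B(2))
  then show ?thesis by (rule R.genideal_ideal)
qed

lemma k_algebra_tensor:
  assumes "k_algebra A" "k_algebra B"
  shows "k_algebra (tensor A B)"
proof -
  interpret A: ring A by (rule k_algebraD(1)) fact
  interpret B: ring B by (rule k_algebraD(1)) fact
  have mon: "Group.monoid (A \<times>\<times> B)"
    by (rule DirProd_monoid) unfold_locales
  show ?thesis unfolding tensor_def Let_def
    by (intro k_algebra_quot_algebra k_algebra_monoid_algebra mon ideal_bilinear assms)
qed

lemma inj_on_Base: "inj_on Base S"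
  by (simp add: inj_on_def)

lemma inj_on_tensor_name_tensor:
  assumes "k_algebra A" "k_algebra B"
  shows "inj_on tensor_name (carrier (tensor A B))"
  unfolding tensor_def Let_def by (intro inj_on_tensor_name ideal_bilinear assms)

lemma k_algebra_tensor_power:
  assumes "k_algebra A"
  shows "k_algebra (tensor_power A n)"
proof (induction n)
  case 0
  then show ?case by (simp add: relabel_iso(1) inj_on_Base assms)
next
  case (Suc n)
  then show ?case
    by (auto intro!: relabel_iso(1) inj_on_Base assms k_algebra_tensor inj_on_tensor_name_tensor)
qed

text \<open>The renaming maps are isomorphisms: \<open>A\<^sup>1 \<cong> A\<close> and \<open>A\<^sup>n\<^sup>+\<^sup>1 \<cong> A\<^sup>n \<otimes> A\<close>.\<close>

lemma tensor_power_1: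
  assumes "k_algebra A"
  shows "Base \<in> ring_iso A (tensor_power A 1)"
    and "a \<in> carrier A \<Longrightarrow> Base (c \<odot>\<^bsub>A\<^esub> a) = c \<odot>\<^bsub>tensor_power A 1\<^esub> Base a"
  using relabel_iso(2,3)[OF assms inj_on_Base] by simp_all

lemma tensor_power_Suc:
  assumes "k_algebra A" "n \<ge> 1"
  shows "tensor_name \<in> ring_iso (tensor (tensor_power A n) A) (tensor_power A (Suc n))"
    and "t \<in> carrier (tensor (tensor_power A n) A) \<Longrightarrow>
      tensor_name (c \<odot>\<^bsub>tensor (tensor_power A n) A\<^esub> t) = c \<odot>\<^bsub>tensor_power A (Suc n)\<^esub> tensor_name t"
  using relabel_iso(2,3)[OF k_algebra_tensor inj_on_tensor_name_tensor, OF k_algebra_tensor_power _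
      k_algebra_tensor_power, OF assms(1) assms(1) assms(1) assms(1)] assms(2)
  by simp_all


section \<open>Polynomial identity rings\<close>

text \<open>
  The elements of \<open>\<int>\<langle>X\<^sub>0, X\<^sub>1, \<dots>\<rangle>\<close> are the finitely supported functions \<open>nat list \<Rightarrow>\<^sub>0 int\<close>.
\<close>

definition nc_poly_eval ::
    "('a, 'e) ring_scheme \<Rightarrow> (nat list \<Rightarrow>\<^sub>0 int) \<Rightarrow> (nat \<Rightarrow> 'a) \<Rightarrow> 'a" where
  "nc_poly_eval R f \<rho> =
    (\<Oplus>\<^bsub>R\<^esub>w\<in>Poly_Mapping.keys f.
      add_pow R (Poly_Mapping.lookup f w) (foldr (\<lambda>i a. \<rho> i \<otimes>\<^bsub>R\<^esub> a) w \<one>\<^bsub>R\<^esub>))"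

text \<open>
  Such a polynomial is monic if some word of maximal length in its support has coefficient 1.
  A polynomial identity ring is a ring satisfying a monic identity (McConnell and Robson,
  Noncommutative Noetherian Rings).
\<close>

definition nc_monic :: "(nat list \<Rightarrow>\<^sub>0 int) \<Rightarrow> bool" where
  "nc_monic f \<longleftrightarrow> (\<exists>w. Poly_Mapping.lookup f w = 1 \<and>
    (\<forall>u\<in>Poly_Mapping.keys f. length u \<le> length w))"

definition PI_ring :: "('a, 'e) ring_scheme \<Rightarrow> bool" where
  "PI_ring R \<longleftrightarrow> (\<exists>f. nc_monic f \<and>
    (\<forall>\<rho>. (\<forall>i. \<rho> i \<in> carrier R) \<longrightarrow> nc_poly_eval R f \<rho> = \<zero>\<^bsub>R\<^esub>))"


section \<open>Representations\<close>

text \<open>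
  \<open>\<rho>\<close> is a homomorphism of unital algebras from \<open>A\<close> to the endomorphism algebra of the vector
  space \<open>V\<close>. The fields \<open>mult\<close> and \<open>one\<close> of the record \<open>V\<close> play no role.
\<close>

definition representation ::
    "('k::field, 'a) module \<Rightarrow> ('k, 'v) module \<Rightarrow> ('a \<Rightarrow> 'v \<Rightarrow> 'v) \<Rightarrow> bool" where
  "representation A V \<rho> \<longleftrightarrow>
    module (ring_of_type_algebra :: 'k ring) V \<and>
    (\<forall>a\<in>carrier A. \<forall>v\<in>carrier V. \<rho> a v \<in> carrier V) \<and>
    (\<forall>a\<in>carrier A. \<forall>v\<in>carrier V. \<forall>w\<in>carrier V. \<rho> a (v \<oplus>\<^bsub>V\<^esub> w) = \<rho> a v \<oplus>\<^bsub>V\<^esub> \<rho> a w) \<and>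
    (\<forall>a\<in>carrier A. \<forall>c. \<forall>v\<in>carrier V. \<rho> a (c \<odot>\<^bsub>V\<^esub> v) = c \<odot>\<^bsub>V\<^esub> \<rho> a v) \<and>
    (\<forall>a\<in>carrier A. \<forall>b\<in>carrier A. \<forall>v\<in>carrier V. \<rho> (a \<oplus>\<^bsub>A\<^esub> b) v = \<rho> a v \<oplus>\<^bsub>V\<^esub> \<rho> b v) \<and>
    (\<forall>c. \<forall>a\<in>carrier A. \<forall>v\<in>carrier V. \<rho> (c \<odot>\<^bsub>A\<^esub> a) v = c \<odot>\<^bsub>V\<^esub> \<rho> a v) \<and>
    (\<forall>a\<in>carrier A. \<forall>b\<in>carrier A. \<forall>v\<in>carrier V. \<rho> (a \<otimes>\<^bsub>A\<^esub> b) v = \<rho> a (\<rho> b v)) \<and>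
    (\<forall>v\<in>carrier V. \<rho> \<one>\<^bsub>A\<^esub> v = v)"

definition faithful_rep ::
    "('k::field, 'a) module \<Rightarrow> ('k, 'v) module \<Rightarrow> ('a \<Rightarrow> 'v \<Rightarrow> 'v) \<Rightarrow> bool" where
  "faithful_rep A V \<rho> \<longleftrightarrow>
    (\<forall>a\<in>carrier A. (\<forall>v\<in>carrier V. \<rho> a v = \<zero>\<^bsub>V\<^esub>) \<longrightarrow> a = \<zero>\<^bsub>A\<^esub>)"

definition irreducible_rep ::
    "('k::field, 'a) module \<Rightarrow> ('k, 'v) module \<Rightarrow> ('a \<Rightarrow> 'v \<Rightarrow> 'v) \<Rightarrow> bool" where
  "irreducible_rep A V \<rho> \<longleftrightarrow>
    carrier V \<noteq> {\<zero>\<^bsub>V\<^esub>} \<and>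
    (\<forall>W. submodule W (ring_of_type_algebra :: 'k ring) V \<and>
         (\<forall>a\<in>carrier A. \<forall>w\<in>W. \<rho> a w \<in> W) \<longrightarrow>
       W = {\<zero>\<^bsub>V\<^esub>} \<or> W = carrier V)"

text \<open>
  The vectors are taken in the type \<open>'a set\<close>, which is no restriction: an irreducible
  representation is isomorphic to a quotient of \<open>A\<close> by a left ideal, and the elements of the
  quotient are sets of elements of \<open>A\<close>.
\<close>

definition has_faithful_irreducible_rep :: "('k::field, 'a) module \<Rightarrow> bool" where
  "has_faithful_irreducible_rep A \<longleftrightarrow>
    (\<exists>(V :: ('k, 'a set) module) \<rho>.
      representation A V \<rho> \<and> faithful_rep A V \<rho> \<and> irreducible_rep A V \<rho>)"


section \<open>The algebras $H_{p,q}$ and $A_p(r,s)$\<close>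

datatype gen = GX | GY | GZ

definition H_relations :: "'k::field \<Rightarrow> 'k \<Rightarrow> (gen list \<Rightarrow>\<^sub>0 'k) set" where
  "H_relations p q =
    (let F = free_algebra; x = free_gen GX; y = free_gen GY; z = free_gen GZ in
      {z \<otimes>\<^bsub>F\<^esub> x \<ominus>\<^bsub>F\<^esub> (inverse p \<odot>\<^bsub>F\<^esub> (x \<otimes>\<^bsub>F\<^esub> z)),
       z \<otimes>\<^bsub>F\<^esub> y \<ominus>\<^bsub>F\<^esub> (p \<odot>\<^bsub>F\<^esub> (y \<otimes>\<^bsub>F\<^esub> z)),
       y \<otimes>\<^bsub>F\<^esub> x \<ominus>\<^bsub>F\<^esub> (q \<odot>\<^bsub>F\<^esub> (x \<otimes>\<^bsub>F\<^esub> y)) \<ominus>\<^bsub>F\<^esub> z})"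

definition H_ideal :: "'k::field \<Rightarrow> 'k \<Rightarrow> (gen list \<Rightarrow>\<^sub>0 'k) set" where
  "H_ideal p q = Idl\<^bsub>free_algebra\<^esub> (H_relations p q)"

definition H_alg :: "'k::field \<Rightarrow> 'k \<Rightarrow> ('k, (gen list \<Rightarrow>\<^sub>0 'k) set) module" where
  "H_alg p q = quot_algebra free_algebra (H_ideal p q)"

lemma k_algebra_free_algebra: "k_algebra free_algebra"
  unfolding free_algebra_def by (rule k_algebra_monoid_algebra) (auto intro: monoidI)

lemma ideal_H_ideal: "ideal (H_ideal p q) free_algebra"
proof -
  interpret F: ring "free_algebra :: ('a, gen list \<Rightarrow>\<^sub>0 'a) module"
    by (rule k_algebraD(1)[OF k_algebra_free_algebra])
  have g: "free_gen v \<in> carrier (free_algebra :: ('a, gen list \<Rightarrow>\<^sub>0 'a) module)" for v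
    by (simp add: free_gen_def free_algebra_def monoid_algebra_def)
  show ?thesis unfolding H_ideal_def
    by (rule F.genideal_ideal) (auto simp: H_relations_def Let_def g k_algebraD(2)[OF k_algebra_free_algebra])
qed

lemma k_algebra_H_alg: "k_algebra (H_alg p q)"
  unfolding H_alg_def by (intro k_algebra_quot_algebra k_algebra_free_algebra ideal_H_ideal)

definition H_gen :: "'k::field \<Rightarrow> 'k \<Rightarrow> gen \<Rightarrow> (gen list \<Rightarrow>\<^sub>0 'k) set" where
  "H_gen p q v = H_ideal p q +>\<^bsub>free_algebra\<^esub> free_gen v"

definition H_Omega :: "'k::field \<Rightarrow> 'k \<Rightarrow> nat \<Rightarrow> nat \<Rightarrow> (gen list \<Rightarrow>\<^sub>0 'k) set" where
  "H_Omega p q r s =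
    (let H = H_alg p q; x = H_gen p q GX; y = H_gen p q GY; z = H_gen p q GZ in
      (y \<otimes>\<^bsub>H\<^esub> x \<ominus>\<^bsub>H\<^esub> (inverse p \<odot>\<^bsub>H\<^esub> (x \<otimes>\<^bsub>H\<^esub> y))) [^]\<^bsub>H\<^esub> r \<otimes>\<^bsub>H\<^esub> z [^]\<^bsub>H\<^esub> s)"

text \<open>
  The set \<open>(\<Omega> - 1) H\<close> is a two-sided ideal because \<open>\<Omega>\<close> is central when
  \<open>q ^ r = p ^ s\<close>; only in this case is \<open>A_alg p q r s\<close> meaningful.
\<close>

definition A_alg ::
    "'k::field \<Rightarrow> 'k \<Rightarrow> nat \<Rightarrow> nat \<Rightarrow> ('k, (gen list \<Rightarrow>\<^sub>0 'k) set set) module" where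
  "A_alg p q r s =
    (let H = H_alg p q in
      quot_algebra H {(H_Omega p q r s \<ominus>\<^bsub>H\<^esub> \<one>\<^bsub>H\<^esub>) \<otimes>\<^bsub>H\<^esub> h | h. h \<in> carrier H})"

end

theory Submission
  imports Defs "HOL-Combinatorics.Permutations" "HOL-Computational_Algebra.Polynomial" "HOL-Library.Nat_Bijection"
begin

text \<open>
  The algebra \<open>H\<close> acts on the space with basis \<open>e\<^sub>0, e\<^sub>1, \<dots>\<close> like the Heisenberg algebra acts on Fock
  space: \<open>x\<close> raises \<open>e\<^sub>m\<close> to \<open>e\<^bsub>m+1\<^esub>\<close>, \<open>z\<close> acts by the scalar \<open>p\<^sup>-\<^sup>m\<close>, and \<open>y\<close> lowers \<open>e\<^sub>m\<close> to a multiple of \<open>e\<^bsub>m-1\<^esub>\<close>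
  with the factor \<open>(q\<^sup>m - p\<^sup>-\<^sup>m) / (q - p\<^sup>-\<^sup>1)\<close>. The element \<open>\<theta> = y x - p\<^sup>-\<^sup>1 x y\<close> then acts by \<open>q\<^sup>m\<close>, and
  \<open>\<Omega> = \<theta>\<^sup>r z\<^sup>s\<close> by \<open>(q\<^sup>r p\<^sup>-\<^sup>s)\<^sup>m = 1\<close>, so that this is a representation of \<open>H / (\<Omega> - 1) H\<close>.

  Because \<open>p q \<noteq> 1\<close>, the products \<open>x y\<close> and \<open>y x\<close> are combinations of \<open>\<theta>\<close> and \<open>z\<close>, and \<open>H\<close> is spanned by the
  monomials \<open>x\<^sup>i z\<^sup>j \<theta>\<^sup>k\<close> and \<open>y\<^sup>i z\<^sup>j \<theta>\<^sup>k\<close> (\<open>span_monomials\<close>). If \<open>p\<close> were a root of unity, so would be \<open>q\<close>; then suitable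
  powers of \<open>x, y, z, \<theta>\<close> would be central, \<open>H\<close> would be a finitely generated module over its centre, and
  a standard polynomial would be an identity of \<open>H\<close> (\<open>PI_ring_if_roots_of_unity\<close>). Hence \<open>p\<close> is not a
  root of unity.

  It follows that all lowering factors with \<open>m > 0\<close> are nonzero and that \<open>z\<close> has distinct eigenvalues. So any
  basis vector can be moved to any other by an element that annihilates finitely many prescribed
  other basis vectors (\<open>separating_A_act\<close>). The representation is also faithful (\<open>faithful_A_act\<close>): modulo \<open>\<Omega> = 1\<close>
  a monomial is determined by its degree and by \<open>n = s k - r j\<close>, where the coprimality of \<open>r\<close> and \<open>s\<close>
  enters; monomials of one degree act on \<open>e\<^sub>m\<close> by exponentials in \<open>m\<close> with distinct bases for distinct \<open>n\<close>, up
  to a common nonzero factor, and distinct exponentials are linearly independent.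

  Both properties pass from two representations to their tensor product
  (\<open>faithful_separating_rep_tensor\<close>), hence hold for all tensor powers, and the separation property
  implies irreducibility.
\<close>

section \<open>Computing in an algebra over a field\<close>

locale k_alg = ring A for A :: "('k::field, 'a) module" (structure) +
  assumes k_algebra: "k_algebra A"
begin

lemmas kD = k_algebraD[OF k_algebra]
lemmas smult_closed [simp, intro] = kD(2)
lemmas smult_one [simp] = kD(6)
lemmas smult_l [simp] = kD(7)
lemmas smult_r [simp] = kD(8)
lemmas smult_add = kD(4)
lemmas add_smult = kD(3)

lemma smult_smult [simp]: "a \<in> carrier A \<Longrightarrow> c \<odot> (d \<odot> a) = (c * d) \<odot> a"
  by (simp add: kD(5))

lemma zero_smult [simp]:
  assumes "a \<in> carrier A" shows "0 \<odot> a = \<zero>"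
proof -
  have "0 \<odot> a \<oplus> 0 \<odot> a = 0 \<odot> a" using add_smult[OF assms, of 0 0] by simp
  then show ?thesis using assms add.l_cancel_one smult_closed by blast
qed

lemma smult_zero [simp]: "c \<odot> \<zero> = \<zero>"
proof -
  have "c \<odot> \<zero> \<oplus> c \<odot> \<zero> = c \<odot> \<zero>" using smult_add[of \<zero> \<zero> c] by simp
  then show ?thesis using add.l_cancel_one smult_closed zero_closed by blast
qed

lemma minus_one_smult:
  assumes "a \<in> carrier A" shows "(- 1) \<odot> a = \<ominus> a"
proof -
  have "(- 1) \<odot> a \<oplus> 1 \<odot> a = \<zero>" using add_smult[OF assms, of "- 1" 1] assms by simp
  then show ?thesis using assms by (simp add: minus_equality)
qed

lemma minus_smult:
  assumes "a \<in> carrier A" "b \<in> carrier A" shows "a \<ominus> b = a \<oplus> (- 1) \<odot> b"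
  using assms by (simp add: minus_one_smult minus_eq)

lemma pow_Suc_left: "a \<in> carrier A \<Longrightarrow> a [^] Suc n = a \<otimes> a [^] n"
  using nat_pow_comm[of a n 1] by simp

text \<open>
  Scalar commutation \<open>a b = c b a\<close> is multiplicative in each of \<open>a\<close> and \<open>b\<close>, so that every reordering
  of powers of the generators is reduced to the reordering of two generators.
\<close>

definition q_commute :: "'k \<Rightarrow> 'a \<Rightarrow> 'a \<Rightarrow> bool" where
  "q_commute c a b \<longleftrightarrow> a \<otimes> b = c \<odot> (b \<otimes> a)"

lemma q_commuteD: "q_commute c a b \<Longrightarrow> a \<otimes> b = c \<odot> (b \<otimes> a)"
  by (simp add: q_commute_def)

lemma q_commute_mult_left:
  assumes "a \<in> carrier A" "b \<in> carrier A" "x \<in> carrier A" "q_commute c a x" "q_commute d b x"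
  shows "q_commute (c * d) (a \<otimes> b) x"
proof -
  have "a \<otimes> b \<otimes> x = a \<otimes> (b \<otimes> x)" using assms by (simp add: m_assoc)
  also have "\<dots> = d \<odot> (a \<otimes> x \<otimes> b)" using assms(1-3) by (simp add: q_commuteD[OF assms(5)] m_assoc)
  also have "\<dots> = (c * d) \<odot> (x \<otimes> a \<otimes> b)" using assms(1-3) by (simp add: q_commuteD[OF assms(4)] mult.commute)
  also have "\<dots> = (c * d) \<odot> (x \<otimes> (a \<otimes> b))" using assms by (simp add: m_assoc)
  finally show ?thesis by (simp add: q_commute_def)
qed

lemma q_commute_mult_right:
  assumes "a \<in> carrier A" "b \<in> carrier A" "x \<in> carrier A" "q_commute c x a" "q_commute d x b"
  shows "q_commute (c * d) x (a \<otimes> b)"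
proof -
  have "x \<otimes> (a \<otimes> b) = x \<otimes> a \<otimes> b" using assms by (simp add: m_assoc)
  also have "\<dots> = c \<odot> (a \<otimes> (x \<otimes> b))" using assms by (simp add: q_commute_def m_assoc)
  also have "\<dots> = (c * d) \<odot> (a \<otimes> b \<otimes> x)" using assms by (simp add: q_commute_def m_assoc)
  finally show ?thesis by (simp add: q_commute_def)
qed

lemma q_commute_one [simp]: "a \<in> carrier A \<Longrightarrow> q_commute 1 \<one> a" "a \<in> carrier A \<Longrightarrow> q_commute 1 a \<one>"
  by (simp_all add: q_commute_def)

lemma q_commute_self: "a \<in> carrier A \<Longrightarrow> q_commute 1 a a"
  by (simp add: q_commute_def)

lemma q_commute_pow_left:
  assumes "a \<in> carrier A" "b \<in> carrier A" "q_commute c a b"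
  shows "q_commute (c ^ n) (a [^] (n::nat)) b"
proof (induction n)
  case 0 then show ?case using assms by simp
next
  case (Suc n)
  then show ?case using q_commute_mult_left[of "a [^] n" a b "c ^ n" c] assms by (simp add: mult.commute)
qed

lemma q_commute_pow_right:
  assumes "a \<in> carrier A" "b \<in> carrier A" "q_commute c a b"
  shows "q_commute (c ^ n) a (b [^] (n::nat))"
proof (induction n)
  case 0 then show ?case using assms by simp
next
  case (Suc n)
  then show ?case using q_commute_mult_right[of "b [^] n" b a "c ^ n" c] assms by (simp add: mult.commute)
qed

definition centre :: "'a set" where
  "centre = {c \<in> carrier A. \<forall>a\<in>carrier A. c \<otimes> a = a \<otimes> c}"

lemma centreD: "c \<in> centre \<Longrightarrow> c \<in> carrier A" "c \<in> centre \<Longrightarrow> a \<in> carrier A \<Longrightarrow> c \<otimes> a = a \<otimes> c"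
  by (auto simp: centre_def)

lemma centre_mult:
  assumes c: "c \<in> centre" and d: "d \<in> centre" shows "c \<otimes> d \<in> centre"
proof -
  note cd = centreD(1)[OF c] centreD(1)[OF d]
  have "c \<otimes> d \<otimes> a = a \<otimes> (c \<otimes> d)" if a: "a \<in> carrier A" for a
  proof -
    have "c \<otimes> d \<otimes> a = c \<otimes> (a \<otimes> d)"
      by (simp only: m_assoc cd a centreD(2)[OF d a])
    also have "\<dots> = c \<otimes> a \<otimes> d" by (simp only: m_assoc cd a)
    also have "\<dots> = a \<otimes> (c \<otimes> d)" by (simp only: m_assoc cd a centreD(2)[OF c a])
    finally show ?thesis .
  qed
  then show ?thesis using cd by (simp add: centre_def)
qed

lemma centre_one: "\<one> \<in> centre" by (simp add: centre_def)

lemma centre_pow: "c \<in> centre \<Longrightarrow> c [^] (n::nat) \<in> centre"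
  by (induction n) (simp_all add: centre_mult centre_one)

lemma centre_smult: "c \<in> centre \<Longrightarrow> k \<odot> c \<in> centre" by (simp add: centre_def)

lemma centre_add: "c \<in> centre \<Longrightarrow> d \<in> centre \<Longrightarrow> c \<oplus> d \<in> centre"
  by (simp add: centre_def l_distr r_distr)

lemma ideal_centre_mult:
  assumes c: "c \<in> centre" shows "ideal {c \<otimes> h | h. h \<in> carrier A} A"
proof -
  note cc = centreD(1)[OF c]
  have "subgroup {c \<otimes> h | h. h \<in> carrier A} (add_monoid A)"
  proof (rule add.subgroupI)
    show "{c \<otimes> h | h. h \<in> carrier A} \<noteq> {}" using zero_closed by blast
  next
    fix a assume "a \<in> {c \<otimes> h | h. h \<in> carrier A}"
    then obtain h where "a = c \<otimes> h" "h \<in> carrier A" by blast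
    then have "\<ominus> a = c \<otimes> (\<ominus> h) \<and> \<ominus> h \<in> carrier A" using cc by (simp add: r_minus)
    then show "\<ominus> a \<in> {c \<otimes> h | h. h \<in> carrier A}" by blast
  next
    fix a b assume "a \<in> {c \<otimes> h | h. h \<in> carrier A}" "b \<in> {c \<otimes> h | h. h \<in> carrier A}"
    then obtain h h' where "a = c \<otimes> h" "h \<in> carrier A" "b = c \<otimes> h'" "h' \<in> carrier A" by blast
    then have "a \<oplus> b = c \<otimes> (h \<oplus> h') \<and> h \<oplus> h' \<in> carrier A" using cc by (simp add: r_distr)
    then show "a \<oplus> b \<in> {c \<otimes> h | h. h \<in> carrier A}" by blast
  qed (use cc in auto)
  then show ?thesis
  proof (rule idealI[OF ring_axioms])
    fix a x assume "a \<in> {c \<otimes> h | h. h \<in> carrier A}" and x: "x \<in> carrier A"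
    then obtain h where a: "a = c \<otimes> h" "h \<in> carrier A" by blast
    have "x \<otimes> a = c \<otimes> (x \<otimes> h)"
      using a x cc centreD(2)[OF c x] by (simp flip: m_assoc)
    then show "x \<otimes> a \<in> {c \<otimes> h | h. h \<in> carrier A}" using a x by auto
    have "a \<otimes> x = c \<otimes> (h \<otimes> x)" using a x cc by (simp add: m_assoc)
    then show "a \<otimes> x \<in> {c \<otimes> h | h. h \<in> carrier A}" using a x by auto
  qed
qed

text \<open>
  Membership is defined by closure rules rather than by finite sums, because the span is only
  ever used through induction on its elements.
\<close>

inductive_set lin_span :: "'a set \<Rightarrow> 'a set" for S where
  zero: "\<zero> \<in> lin_span S"
| base: "a \<in> S \<Longrightarrow> a \<in> lin_span S"
| add: "a \<in> lin_span S \<Longrightarrow> b \<in> lin_span S \<Longrightarrow> a \<oplus> b \<in> lin_span S"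
| smult: "a \<in> lin_span S \<Longrightarrow> c \<odot> a \<in> lin_span S"

lemma lin_span_closed:
  assumes "S \<subseteq> carrier A" "a \<in> lin_span S" shows "a \<in> carrier A"
  using assms(2,1) by induction auto

lemma lin_span_mult_left:
  assumes "S \<subseteq> carrier A" "g \<in> carrier A" "\<And>s. s \<in> S \<Longrightarrow> g \<otimes> s \<in> lin_span S" "a \<in> lin_span S"
  shows "g \<otimes> a \<in> lin_span S"
  using assms(4)
proof induction
  case (add a b)
  then show ?case using assms lin_span_closed[OF assms(1)] by (simp add: r_distr lin_span.add)
next
  case (smult a c)
  then show ?case using assms lin_span_closed[OF assms(1)] by (simp add: lin_span.smult)
qed (use assms in \<open>auto intro: lin_span.intros\<close>)

end

section \<open>Quantum Heisenberg algebras\<close>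

text \<open>
  The assumption \<open>generated\<close> says that \<open>x, y, z\<close> generate \<open>H\<close>, in the form of an induction
  principle: a subspace that contains \<open>1\<close> and is stable under left multiplication by the
  generators is everything. The element \<open>\<theta>\<close> commutes with \<open>z\<close> and commutes with \<open>x\<close> and \<open>y\<close> up to
  a scalar. Since \<open>p q \<noteq> 1\<close>, the products \<open>x y\<close> and \<open>y x\<close> are both linear combinations of \<open>\<theta>\<close>
  and \<open>z\<close>, which makes \<open>H\<close> a generalized Weyl algebra over \<open>k[z, \<theta>]\<close>.
\<close>

locale q_heisenberg = k_alg H for H :: "('k::field, 'a) module" (structure) +
  fixes p q :: 'k and x y z \<theta> :: 'a
  assumes p0: "p \<noteq> 0" and q0: "q \<noteq> 0" and pq: "p * q \<noteq> 1"
    and xyz_closed: "x \<in> carrier H" "y \<in> carrier H" "z \<in> carrier H"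
    and zx_eq: "z \<otimes> x = inverse p \<odot> (x \<otimes> z)"
    and zy_eq: "z \<otimes> y = p \<odot> (y \<otimes> z)"
    and yx_eq: "y \<otimes> x = q \<odot> (x \<otimes> y) \<oplus> z"
    and theta_def: "\<theta> = y \<otimes> x \<ominus> inverse p \<odot> (x \<otimes> y)"
    and generated: "\<And>W. W \<subseteq> carrier H \<Longrightarrow> \<one> \<in> W \<Longrightarrow>
      (\<And>a b. a \<in> W \<Longrightarrow> b \<in> W \<Longrightarrow> a \<oplus> b \<in> W) \<Longrightarrow> (\<And>a c. a \<in> W \<Longrightarrow> c \<odot> a \<in> W) \<Longrightarrow>
      (\<And>a g. a \<in> W \<Longrightarrow> g \<in> {x, y, z} \<Longrightarrow> g \<otimes> a \<in> W) \<Longrightarrow> carrier H \<subseteq> W"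
begin

declare xyz_closed [simp]

lemma theta_closed [simp]: "\<theta> \<in> carrier H" by (simp add: theta_def)

definition \<delta> where "\<delta> = q - inverse p"

lemma delta0: "\<delta> \<noteq> 0"
proof
  assume "\<delta> = 0" then have "q = inverse p" by (simp add: \<delta>_def)
  then have "p * q = 1" using p0 by simp
  then show False using pq by simp
qed

lemma theta_eq: "\<theta> = \<delta> \<odot> (x \<otimes> y) \<oplus> z"
proof -
  have "\<theta> = q \<odot> (x \<otimes> y) \<oplus> z \<oplus> (- inverse p) \<odot> (x \<otimes> y)"
    by (simp add: theta_def yx_eq minus_smult)
  also have "\<dots> = (q \<odot> (x \<otimes> y) \<oplus> (- inverse p) \<odot> (x \<otimes> y)) \<oplus> z"
    by (simp add: a_ac)
  finally show ?thesis by (simp add: add_smult[symmetric] \<delta>_def)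
qed

lemma delta_xy: "\<delta> \<odot> (x \<otimes> y) = \<theta> \<ominus> z"
  by (simp add: theta_eq minus_eq a_assoc r_neg)

lemma delta_yx: "\<delta> \<odot> (y \<otimes> x) = q \<odot> \<theta> \<oplus> (- inverse p) \<odot> z"
proof -
  have "\<delta> \<odot> (y \<otimes> x) = q \<odot> (\<delta> \<odot> (x \<otimes> y)) \<oplus> \<delta> \<odot> z"
    by (simp add: yx_eq smult_add mult.commute)
  also have "\<dots> = q \<odot> \<theta> \<oplus> ((- q) \<odot> z \<oplus> \<delta> \<odot> z)"
    unfolding delta_xy by (simp add: minus_smult smult_add a_assoc)
  also have "(- q) \<odot> z \<oplus> \<delta> \<odot> z = (- inverse p) \<odot> z"
    by (simp add: add_smult[symmetric] \<delta>_def)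
  finally show ?thesis .
qed

lemma xy_eq_theta: "x \<otimes> y = inverse \<delta> \<odot> \<theta> \<oplus> (- inverse \<delta>) \<odot> z"
proof -
  have "x \<otimes> y = inverse \<delta> \<odot> (\<delta> \<odot> (x \<otimes> y))" using delta0 by simp
  then show ?thesis unfolding delta_xy by (simp add: minus_smult smult_add)
qed

lemma yx_eq_theta: "y \<otimes> x = (inverse \<delta> * q) \<odot> \<theta> \<oplus> (- inverse \<delta> * inverse p) \<odot> z"
proof -
  have "y \<otimes> x = inverse \<delta> \<odot> (\<delta> \<odot> (y \<otimes> x))" using delta0 by simp
  then show ?thesis unfolding delta_yx by (simp add: smult_add)
qed

lemma qc_zx: "q_commute (inverse p) z x" and qc_zy: "q_commute p z y"
  using zx_eq zy_eq by (simp_all add: q_commute_def)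

lemma qc_z_theta: "q_commute 1 z \<theta>"
proof -
  have "q_commute 1 z (x \<otimes> y)"
    using q_commute_mult_right[OF _ _ _ qc_zx qc_zy] p0 by simp
  then show ?thesis by (simp add: theta_eq q_commute_def r_distr l_distr)
qed

text \<open>
  Both relations come from computing \<open>x y x\<close>, respectively \<open>y x y\<close>, in two ways, with the inner
  product expressed by \<open>\<theta>\<close> and \<open>z\<close>.
\<close>

lemma qc_theta_x: "q_commute q \<theta> x"
proof -
  have "\<theta> \<otimes> x = x \<otimes> (\<delta> \<odot> (y \<otimes> x)) \<oplus> z \<otimes> x"
    by (simp add: theta_eq l_distr m_assoc)
  also have "\<dots> = x \<otimes> (q \<odot> \<theta>) \<oplus> ((- inverse p) \<odot> (x \<otimes> z) \<oplus> inverse p \<odot> (x \<otimes> z))"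
    unfolding delta_yx zx_eq by (simp add: r_distr a_assoc)
  also have "(- inverse p) \<odot> (x \<otimes> z) \<oplus> inverse p \<odot> (x \<otimes> z) = \<zero>"
    by (simp add: add_smult[symmetric])
  finally show ?thesis by (simp add: q_commute_def)
qed

lemma qc_theta_y: "q_commute (inverse q) \<theta> y"
proof -
  have "y \<otimes> \<theta> = \<delta> \<odot> (y \<otimes> x) \<otimes> y \<oplus> y \<otimes> z"
    by (simp add: theta_eq r_distr m_assoc)
  also have "\<dots> = q \<odot> (\<theta> \<otimes> y) \<oplus> ((- inverse p) \<odot> (z \<otimes> y) \<oplus> y \<otimes> z)"
    unfolding delta_yx by (simp add: l_distr a_assoc)
  also have "(- inverse p) \<odot> (z \<otimes> y) \<oplus> y \<otimes> z = (- 1) \<odot> (y \<otimes> z) \<oplus> 1 \<odot> (y \<otimes> z)"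
    using p0 by (simp add: zy_eq)
  also have "\<dots> = \<zero>" using add_smult[of "y \<otimes> z" "- 1" 1] by simp
  finally show ?thesis using q0 by (simp add: q_commute_def)
qed

text \<open>
  The integer \<open>d\<close> is the degree for the grading with \<open>deg x = 1\<close>, \<open>deg y = -1\<close>, \<open>deg z = 0\<close>; one
  index covers the powers of both \<open>x\<close> and \<open>y\<close>.
\<close>

definition B :: "int \<Rightarrow> 'a" where
  "B d = (if d \<ge> 0 then x [^] nat d else y [^] nat (- d))"

definition M :: "int \<Rightarrow> nat \<Rightarrow> nat \<Rightarrow> 'a" where
  "M d j k = B d \<otimes> (z [^] j \<otimes> \<theta> [^] k)"

lemma B_closed [simp]: "B d \<in> carrier H"
  unfolding B_def using xyz_closed by (metis nat_pow_closed)
lemma M_closed [simp]: "M d j k \<in> carrier H" by (simp add: M_def)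

lemma B_of_nat: "B (int n) = x [^] n" "B (- int n) = y [^] n"
  by (simp_all add: B_def)

lemma z_past: "q_commute (inverse p ^ n) z (x [^] n)" "q_commute (p ^ n) z (y [^] n)"
  using qc_zx qc_zy by (simp_all add: q_commute_pow_right)

lemma theta_past: "q_commute (q ^ n) \<theta> (x [^] n)" "q_commute (inverse q ^ n) \<theta> (y [^] n)"
  using qc_theta_x qc_theta_y by (simp_all add: q_commute_pow_right)

lemma z_mult_normal: "z \<otimes> (z [^] (j::nat) \<otimes> \<theta> [^] k) = z [^] Suc j \<otimes> \<theta> [^] (k::nat)"
  by (simp only: pow_Suc_left m_assoc xyz_closed theta_closed nat_pow_closed)

lemma theta_mult_normal: "\<theta> \<otimes> (z [^] (j::nat) \<otimes> \<theta> [^] k) = z [^] j \<otimes> \<theta> [^] (Suc k::nat)"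
proof -
  have "q_commute 1 (z [^] j) \<theta>" using q_commute_pow_left[OF _ _ qc_z_theta, of j] by simp
  then have "\<theta> \<otimes> z [^] j = z [^] j \<otimes> \<theta>" by (simp add: q_commute_def)
  then have "\<theta> \<otimes> (z [^] j \<otimes> \<theta> [^] k) = z [^] j \<otimes> (\<theta> \<otimes> \<theta> [^] k)"
    by (simp add: m_assoc[symmetric])
  then show ?thesis by (simp only: pow_Suc_left theta_closed)
qed

lemma push:
  assumes "q_commute c g b" "g \<in> carrier H" "b \<in> carrier H" "u \<in> carrier H"
  shows "g \<otimes> (b \<otimes> u) = c \<odot> (b \<otimes> (g \<otimes> u))"
  using assms by (simp add: q_commute_def m_assoc[symmetric])

text \<open>
  Left multiplication by \<open>z\<close> or \<open>\<theta>\<close> permutes the monomials up to a scalar.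
\<close>

lemma z_theta_mult_M:
  "z \<otimes> M (int n) j k = (inverse p ^ n) \<odot> M (int n) (Suc j) k"
  "z \<otimes> M (- int n) j k = (p ^ n) \<odot> M (- int n) (Suc j) k"
  "\<theta> \<otimes> M (int n) j k = (q ^ n) \<odot> M (int n) j (Suc k)"
  "\<theta> \<otimes> M (- int n) j k = (inverse q ^ n) \<odot> M (- int n) j (Suc k)"
  unfolding M_def B_of_nat
  using push[OF z_past(1)] push[OF z_past(2)] push[OF theta_past(1)] push[OF theta_past(2)]
  by (simp_all only: z_mult_normal theta_mult_normal xyz_closed theta_closed nat_pow_closed m_closed)

lemma Suc_B: "B (int (Suc n)) = x \<otimes> B (int n)" "B (- int (Suc n)) = y \<otimes> B (- int n)"
  unfolding B_of_nat by (simp_all only: pow_Suc_left xyz_closed)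

lemma Suc_M: "M (int (Suc n)) j k = x \<otimes> M (int n) j k" "M (- int (Suc n)) j k = y \<otimes> M (- int n) j k"
  unfolding M_def Suc_B by (simp_all add: m_assoc)

definition monomials where "monomials = {M d j k | d j k. True}"

lemma monomials_closed: "monomials \<subseteq> carrier H" by (auto simp: monomials_def)

lemma M_span: "M d j k \<in> lin_span monomials"
  by (rule lin_span.base) (auto simp: monomials_def)

lemma int_dest: obtains n where "d = int n" | n where "d = - int (Suc n)"
  by (cases d rule: int_cases) auto

text \<open>
  A factor \<open>x\<close> lengthens a power of \<open>x\<close>; it meets a power of \<open>y\<close> in \<open>x y\<close>, which is a combination
  of \<open>\<theta>\<close> and \<open>z\<close>, and these move into place. The factor \<open>y\<close> is treated symmetrically.
\<close>

lemma x_mult_M: "x \<otimes> M d j k \<in> lin_span monomials"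
proof (cases d rule: int_dest)
  case (1 n)
  then show ?thesis by (simp only: Suc_M[symmetric] M_span)
next
  case (2 n)
  have "x \<otimes> M d j k = (x \<otimes> y) \<otimes> M (- int n) j k"
    unfolding 2 Suc_M by (simp add: m_assoc)
  also have "\<dots> = inverse \<delta> \<odot> (\<theta> \<otimes> M (- int n) j k) \<oplus> (- inverse \<delta>) \<odot> (z \<otimes> M (- int n) j k)"
    unfolding xy_eq_theta by (simp add: l_distr)
  finally show ?thesis unfolding z_theta_mult_M
    by (simp only:) (intro lin_span.add lin_span.smult M_span)
qed

lemma y_mult_M: "y \<otimes> M d j k \<in> lin_span monomials"
proof (cases "- d" rule: int_dest)
  case (1 n)
  then have "d = - int n" by simp
  then show ?thesis by (simp only: Suc_M[symmetric] M_span)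
next
  case (2 n)
  then have d: "d = int (Suc n)" by simp
  have "y \<otimes> M d j k = (y \<otimes> x) \<otimes> M (int n) j k"
    unfolding d Suc_M by (simp add: m_assoc)
  also have "\<dots> = (inverse \<delta> * q) \<odot> (\<theta> \<otimes> M (int n) j k)
      \<oplus> (- inverse \<delta> * inverse p) \<odot> (z \<otimes> M (int n) j k)"
    unfolding yx_eq_theta by (simp add: l_distr)
  finally show ?thesis unfolding z_theta_mult_M
    by (simp only:) (intro lin_span.add lin_span.smult M_span)
qed

lemma z_mult_M: "z \<otimes> M d j k \<in> lin_span monomials"
  by (cases d rule: int_dest) (simp_all only: z_theta_mult_M lin_span.smult M_span)

theorem span_monomials: "lin_span monomials = carrier H"
proof
  show "lin_span monomials \<subseteq> carrier H" using lin_span_closed monomials_closed by blast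
  show "carrier H \<subseteq> lin_span monomials"
  proof (rule generated)
    show "\<one> \<in> lin_span monomials" using M_span[of 0 0 0] by (simp add: M_def B_def)
    show "g \<otimes> a \<in> lin_span monomials" if "a \<in> lin_span monomials" "g \<in> {x, y, z}" for a g
    proof (rule lin_span_mult_left[OF monomials_closed _ _ that(1)])
      show "g \<in> carrier H" using that by auto
      fix s assume "s \<in> monomials"
      then obtain d j k where "s = M d j k" by (auto simp: monomials_def)
      then show "g \<otimes> s \<in> lin_span monomials"
        using that(2) x_mult_M y_mult_M z_mult_M by blast
    qed
    show "lin_span monomials \<subseteq> carrier H" using lin_span_closed monomials_closed by blast
  qed (simp_all add: lin_span.add lin_span.smult)
qed

lemma centreI:
  assumes "c \<in> carrier H" "q_commute 1 c x" "q_commute 1 c y" "q_commute 1 c z"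
  shows "c \<in> centre"
proof -
  let ?W = "{a \<in> carrier H. q_commute 1 c a}"
  have "carrier H \<subseteq> ?W"
  proof (rule generated)
    show "a \<oplus> b \<in> ?W" if "a \<in> ?W" "b \<in> ?W" for a b
      using that assms(1) by (simp add: q_commute_def l_distr r_distr)
    show "k \<odot> a \<in> ?W" if "a \<in> ?W" for a k
      using that assms(1) by (simp add: q_commute_def)
    show "g \<otimes> a \<in> ?W" if "a \<in> ?W" "g \<in> {x, y, z}" for a g
      using that assms q_commute_mult_right[of g a c 1 1] by auto
  qed (use assms in auto)
  then have "c \<otimes> a = a \<otimes> c" if "a \<in> carrier H" for a
    using that assms(1) q_commuteD[of 1 c a] by (auto simp only: smult_one m_closed)
  then show ?thesis using assms(1) by (simp add: centre_def)
qed

lemma q_commute_sym: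
  assumes "a \<in> carrier H" "b \<in> carrier H" "q_commute c a b" "c \<noteq> 0"
  shows "q_commute (inverse c) b a"
  using assms by (simp add: q_commute_def)

lemma Omega_centre:
  assumes "q ^ r = p ^ s"
  shows "\<theta> [^] r \<otimes> z [^] s \<in> centre"
proof (rule centreI)
  have e: "p ^ s * inverse (p ^ s) = 1" "inverse (p ^ s) * p ^ s = 1" using p0 by simp_all
  have "q_commute (q ^ r * inverse p ^ s) (\<theta> [^] r \<otimes> z [^] s) x"
    by (rule q_commute_mult_left) (simp_all add: q_commute_pow_left qc_theta_x qc_zx)
  then show "q_commute 1 (\<theta> [^] r \<otimes> z [^] s) x"
    by (simp only: assms power_inverse e)
  have "q_commute (inverse q ^ r * p ^ s) (\<theta> [^] r \<otimes> z [^] s) y"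
    by (rule q_commute_mult_left) (simp_all add: q_commute_pow_left qc_theta_y qc_zy)
  then show "q_commute 1 (\<theta> [^] r \<otimes> z [^] s) y"
    by (simp only: assms power_inverse e)
  have "q_commute (1 ^ r * 1 ^ s) (\<theta> [^] r \<otimes> z [^] s) z"
    using q_commute_sym[OF _ _ qc_z_theta]
    by (intro q_commute_mult_left q_commute_pow_left) (simp_all add: q_commute_self)
  then show "q_commute 1 (\<theta> [^] r \<otimes> z [^] s) z" by simp
qed simp_all

text \<open>
  If \<open>p\<close> and \<open>q\<close> are roots of unity of order dividing \<open>m\<close>, the commutation scalars of \<open>m\<close>-th powers
  are \<open>1\<close>. Only \<open>x\<^sup>m\<close> against \<open>y\<close> and \<open>y\<^sup>m\<close> against \<open>x\<close> are not scalar commutations: there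
  \<open>y x\<^sup>m = (y x) x\<^sup>m\<^sup>-\<^sup>1\<close>, and moving \<open>y x\<close> past \<open>x\<^sup>m\<^sup>-\<^sup>1\<close> turns its coefficients into those of \<open>x y\<close>.
\<close>

lemma powers_centre:
  assumes m: "p ^ m = 1" "q ^ m = 1"
  shows "x [^] m \<in> centre" "y [^] m \<in> centre" "z [^] m \<in> centre" "\<theta> [^] m \<in> centre"
proof -
  have m': "inverse p ^ m = 1" "inverse q ^ m = 1" by (simp_all only: power_inverse m inverse_1)
  have theta_z: "q_commute 1 \<theta> z" using q_commute_sym[OF _ _ qc_z_theta] by simp
  note pow = q_commute_pow_left[of _ _ _ m]
  have Z: "q_commute 1 (z [^] m) x" "q_commute 1 (z [^] m) y" "q_commute 1 (z [^] m) z"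
    using pow[OF _ _ qc_zx] pow[OF _ _ qc_zy] pow[OF _ _ q_commute_self[of z]]
    by (simp_all only: m m' xyz_closed simp_thms power_one)
  have T: "q_commute 1 (\<theta> [^] m) x" "q_commute 1 (\<theta> [^] m) y" "q_commute 1 (\<theta> [^] m) z"
    using pow[OF _ _ qc_theta_x] pow[OF _ _ qc_theta_y] pow[OF _ _ theta_z]
    by (simp_all only: m m' xyz_closed theta_closed simp_thms power_one)
  show "z [^] m \<in> centre" "\<theta> [^] m \<in> centre"
    using Z T by (auto intro: centreI)
  have x: "q_commute 1 (x [^] m) x" and y: "q_commute 1 (y [^] m) y"
    using pow[OF _ _ q_commute_self[of x]] pow[OF _ _ q_commute_self[of y]]
    by (simp_all only: xyz_closed simp_thms power_one)
  have XZ: "q_commute 1 (x [^] m) z" and YZ: "q_commute 1 (y [^] m) z"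
    using q_commute_sym[OF _ _ z_past(1)[of m]] q_commute_sym[OF _ _ z_past(2)[of m]]
    by (simp_all only: m m' xyz_closed nat_pow_closed simp_thms one_neq_zero inverse_1)
  have XY': "q_commute 1 (x [^] m) y" and YX': "q_commute 1 (y [^] m) x"
  proof -
    show "q_commute 1 (x [^] m) y"
    proof (cases m)
      case (Suc n)
      have e: "q * q ^ n = 1" "inverse p * inverse p ^ n = 1"
        using m(2) m'(1) unfolding Suc power_Suc by simp_all
      have "y \<otimes> x [^] m = (y \<otimes> x) \<otimes> x [^] n"
        unfolding Suc pow_Suc_left[OF xyz_closed(1)] by (simp add: m_assoc)
      also have "\<dots> = (inverse \<delta> * q) \<odot> (\<theta> \<otimes> x [^] n) \<oplus> (- inverse \<delta> * inverse p) \<odot> (z \<otimes> x [^] n)"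
        unfolding yx_eq_theta by (simp add: l_distr)
      also have "\<dots> = (inverse \<delta> * (q * q ^ n)) \<odot> (x [^] n \<otimes> \<theta>) \<oplus>
          (- inverse \<delta> * (inverse p * inverse p ^ n)) \<odot> (x [^] n \<otimes> z)"
        by (simp add: q_commuteD[OF theta_past(1)] q_commuteD[OF z_past(1)] mult.assoc)
      also have "\<dots> = x [^] n \<otimes> (x \<otimes> y)" unfolding e xy_eq_theta by (simp add: r_distr)
      also have "\<dots> = x [^] m \<otimes> y" unfolding Suc by (simp add: m_assoc[symmetric])
      finally show ?thesis by (simp add: q_commute_def)
    qed simp
    show "q_commute 1 (y [^] m) x"
    proof (cases m)
      case (Suc n)
      have "inverse q * inverse q ^ n = 1" "p * p ^ n = 1"
        using m(1) m'(2) unfolding Suc power_Suc by simp_all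
      then have e: "inverse q ^ n = q" "p ^ n = inverse p"
        using p0 q0 by (simp_all add: field_simps)
      have "x \<otimes> y [^] m = (x \<otimes> y) \<otimes> y [^] n"
        unfolding Suc pow_Suc_left[OF xyz_closed(2)] by (simp add: m_assoc)
      also have "\<dots> = inverse \<delta> \<odot> (\<theta> \<otimes> y [^] n) \<oplus> (- inverse \<delta>) \<odot> (z \<otimes> y [^] n)"
        unfolding xy_eq_theta by (simp add: l_distr)
      also have "\<dots> = (inverse \<delta> * inverse q ^ n) \<odot> (y [^] n \<otimes> \<theta>) \<oplus>
          (- inverse \<delta> * p ^ n) \<odot> (y [^] n \<otimes> z)"
        by (simp add: q_commuteD[OF theta_past(2)] q_commuteD[OF z_past(2)])
      also have "\<dots> = y [^] n \<otimes> (y \<otimes> x)" unfolding e yx_eq_theta by (simp add: r_distr)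
      also have "\<dots> = y [^] m \<otimes> x" unfolding Suc by (simp add: m_assoc[symmetric])
      finally show ?thesis by (simp add: q_commute_def)
    qed simp
  qed
  show "x [^] m \<in> centre" "y [^] m \<in> centre"
    using x XZ XY' y YZ YX' by (auto intro: centreI)
qed

end


section \<open>Polynomial identities from finiteness over the centre\<close>

definition perm_words :: "nat \<Rightarrow> nat list set" where
  "perm_words n = {w. distinct w \<and> set w = {..<n}}"

definition word_perm :: "nat list \<Rightarrow> nat \<Rightarrow> nat" where
  "word_perm w i = (if i < length w then w ! i else i)"

text \<open>
  The standard polynomial: the alternating sum of the words \<open>X\<^bsub>\<sigma>(0)\<^esub> \<dots> X\<^bsub>\<sigma>(n-1)\<^esub>\<close>. The word of a
  permutation \<open>\<sigma>\<close> is the list of its values, and \<open>word_perm\<close> recovers \<open>\<sigma>\<close> from it.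
\<close>

definition standard_poly :: "nat \<Rightarrow> (nat list \<Rightarrow>\<^sub>0 int)" where
  "standard_poly n = Abs_poly_mapping (\<lambda>w. sign (word_perm w) when w \<in> perm_words n)"

lemma finite_perm_words: "finite (perm_words n)"
  by (rule finite_subset[OF _ finite_subset_distinct[of "{..<n}"]]) (auto simp: perm_words_def)

lemma length_perm_words: "w \<in> perm_words n \<Longrightarrow> length w = n"
  unfolding perm_words_def by (metis (mono_tags) distinct_card card_lessThan mem_Collect_eq)

lemma lookup_standard_poly:
  "Poly_Mapping.lookup (standard_poly n) w = (sign (word_perm w) when w \<in> perm_words n)"
  unfolding standard_poly_def
  by (subst lookup_Abs_poly_mapping) (auto intro: finite_subset[OF _ finite_perm_words[of n]])

lemma keys_standard_poly: "Poly_Mapping.keys (standard_poly n) = perm_words n"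
  by (auto simp: in_keys_iff lookup_standard_poly)

lemma word_perm_permutes: "w \<in> perm_words n \<Longrightarrow> word_perm w permutes {..<n}"
proof (rule bij_imp_permutes)
  assume w: "w \<in> perm_words n"
  then have "bij_betw ((!) w) {..<n} {..<n}"
    using length_perm_words[OF w] by (intro bij_betw_nth) (auto simp: perm_words_def)
  then show "bij_betw (word_perm w) {..<n} {..<n}"
    using length_perm_words[OF w] bij_betw_cong[of "{..<n}" "(!) w" "word_perm w"]
    by (auto simp: word_perm_def)
  show "word_perm w i = i" if "i \<notin> {..<n}" for i
    using that length_perm_words[OF w] by (simp add: word_perm_def)
qed

lemma monic_standard_poly: "nc_monic (standard_poly n)"
  unfolding nc_monic_def
proof (intro exI[of _ "[0..<n]"] conjI ballI)
  have "word_perm [0..<n] = id" by (auto simp: word_perm_def)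
  then show "Poly_Mapping.lookup (standard_poly n) [0..<n] = 1"
    by (simp add: lookup_standard_poly perm_words_def atLeast0LessThan)
qed (auto simp: keys_standard_poly dest: length_perm_words)

lemma map_transpose_perm_words:
  assumes "i < n" "j < n" "w \<in> perm_words n"
  shows "map (Transposition.transpose i j) w \<in> perm_words n"
proof -
  have "Transposition.transpose i j ` {..<n} = {..<n}"
    using permutes_swap_id[of i "{..<n}" j] assms by (simp add: permutes_image)
  then show ?thesis using assms by (simp add: perm_words_def distinct_map)
qed

text \<open>
  Exchanging two letters in every word is the composition of the permutation with a
  transposition, hence changes the sign. This makes the evaluation an alternating function.
\<close>

lemma lookup_map_transpose:
  assumes "i < n" "j < n" "i \<noteq> j" "w \<in> perm_words n"
  shows "Poly_Mapping.lookup (standard_poly n) (map (Transposition.transpose i j) w)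
    = - Poly_Mapping.lookup (standard_poly n) w"
proof -
  let ?t = "Transposition.transpose i j"
  have "word_perm (map ?t w) = ?t \<circ> word_perm w"
    using assms(1,2) length_perm_words[OF assms(4)] unfolding fun_eq_iff
    by (simp add: word_perm_def)
  moreover have "permutation ?t" "permutation (word_perm w)"
    using word_perm_permutes[OF assms(4)] permutation_permutes by (blast intro: permutation_swap_id)+
  ultimately have "sign (word_perm (map ?t w)) = - sign (word_perm w)"
    using assms(3) by (simp add: sign_compose sign_swap_id)
  then show ?thesis using assms map_transpose_perm_words by (simp add: lookup_standard_poly)
qed

context ring begin

definition word_prod :: "(nat \<Rightarrow> 'a) \<Rightarrow> nat list \<Rightarrow> 'a" where
  "word_prod \<rho> w = foldr (\<lambda>i a. \<rho> i \<otimes> a) w \<one>"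

lemma word_prod_simps [simp]:
  "word_prod \<rho> [] = \<one>" "word_prod \<rho> (i # w) = \<rho> i \<otimes> word_prod \<rho> w"
  by (simp_all add: word_prod_def)

lemma word_prod_closed [simp]: "(\<And>i. \<rho> i \<in> carrier R) \<Longrightarrow> word_prod \<rho> w \<in> carrier R"
  by (induction w) simp_all

lemma word_prod_upd_notin: "k \<notin> set w \<Longrightarrow> word_prod (\<rho>(k := a)) w = word_prod \<rho> w"
  by (induction w) auto

lemma word_prod_add:
  assumes "\<And>i. \<rho> i \<in> carrier R" "a \<in> carrier R" "b \<in> carrier R" "distinct w" "k \<in> set w"
  shows "word_prod (\<rho>(k := a \<oplus> b)) w = word_prod (\<rho>(k := a)) w \<oplus> word_prod (\<rho>(k := b)) w"
  using assms(4,5)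
proof (induction w)
  case (Cons i w)
  show ?case
  proof (cases "i = k")
    case True
    then have "k \<notin> set w" using Cons.prems by simp
    then show ?thesis
      using l_distr[OF assms(2,3) word_prod_closed[of \<rho> w, OF assms(1)]]
      unfolding True word_prod_simps fun_upd_same by (simp only: word_prod_upd_notin not_False_eq_True)
  next
    case False
    then show ?thesis using Cons assms by (simp add: r_distr)
  qed
qed simp

lemma word_prod_centre:
  assumes "\<And>i. \<rho> i \<in> carrier R" "a \<in> carrier R" "c \<in> carrier R" "\<And>a. a \<in> carrier R \<Longrightarrow> c \<otimes> a = a \<otimes> c"
    "distinct w" "k \<in> set w"
  shows "word_prod (\<rho>(k := c \<otimes> a)) w = c \<otimes> word_prod (\<rho>(k := a)) w"
  using assms(5,6)
proof (induction w)
  case (Cons i w)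
  show ?case
  proof (cases "i = k")
    case True
    then have "k \<notin> set w" using Cons.prems by simp
    then show ?thesis
      using m_assoc[OF assms(3,2) word_prod_closed[of \<rho> w, OF assms(1)]]
      unfolding True word_prod_simps fun_upd_same by (simp only: word_prod_upd_notin not_False_eq_True)
  next
    case False
    let ?v = "word_prod (\<rho>(k := a)) w"
    have v: "?v \<in> carrier R" using assms by simp
    have "\<rho> i \<otimes> (c \<otimes> ?v) = \<rho> i \<otimes> c \<otimes> ?v" by (simp only: m_assoc assms(1,3) v)
    also have "\<dots> = c \<otimes> (\<rho> i \<otimes> ?v)" by (simp only: assms(4)[symmetric, OF assms(1)] m_assoc assms(1,3) v)
    finally have *: "\<rho> i \<otimes> (c \<otimes> ?v) = c \<otimes> (\<rho> i \<otimes> ?v)" .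
    have "word_prod (\<rho>(k := c \<otimes> a)) w = c \<otimes> ?v" using Cons False by (auto intro: Cons.IH)
    then show ?thesis unfolding word_prod_simps fun_upd_other[OF False] by (simp only: *)
  qed
qed simp

abbreviation standard_eval :: "nat \<Rightarrow> (nat \<Rightarrow> 'a) \<Rightarrow> 'a" where
  "standard_eval n \<rho> \<equiv> nc_poly_eval R (standard_poly n) \<rho>"

lemma standard_eval_eq:
  "standard_eval n \<rho> = (\<Oplus>w\<in>perm_words n. add_pow R (Poly_Mapping.lookup (standard_poly n) w) (word_prod \<rho> w))"
  by (simp add: nc_poly_eval_def keys_standard_poly word_prod_def)

lemma standard_eval_closed: "(\<And>i. \<rho> i \<in> carrier R) \<Longrightarrow> standard_eval n \<rho> \<in> carrier R"
  unfolding standard_eval_eq by (intro finsum_closed) auto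

lemma standard_eval_add:
  assumes "\<And>i. \<rho> i \<in> carrier R" "a \<in> carrier R" "b \<in> carrier R" "k < n"
  shows "standard_eval n (\<rho>(k := a \<oplus> b)) = standard_eval n (\<rho>(k := a)) \<oplus> standard_eval n (\<rho>(k := b))"
proof -
  have "standard_eval n (\<rho>(k := a \<oplus> b)) = (\<Oplus>w\<in>perm_words n.
      add_pow R (Poly_Mapping.lookup (standard_poly n) w) (word_prod (\<rho>(k := a)) w) \<oplus>
      add_pow R (Poly_Mapping.lookup (standard_poly n) w) (word_prod (\<rho>(k := b)) w))"
    unfolding standard_eval_eq
  proof (rule add.finprod_cong')
    fix w assume "w \<in> perm_words n"
    then have w: "distinct w" "k \<in> set w" using assms(4) by (auto simp: perm_words_def)
    show "add_pow R (Poly_Mapping.lookup (standard_poly n) w) (word_prod (\<rho>(k := a \<oplus> b)) w) =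
      add_pow R (Poly_Mapping.lookup (standard_poly n) w) (word_prod (\<rho>(k := a)) w) \<oplus>
      add_pow R (Poly_Mapping.lookup (standard_poly n) w) (word_prod (\<rho>(k := b)) w)"
      using assms by (simp add: word_prod_add[OF assms(1-3) w] add.int_pow_distrib)
  qed (use assms in auto)
  also have "\<dots> = standard_eval n (\<rho>(k := a)) \<oplus> standard_eval n (\<rho>(k := b))"
    unfolding standard_eval_eq using assms by (intro finsum_addf) auto
  finally show ?thesis .
qed

lemma standard_eval_centre:
  assumes "\<And>i. \<rho> i \<in> carrier R" "a \<in> carrier R" "c \<in> carrier R" "\<And>a. a \<in> carrier R \<Longrightarrow> c \<otimes> a = a \<otimes> c"
    "k < n"
  shows "standard_eval n (\<rho>(k := c \<otimes> a)) = c \<otimes> standard_eval n (\<rho>(k := a))"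
proof -
  have "standard_eval n (\<rho>(k := c \<otimes> a)) = (\<Oplus>w\<in>perm_words n.
      c \<otimes> add_pow R (Poly_Mapping.lookup (standard_poly n) w) (word_prod (\<rho>(k := a)) w))"
    unfolding standard_eval_eq
  proof (rule add.finprod_cong')
    fix w assume "w \<in> perm_words n"
    then have w: "distinct w" "k \<in> set w" using assms(5) by (auto simp: perm_words_def)
    show "add_pow R (Poly_Mapping.lookup (standard_poly n) w) (word_prod (\<rho>(k := c \<otimes> a)) w) =
      c \<otimes> add_pow R (Poly_Mapping.lookup (standard_poly n) w) (word_prod (\<rho>(k := a)) w)"
      using assms(1-3) by (simp add: word_prod_centre[OF assms(1-4) w] add_pow_rdistr_int)
  qed (use assms in auto)
  also have "\<dots> = c \<otimes> standard_eval n (\<rho>(k := a))"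
    unfolding standard_eval_eq using assms by (intro finsum_rdistr[symmetric] finite_perm_words) auto
  finally show ?thesis .
qed

text \<open>
  Exchanging the letters \<open>i\<close> and \<open>j\<close> permutes the words, does not change the value of any of them
  because \<open>\<rho> i = \<rho> j\<close>, and reverses all signs. So the sum equals its own negative.
\<close>

lemma standard_eval_repeat:
  assumes \<rho>: "\<And>i. \<rho> i \<in> carrier R" and "i < n" "j < n" "i \<noteq> j" "\<rho> i = \<rho> j"
  shows "standard_eval n \<rho> \<oplus> standard_eval n \<rho> = \<zero>"
proof -
  let ?t = "Transposition.transpose i j"
  let ?g = "\<lambda>w. add_pow R (Poly_Mapping.lookup (standard_poly n) w) (word_prod \<rho> w)"
  have im: "map ?t ` perm_words n = perm_words n"
  proof
    show "map ?t ` perm_words n \<subseteq> perm_words n" using map_transpose_perm_words assms by auto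
    show "perm_words n \<subseteq> map ?t ` perm_words n"
    proof
      fix w assume "w \<in> perm_words n"
      then have "map ?t w \<in> perm_words n" "w = map ?t (map ?t w)"
        using map_transpose_perm_words assms by (auto simp: o_def)
      then show "w \<in> map ?t ` perm_words n" by blast
    qed
  qed
  have inj: "inj_on (map ?t) (perm_words n)"
    by (rule inj_onI) (metis list.inj_map_strong inj_transpose injD)
  have "word_prod \<rho> (map ?t w) = word_prod \<rho> w" for w
    using assms(5) by (induction w) (auto simp: transpose_def)
  then have g: "?g (map ?t w) = \<ominus> ?g w" if "w \<in> perm_words n" for w
    using lookup_map_transpose[OF assms(2-4) that] \<rho> by (simp add: add.int_pow_neg)
  have "standard_eval n \<rho> = (\<Oplus>w\<in>perm_words n. ?g (map ?t w))"
    unfolding standard_eval_eq by (subst im[symmetric], rule finsum_reindex) (use inj \<rho> in auto)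
  then have "standard_eval n \<rho> \<oplus> standard_eval n \<rho> = (\<Oplus>w\<in>perm_words n. ?g (map ?t w)) \<oplus> (\<Oplus>w\<in>perm_words n. ?g w)"
    by (simp add: standard_eval_eq)
  also have "\<dots> = (\<Oplus>w\<in>perm_words n. ?g (map ?t w) \<oplus> ?g w)"
    using \<rho> by (intro finsum_addf[symmetric]) auto
  also have "\<dots> = \<zero>"
    using \<rho> g by (intro add.finprod_one_eqI) (simp add: l_neg)
  finally show ?thesis .
qed

end

text \<open>
  The evaluation of the standard polynomial in \<open>|U| + 1\<close> variables is additive and homogeneous
  over the centre in each variable, so that it vanishes as soon as it vanishes on families of
  elements of \<open>U\<close>. Such a family has a repetition, and the evaluation is alternating.
\<close>

theorem PI_ring_if_finite_over_centre:
  fixes A :: "('k::field_char_0, 'a) module" (structure)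
  assumes A: "k_algebra A" and U: "finite U" "U \<subseteq> carrier A"
    and gen: "\<And>W. W \<subseteq> carrier A \<Longrightarrow> U \<subseteq> W \<Longrightarrow> (\<And>a b. a \<in> W \<Longrightarrow> b \<in> W \<Longrightarrow> a \<oplus> b \<in> W) \<Longrightarrow>
      (\<And>c a. c \<in> k_alg.centre A \<Longrightarrow> a \<in> W \<Longrightarrow> c \<otimes> a \<in> W) \<Longrightarrow> carrier A \<subseteq> W"
  shows "PI_ring A"
proof -
  interpret k_alg A by (simp add: k_alg_def k_alg_axioms_def A k_algebraD(1)[OF A])
  define n where "n = Suc (card U)"
  have double: "a = \<zero>" if "a \<in> carrier A" "a \<oplus> a = \<zero>" for a
  proof -
    have "2 \<odot> a = \<zero>" using that add_smult[of a 1 1] by simp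
    then have "(inverse 2 * 2) \<odot> a = \<zero>" unfolding smult_smult[OF that(1), symmetric] by simp
    moreover have "inverse 2 * 2 = (1 :: 'k)" by simp
    ultimately show ?thesis using smult_one[OF that(1)] by simp
  qed
  \<comment> \<open>The first \<open>m\<close> variables are arbitrary, the others are in \<open>U\<close>; they are freed one by one.\<close>
  have main: "standard_eval n \<rho> = \<zero>"
    if "\<And>i. \<rho> i \<in> carrier A" "\<And>i. m \<le> i \<Longrightarrow> i < n \<Longrightarrow> \<rho> i \<in> U" "m \<le> n" for m \<rho>
    using that
  proof (induction m arbitrary: \<rho>)
    case 0
    have "\<not> inj_on \<rho> {..<n}"
    proof
      assume "inj_on \<rho> {..<n}"
      then have "card {..<n} \<le> card U" using 0 U(1) by (intro card_inj_on_le) auto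
      then show False by (simp add: n_def)
    qed
    then obtain i j where "i < n" "j < n" "i \<noteq> j" "\<rho> i = \<rho> j" by (auto simp: inj_on_def)
    then have "standard_eval n \<rho> \<oplus> standard_eval n \<rho> = \<zero>"
      by (rule standard_eval_repeat[OF 0(1)])
    then show ?case by (rule double[OF standard_eval_closed[OF 0(1)]])
  next
    case (Suc m)
    let ?W = "{a \<in> carrier A. standard_eval n (\<rho>(m := a)) = \<zero>}"
    have m: "m < n" using Suc by simp
    have "carrier A \<subseteq> ?W"
    proof (rule gen)
      show "U \<subseteq> ?W" using Suc U(2) by (auto intro!: Suc.IH)
      show "a \<oplus> b \<in> ?W" if "a \<in> ?W" "b \<in> ?W" for a b
        using that Suc.prems(1) m by (simp add: standard_eval_add)
      show "c \<otimes> a \<in> ?W" if "c \<in> centre" "a \<in> ?W" for c a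
        using that(2) m centreD(1)[OF that(1)]
          standard_eval_centre[OF Suc.prems(1) _ centreD(1)[OF that(1)] centreD(2)[OF that(1)], of a m n]
        by simp
    qed simp
    then have "standard_eval n (\<rho>(m := \<rho> m)) = \<zero>" using Suc.prems(1) by blast
    then show ?case by simp
  qed
  show ?thesis
    unfolding PI_ring_def
  proof (intro exI conjI allI impI)
    show "nc_monic (standard_poly n)" by (rule monic_standard_poly)
    show "standard_eval n \<rho> = \<zero>" if "\<forall>i. \<rho> i \<in> carrier A" for \<rho>
      using that by (intro main[of \<rho> n]) simp_all
  qed
qed

lemma (in q_heisenberg) monomial_reduce:
  assumes cx: "cx \<in> centre" and cz: "cz \<in> centre" and ct: "ct \<in> centre"
    and W: "\<And>c a. c \<in> centre \<Longrightarrow> a \<in> W \<Longrightarrow> c \<otimes> a \<in> W"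
    and uvw: "u \<in> carrier H" "v \<in> carrier H" "w \<in> carrier H" "u \<otimes> (v \<otimes> w) \<in> W"
  shows "cx \<otimes> u \<otimes> (cz \<otimes> v \<otimes> (ct \<otimes> w)) \<in> W"
proof -
  note cc = centreD(1)[OF cx] centreD(1)[OF cz] centreD(1)[OF ct]
  have "cz \<otimes> v \<otimes> (ct \<otimes> w) = cz \<otimes> (v \<otimes> ct \<otimes> w)" using cc uvw by (simp add: m_assoc)
  also have "v \<otimes> ct = ct \<otimes> v" using centreD(2)[OF ct uvw(2)] by simp
  finally have "cx \<otimes> u \<otimes> (cz \<otimes> v \<otimes> (ct \<otimes> w)) = cx \<otimes> (u \<otimes> (cz \<otimes> ct) \<otimes> (v \<otimes> w))"
    using cc uvw by (simp add: m_assoc)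
  also have "u \<otimes> (cz \<otimes> ct) = cz \<otimes> ct \<otimes> u" using centreD(2)[OF centre_mult[OF cz ct] uvw(1)] by simp
  finally have "cx \<otimes> u \<otimes> (cz \<otimes> v \<otimes> (ct \<otimes> w)) = cx \<otimes> (cz \<otimes> (ct \<otimes> (u \<otimes> (v \<otimes> w))))"
    using cc uvw by (simp add: m_assoc)
  then show ?thesis using W cx cz ct uvw(4) by simp
qed

lemma (in monoid) pow_div_mod: "a \<in> carrier G \<Longrightarrow> a [^] n = (a [^] m) [^] (n div m) \<otimes> a [^] (n mod m :: nat)"
  by (simp add: nat_pow_mult nat_pow_pow)

text \<open>
  Division with remainder of all exponents by \<open>m\<close> writes each monomial as a central element times
  one of finitely many monomials with small exponents.
\<close>

theorem PI_ring_if_roots_of_unity: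
  fixes H :: "('k::field_char_0, 'a) module" (structure)
  assumes H: "q_heisenberg H p q x y z \<theta>" and m: "p ^ m = 1" "q ^ m = 1" "m > 0"
  shows "PI_ring H"
proof -
  interpret q_heisenberg H p q x y z \<theta> by fact
  define U where "U = (\<lambda>(d, j, k). M d j k) ` ({- int m<..<int m} \<times> {..<m} \<times> {..<m})"
  show ?thesis
  proof (rule PI_ring_if_finite_over_centre[OF k_algebra])
    show "finite U" "U \<subseteq> carrier H" by (auto simp: U_def)
    fix W assume W: "W \<subseteq> carrier H" "U \<subseteq> W" "\<And>a b. a \<in> W \<Longrightarrow> b \<in> W \<Longrightarrow> a \<oplus> b \<in> W"
      "\<And>c a. c \<in> centre \<Longrightarrow> a \<in> W \<Longrightarrow> c \<otimes> a \<in> W"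
    note c = powers_centre[OF m(1,2), THEN centre_pow]
    have U: "M d j k \<in> W" if "\<bar>d\<bar> < int m" "j < m" "k < m" for d j k
    proof -
      have "(d, j, k) \<in> {- int m<..<int m} \<times> {..<m} \<times> {..<m}" using that by auto
      then show ?thesis using W(2) unfolding U_def by force
    qed
    have M: "M d j k \<in> W" for d j k
    proof (cases d rule: int_dest)
      case (1 n)
      have "M d j k = ((x [^] m) [^] (n div m) \<otimes> x [^] (n mod m)) \<otimes>
        (((z [^] m) [^] (j div m) \<otimes> z [^] (j mod m)) \<otimes> ((\<theta> [^] m) [^] (k div m) \<otimes> \<theta> [^] (k mod m)))"
        unfolding 1 M_def B_of_nat by (simp only: pow_div_mod[symmetric] xyz_closed theta_closed)
      also have "\<dots> \<in> W"
        using U[of "int (n mod m)" "j mod m" "k mod m"] m(3)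
        by (intro monomial_reduce[OF c(1,3,4) W(4)]) (simp_all add: M_def B_of_nat del: of_nat_mod)
      finally show ?thesis .
    next
      case (2 n')
      define n where "n = Suc n'"
      have "M d j k = ((y [^] m) [^] (n div m) \<otimes> y [^] (n mod m)) \<otimes>
        (((z [^] m) [^] (j div m) \<otimes> z [^] (j mod m)) \<otimes> ((\<theta> [^] m) [^] (k div m) \<otimes> \<theta> [^] (k mod m)))"
        unfolding 2 n_def[symmetric] M_def B_of_nat by (simp only: pow_div_mod[symmetric] xyz_closed theta_closed)
      also have "\<dots> \<in> W"
        using U[of "- int (n mod m)" "j mod m" "k mod m"] m(3)
        by (intro monomial_reduce[OF c(2,3,4) W(4)]) (simp_all add: M_def B_of_nat del: of_nat_mod)
      finally show ?thesis .
    qed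
    show "carrier H \<subseteq> W"
    proof
      fix a assume "a \<in> carrier H"
      then have "a \<in> lin_span monomials" by (simp add: span_monomials)
      then show "a \<in> W"
      proof induction
        case zero
        have "\<zero> \<otimes> M 0 0 0 \<in> W" by (rule W(4)) (simp_all add: M centre_def)
        then show ?case by simp
      next
        case (base a)
        then show ?case using M by (auto simp: monomials_def)
      next
        case (smult a k)
        then have "(k \<odot> \<one>) \<otimes> a \<in> W" by (intro W(4) centre_smult centre_one)
        then show ?case using smult W(1) by auto
      qed (use W(3) in blast)
    qed
  qed
qed


section \<open>Operators on finitely supported sequences\<close>

abbreviation scale :: "'k::field \<Rightarrow> ('i \<Rightarrow>\<^sub>0 'k) \<Rightarrow> ('i \<Rightarrow>\<^sub>0 'k)" where
  "scale c \<equiv> Poly_Mapping.map ((*) c)"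

abbreviation e :: "nat \<Rightarrow> (nat \<Rightarrow>\<^sub>0 'k::field)" where
  "e n \<equiv> Poly_Mapping.single n 1"

lemma scale_simps [simp]:
  "scale c (u + v) = scale c u + scale c v" "scale (c::'k::field) (scale d u) = scale (c * d) u" "scale 1 u = u"
  "scale 0 u = 0" "scale c 0 = 0" "scale c (Poly_Mapping.single i d) = Poly_Mapping.single i (c * d)"
  by (rule poly_mapping_eqI; simp add: lookup_smult lookup_add algebra_simps lookup_single when_def)+

lemma scale_add_left: "scale (c + d :: 'k::field) u = scale c u + scale d u"
  by (rule poly_mapping_eqI) (simp add: lookup_smult lookup_add algebra_simps)

lemma scale_diff_left: "scale (c - d :: 'k::field) u = scale c u - scale d u"
  by (rule poly_mapping_eqI) (simp add: lookup_smult lookup_minus algebra_simps)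

lemma scale_sum: "scale (c::'k::field) (sum f S) = (\<Sum>i\<in>S. scale c (f i))"
  by (induction S rule: infinite_finite_induct) simp_all

definition linear_op :: "((nat \<Rightarrow>\<^sub>0 'k::field) \<Rightarrow> (nat \<Rightarrow>\<^sub>0 'k)) \<Rightarrow> bool" where
  "linear_op T \<longleftrightarrow> (\<forall>u v. T (u + v) = T u + T v) \<and> (\<forall>c v. T (scale c v) = scale c (T v))"

lemma linear_opD:
  assumes "linear_op T"
  shows "T (u + v) = T u + T v" "T (scale c v) = scale c (T v)" "T 0 = 0" "T (sum f S) = (\<Sum>i\<in>S. T (f i))"
proof -
  show *: "T (u + v) = T u + T v" "T (scale c v) = scale c (T v)" for u v c using assms by (auto simp: linear_op_def)
  show 0: "T 0 = 0" using *(2)[of 0 0] by simp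
  show "T (sum f S) = (\<Sum>i\<in>S. T (f i))"
    by (induction S rule: infinite_finite_induct) (simp_all add: * 0)
qed

text \<open>
  This one construction serves twice: with \<open>\<nat>\<close> as index set it extends a map on basis
  vectors linearly, and with a monoid as index set it is the action of a monoid algebra.
\<close>

definition lincomb :: "('i \<Rightarrow>\<^sub>0 'k::field) \<Rightarrow> ('i \<Rightarrow> (nat \<Rightarrow>\<^sub>0 'k)) \<Rightarrow> (nat \<Rightarrow>\<^sub>0 'k)" where
  "lincomb f g = (\<Sum>i\<in>Poly_Mapping.keys f. scale (Poly_Mapping.lookup f i) (g i))"

lemma lincomb_superset:
  assumes "finite S" "Poly_Mapping.keys f \<subseteq> S"
  shows "lincomb f g = (\<Sum>i\<in>S. scale (Poly_Mapping.lookup f i) (g i))"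
  unfolding lincomb_def using assms by (intro sum.mono_neutral_left) (auto simp: in_keys_iff)

lemma lincomb_add: "lincomb (f + f') g = lincomb f g + lincomb f' g"
proof -
  let ?S = "Poly_Mapping.keys f \<union> Poly_Mapping.keys f' \<union> Poly_Mapping.keys (f + f')"
  have *: "lincomb h g = (\<Sum>i\<in>?S. scale (Poly_Mapping.lookup h i) (g i))" if "h \<in> {f, f', f + f'}" for h
    using that by (intro lincomb_superset) auto
  show ?thesis by (simp add: * lookup_add scale_add_left sum.distrib)
qed

lemma lincomb_smult: "lincomb (scale c f) g = scale c (lincomb f g)"
proof -
  have "lincomb (scale c f) g = (\<Sum>i\<in>Poly_Mapping.keys f. scale (Poly_Mapping.lookup (scale c f) i) (g i))"
    by (rule lincomb_superset) (auto simp: in_keys_iff lookup_smult)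
  then show ?thesis by (simp add: lincomb_def scale_sum lookup_smult)
qed

lemma lincomb_single [simp]: "lincomb (Poly_Mapping.single i c) g = scale c (g i)"
  by (subst lincomb_superset[of "{i}"]) auto

lemma lincomb_zero [simp]: "lincomb 0 g = 0" by (simp add: lincomb_def)

lemma lincomb_sum: "lincomb (sum F S) g = (\<Sum>i\<in>S. lincomb (F i) g)"
  by (induction S rule: infinite_finite_induct) (simp_all add: lincomb_add)

lemma linear_op_lincomb: "linear_op (\<lambda>v. lincomb v g)"
  by (simp add: linear_op_def lincomb_add lincomb_smult)

lemma lincomb_linear: "linear_op T \<Longrightarrow> T (lincomb f g) = lincomb f (\<lambda>i. T (g i))"
  by (simp add: lincomb_def linear_opD)

lemma lincomb_basis: "lincomb v e = v"
  by (subst (2) poly_mapping_sum_single) (simp add: lincomb_def)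

lemma linear_op_eqI:
  assumes "linear_op S" "linear_op T" "\<And>n. S (e n) = T (e n)"
  shows "S v = T v"
  using lincomb_linear[OF assms(1), of v e] lincomb_linear[OF assms(2), of v e] assms(3)
  by (simp add: lincomb_basis)

lemma lookup_lincomb: "Poly_Mapping.lookup (lincomb f g) n =
    (\<Sum>i\<in>Poly_Mapping.keys f. Poly_Mapping.lookup f i * Poly_Mapping.lookup (g i) n)"
  by (simp add: lincomb_def lookup_sum lookup_smult)

lemma linear_op_comp: "linear_op S \<Longrightarrow> linear_op T \<Longrightarrow> linear_op (\<lambda>v. S (T v))"
  by (simp add: linear_op_def)

lemma linear_op_id: "linear_op (\<lambda>v. v)" by (simp add: linear_op_def)

text \<open>
  The space is presented as the monoid algebra of the additive monoid \<open>\<nat>\<close> in order to inherit the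
  vector space laws.
\<close>

definition seq_space :: "('k::field, nat \<Rightarrow>\<^sub>0 'k) module" where
  "seq_space = monoid_algebra \<lparr>carrier = UNIV, monoid.mult = (+), one = 0\<rparr>"

lemma seq_space_simps [simp]:
  "carrier seq_space = UNIV" "add seq_space = (+)" "ring.zero seq_space = 0" "module.smult seq_space = scale"
  by (simp_all add: seq_space_def monoid_algebra_def)

lemma k_algebra_seq_space: "k_algebra seq_space"
  unfolding seq_space_def by (intro k_algebra_monoid_algebra monoidI) auto

section \<open>Representations on finitely supported sequences\<close>

locale seq_rep = k_alg A for A :: "('k::field, 'a) module" (structure) +
  fixes \<rho> :: "'a \<Rightarrow> (nat \<Rightarrow>\<^sub>0 'k) \<Rightarrow> (nat \<Rightarrow>\<^sub>0 'k)"
  assumes linear [intro]: "a \<in> carrier A \<Longrightarrow> linear_op (\<rho> a)"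
    and act_add [simp]: "a \<in> carrier A \<Longrightarrow> b \<in> carrier A \<Longrightarrow> \<rho> (a \<oplus> b) v = \<rho> a v + \<rho> b v"
    and act_smult [simp]: "a \<in> carrier A \<Longrightarrow> \<rho> (c \<odot> a) v = scale c (\<rho> a v)"
    and act_mult [simp]: "a \<in> carrier A \<Longrightarrow> b \<in> carrier A \<Longrightarrow> \<rho> (a \<otimes> b) v = \<rho> a (\<rho> b v)"
    and act_one [simp]: "\<rho> \<one> v = v"
begin

lemma act_zero [simp]: "\<rho> \<zero> v = 0"
  using act_smult[of \<zero> 0 v] by simp

lemma act_minus: "a \<in> carrier A \<Longrightarrow> b \<in> carrier A \<Longrightarrow> \<rho> (a \<ominus> b) v = \<rho> a v - \<rho> b v"
  using act_add[of "a \<ominus> b" b v] by (simp add: minus_eq a_assoc l_neg eq_diff_eq)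

lemma act_eigen_pow:
  assumes "a \<in> carrier A" "\<rho> a v = scale c v"
  shows "\<rho> (a [^] (n::nat)) v = scale (c ^ n) v"
  using assms linear_opD(2)[OF linear] by (induction n) (simp_all add: mult.commute)

definition kernel :: "'a set" where
  "kernel = {a \<in> carrier A. \<forall>v. \<rho> a v = 0}"

lemma ideal_kernel: "ideal kernel A"
proof (rule idealI)
  show "subgroup kernel (add_monoid A)"
  proof (rule add.subgroupI)
    show "\<ominus> a \<in> kernel" if "a \<in> kernel" for a
      using that by (auto simp: kernel_def minus_one_smult[symmetric])
  qed (use act_zero in \<open>auto simp: kernel_def\<close>)
qed (auto simp: kernel_def ring_axioms linear_opD(3)[OF linear])

lemma genideal_in_kernel:
  assumes "S \<subseteq> carrier A" "\<And>a v. a \<in> S \<Longrightarrow> \<rho> a v = 0"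
  shows "Idl S \<subseteq> kernel"
  using assms by (intro genideal_minimal ideal_kernel) (auto simp: kernel_def)

end

lemma k_algI: "k_algebra A \<Longrightarrow> k_alg A"
  by (simp add: k_alg_def k_alg_axioms_def k_algebraD(1))

text \<open>
  An action of the monoid by linear operators extends to its algebra by the universal property.
  Words acting on sequences give the representations of a free algebra, and pairs of elements
  acting on a tensor product give the representation from which that of a tensor product of
  algebras descends.
\<close>

lemma seq_rep_monoid_algebra:
  fixes \<mu> :: "'m \<Rightarrow> (nat \<Rightarrow>\<^sub>0 'k::field) \<Rightarrow> (nat \<Rightarrow>\<^sub>0 'k)"
  assumes "Group.monoid M" and linear_\<mu>: "\<And>a. a \<in> carrier M \<Longrightarrow> linear_op (\<mu> a)"
    and mult: "\<And>a b v. a \<in> carrier M \<Longrightarrow> b \<in> carrier M \<Longrightarrow> \<mu> (a \<otimes>\<^bsub>M\<^esub> b) v = \<mu> a (\<mu> b v)"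
    and one: "\<And>v. \<mu> \<one>\<^bsub>M\<^esub> v = v"
  shows "seq_rep (monoid_algebra M) (\<lambda>f v. lincomb f (\<lambda>a. \<mu> a v))"
proof -
  interpret k_alg "monoid_algebra M :: ('k, _) module"
    by (intro k_algI k_algebra_monoid_algebra assms)
  have carr: "carrier (monoid_algebra M) = {f :: _ \<Rightarrow>\<^sub>0 'k. Poly_Mapping.keys f \<subseteq> carrier M}"
    by (simp add: monoid_algebra_def)
  show ?thesis
  proof unfold_locales
    fix f g :: "'m \<Rightarrow>\<^sub>0 'k" and v
    assume f: "f \<in> carrier (monoid_algebra M)" and g: "g \<in> carrier (monoid_algebra M)"
    have l: "linear_op (\<mu> a)" if "a \<in> Poly_Mapping.keys f" for a using f linear_\<mu> that by (auto simp: carr)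
    have "lincomb (f \<otimes>\<^bsub>monoid_algebra M\<^esub> g) (\<lambda>a. \<mu> a v) =
      (\<Sum>a\<in>Poly_Mapping.keys f. \<Sum>b\<in>Poly_Mapping.keys g.
        scale (Poly_Mapping.lookup f a * Poly_Mapping.lookup g b) (\<mu> (a \<otimes>\<^bsub>M\<^esub> b) v))"
      by (simp add: monoid_algebra_def lincomb_sum)
    also have "\<dots> = (\<Sum>a\<in>Poly_Mapping.keys f. scale (Poly_Mapping.lookup f a)
        (\<mu> a (lincomb g (\<lambda>b. \<mu> b v))))"
    proof (rule sum.cong[OF refl])
      fix a assume a: "a \<in> Poly_Mapping.keys f"
      have "\<mu> (a \<otimes>\<^bsub>M\<^esub> b) v = \<mu> a (\<mu> b v)" if "b \<in> Poly_Mapping.keys g" for b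
        using f g a that by (intro mult) (auto simp: carr)
      then show "(\<Sum>b\<in>Poly_Mapping.keys g. scale (Poly_Mapping.lookup f a * Poly_Mapping.lookup g b) (\<mu> (a \<otimes>\<^bsub>M\<^esub> b) v))
        = scale (Poly_Mapping.lookup f a) (\<mu> a (lincomb g (\<lambda>b. \<mu> b v)))"
        by (simp add: lincomb_def linear_opD[OF l[OF a]] scale_sum)
    qed
    finally show "lincomb (f \<otimes>\<^bsub>monoid_algebra M\<^esub> g) (\<lambda>a. \<mu> a v) =
      lincomb f (\<lambda>a. \<mu> a (lincomb g (\<lambda>a. \<mu> a v)))"
      by (simp add: lincomb_def)
  next
    fix f :: "'m \<Rightarrow>\<^sub>0 'k"
    assume f: "f \<in> carrier (monoid_algebra M)"
    then have l: "linear_op (\<mu> a)" if "a \<in> Poly_Mapping.keys f" for a using linear_\<mu> that by (auto simp: carr)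
    show "linear_op (\<lambda>v. lincomb f (\<lambda>a. \<mu> a v))"
      by (simp add: linear_op_def lincomb_def linear_opD[OF l] sum.distrib scale_sum mult.commute)
  qed (simp_all add: monoid_algebra_def lincomb_add lincomb_smult one)
qed

lemma quot_algebra_ops:
  assumes "k_algebra R" "ideal I R"
  shows "carrier (quot_algebra R I) = (\<lambda>x. I +>\<^bsub>R\<^esub> x) ` carrier R"
    and "\<And>x y. x \<in> carrier R \<Longrightarrow> y \<in> carrier R \<Longrightarrow>
      (I +>\<^bsub>R\<^esub> x) \<otimes>\<^bsub>quot_algebra R I\<^esub> (I +>\<^bsub>R\<^esub> y) = I +>\<^bsub>R\<^esub> (x \<otimes>\<^bsub>R\<^esub> y)"
    and "\<And>x y. x \<in> carrier R \<Longrightarrow> y \<in> carrier R \<Longrightarrow>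
      (I +>\<^bsub>R\<^esub> x) \<oplus>\<^bsub>quot_algebra R I\<^esub> (I +>\<^bsub>R\<^esub> y) = I +>\<^bsub>R\<^esub> (x \<oplus>\<^bsub>R\<^esub> y)"
    and "\<And>x c. x \<in> carrier R \<Longrightarrow> c \<odot>\<^bsub>quot_algebra R I\<^esub> (I +>\<^bsub>R\<^esub> x) = I +>\<^bsub>R\<^esub> (c \<odot>\<^bsub>R\<^esub> x)"
    and "\<one>\<^bsub>quot_algebra R I\<^esub> = I +>\<^bsub>R\<^esub> \<one>\<^bsub>R\<^esub>"
    and "\<zero>\<^bsub>quot_algebra R I\<^esub> = I"
    and "\<And>x y. x \<in> carrier R \<Longrightarrow> y \<in> carrier R \<Longrightarrow> (I +>\<^bsub>R\<^esub> x) = (I +>\<^bsub>R\<^esub> y) \<longleftrightarrow> x \<ominus>\<^bsub>R\<^esub> y \<in> I"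
proof -
  interpret ideal I R by fact
  show "carrier (quot_algebra R I) = (\<lambda>x. I +>\<^bsub>R\<^esub> x) ` carrier R"
    by (auto simp: quot_algebra_def FactRing_simps)
  show "(I +>\<^bsub>R\<^esub> x) \<otimes>\<^bsub>quot_algebra R I\<^esub> (I +>\<^bsub>R\<^esub> y) = I +>\<^bsub>R\<^esub> (x \<otimes>\<^bsub>R\<^esub> y)"
    "(I +>\<^bsub>R\<^esub> x) \<oplus>\<^bsub>quot_algebra R I\<^esub> (I +>\<^bsub>R\<^esub> y) = I +>\<^bsub>R\<^esub> (x \<oplus>\<^bsub>R\<^esub> y)"
    if "x \<in> carrier R" "y \<in> carrier R" for x y
    using that by (simp_all add: quot_algebra_def FactRing_def rcoset_mult_add a_rcos_sum)
  show "c \<odot>\<^bsub>quot_algebra R I\<^esub> (I +>\<^bsub>R\<^esub> x) = I +>\<^bsub>R\<^esub> (c \<odot>\<^bsub>R\<^esub> x)" if "x \<in> carrier R" for x c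
    using smult_quot_algebra assms that .
  show "\<one>\<^bsub>quot_algebra R I\<^esub> = I +>\<^bsub>R\<^esub> \<one>\<^bsub>R\<^esub>" "\<zero>\<^bsub>quot_algebra R I\<^esub> = I"
    by (simp_all add: quot_algebra_def FactRing_def)
  show "(I +>\<^bsub>R\<^esub> x) = (I +>\<^bsub>R\<^esub> y) \<longleftrightarrow> x \<ominus>\<^bsub>R\<^esub> y \<in> I" if "x \<in> carrier R" "y \<in> carrier R" for x y
    using quotient_eq_iff_same_a_r_cos[OF is_ideal that] by simp
qed

text \<open>
  The action of a coset is that of any representative; it is well defined when the ideal acts by
  zero.
\<close>

definition quot_act :: "('a \<Rightarrow> 'v \<Rightarrow> 'v) \<Rightarrow> 'a set \<Rightarrow> 'v \<Rightarrow> 'v" where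
  "quot_act \<rho> S = \<rho> (SOME x. x \<in> S)"

lemma (in seq_rep) quot_act_coset:
  assumes "ideal I A" "I \<subseteq> kernel" "x \<in> carrier A"
  shows "quot_act \<rho> (I +> x) v = \<rho> x v"
proof -
  interpret ideal I A by fact
  have "x \<in> I +> x" using assms(3) by (rule a_rcos_self)
  then have "(SOME y. y \<in> I +> x) \<in> I +> x" by (rule someI)
  then obtain i where "i \<in> I" "(SOME y. y \<in> I +> x) = i \<oplus> x" by (auto simp: a_r_coset_def')
  then show ?thesis using assms by (auto simp: quot_act_def kernel_def)
qed

lemma (in seq_rep) seq_rep_quot_algebra:
  assumes I: "ideal I A" "I \<subseteq> kernel"
  shows "seq_rep (quot_algebra A I) (quot_act \<rho>)"
proof -
  interpret Q: k_alg "quot_algebra A I" by (intro k_algI k_algebra_quot_algebra k_algebra I)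
  note ops = quot_algebra_ops[OF k_algebra I(1)]
  show ?thesis
    by unfold_locales
      (auto simp: ops quot_act_coset[OF I] fun_eq_iff linear_op_def linear_opD[OF linear])
qed

lemma (in k_alg) relabel_ops:
  assumes "inj_on \<phi> (carrier A)"
  shows "carrier (relabel \<phi> A) = \<phi> ` carrier A"
    and "\<And>a b. a \<in> carrier A \<Longrightarrow> b \<in> carrier A \<Longrightarrow> \<phi> a \<otimes>\<^bsub>relabel \<phi> A\<^esub> \<phi> b = \<phi> (a \<otimes> b)"
    and "\<And>a b. a \<in> carrier A \<Longrightarrow> b \<in> carrier A \<Longrightarrow> \<phi> a \<oplus>\<^bsub>relabel \<phi> A\<^esub> \<phi> b = \<phi> (a \<oplus> b)"
    and "\<And>a c. a \<in> carrier A \<Longrightarrow> c \<odot>\<^bsub>relabel \<phi> A\<^esub> \<phi> a = \<phi> (c \<odot> a)"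
    and "\<one>\<^bsub>relabel \<phi> A\<^esub> = \<phi> \<one>" "\<zero>\<^bsub>relabel \<phi> A\<^esub> = \<phi> \<zero>"
  using assms by (simp_all add: relabel_def Let_def inv_into_f_f)

section \<open>Separating representations\<close>

text \<open>
  A form of density for finite sets of basis vectors. Unlike irreducibility, this property passes to tensor products at once, because elements can be chosen for each factor
  separately.
\<close>

definition separating :: "('k, 'a) module \<Rightarrow> ('a \<Rightarrow> (nat \<Rightarrow>\<^sub>0 'k) \<Rightarrow> (nat \<Rightarrow>\<^sub>0 'k::field)) \<Rightarrow> bool" where
  "separating A \<rho> \<longleftrightarrow> (\<forall>S i j. finite S \<longrightarrow>
    (\<exists>a\<in>carrier A. \<rho> a (e i) = e j \<and> (\<forall>k\<in>S - {i}. \<rho> a (e k) = 0)))"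

text \<open>
  The invariant of the induction on tensor powers. All representations live on the same space of
  sequences, as \<open>\<nat> \<times> \<nat>\<close> is in bijection with \<open>\<nat>\<close>.
\<close>

definition faithful_separating_rep :: "('k, 'a) module \<Rightarrow> ('a \<Rightarrow> (nat \<Rightarrow>\<^sub>0 'k) \<Rightarrow> (nat \<Rightarrow>\<^sub>0 'k::field)) \<Rightarrow> bool" where
  "faithful_separating_rep A \<rho> \<longleftrightarrow> seq_rep A \<rho> \<and> faithful_rep A seq_space \<rho> \<and> separating A \<rho>"

lemma faithful_separating_rep_relabel:
  assumes "faithful_separating_rep A \<rho>" and inj: "inj_on \<phi> (carrier A)"
  shows "faithful_separating_rep (relabel \<phi> A) (\<lambda>u. \<rho> (inv_into (carrier A) \<phi> u))"
proof -
  interpret seq_rep A \<rho> using assms by (simp add: faithful_separating_rep_def)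
  interpret R: k_alg "relabel \<phi> A" by (intro k_algI relabel_iso(1) k_algebra inj)
  note ops = relabel_ops[OF inj]
  have "seq_rep (relabel \<phi> A) (\<lambda>u. \<rho> (inv_into (carrier A) \<phi> u))"
    by unfold_locales (auto simp: ops inv_into_f_f[OF inj] linear)
  moreover have "faithful_rep (relabel \<phi> A) seq_space (\<lambda>u. \<rho> (inv_into (carrier A) \<phi> u))"
    using assms by (auto simp: faithful_separating_rep_def faithful_rep_def ops inv_into_f_f[OF inj])
  moreover have "separating (relabel \<phi> A) (\<lambda>u. \<rho> (inv_into (carrier A) \<phi> u))"
    using assms by (simp add: faithful_separating_rep_def separating_def ops inv_into_f_f[OF inj])
  ultimately show ?thesis by (simp add: faithful_separating_rep_def)
qed

lemma basis_spans:
  assumes "0 \<in> W" "\<And>u v. u \<in> W \<Longrightarrow> v \<in> W \<Longrightarrow> u + v \<in> W" "\<And>c v. v \<in> W \<Longrightarrow> scale c v \<in> W" "\<And>j. e j \<in> W"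
  shows "v \<in> W"
proof -
  have "(\<Sum>k\<in>S. scale (Poly_Mapping.lookup v k) (e k)) \<in> W" if "finite S" for S
    using that
  proof induction
    case (insert k S)
    have "scale (Poly_Mapping.lookup v k) (e k) \<in> W" by (rule assms(3)[OF assms(4)])
    then show ?case using insert assms(2) by (simp only: sum.insert not_False_eq_True)
  qed (simp add: assms(1))
  then have "lincomb v e \<in> W" unfolding lincomb_def by simp
  then show ?thesis by (simp add: lincomb_basis)
qed

lemma module_seq_space: "module (ring_of_type_algebra :: 'k::field ring) seq_space"
  using k_algebra_seq_space by (auto simp: k_algebra_def)

text \<open>
  Separating the support of a nonzero vector of an invariant subspace produces every basis vector.
\<close>

lemma (in seq_rep) irreducible_if_separating:
  assumes sep: "separating A \<rho>" and sub: "submodule W (ring_of_type_algebra :: 'k ring) seq_space"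
    and inv: "\<And>a w. a \<in> carrier A \<Longrightarrow> w \<in> W \<Longrightarrow> \<rho> a w \<in> W"
  shows "W = {0} \<or> W = UNIV"
proof -
  note subE = module.submoduleE[OF module_seq_space sub]
  have add: "u + v \<in> W" if "u \<in> W" "v \<in> W" for u v
    using subE(5) that by simp
  have smult: "scale c v \<in> W" if "v \<in> W" for c v
    using subE(4)[of c v] that by (simp add: ring_of_type_algebra_def)
  have zero: "0 \<in> W" using subE(2) smult[of _ 0] by auto
  show ?thesis
  proof (cases "W \<subseteq> {0}")
    case True
    then show ?thesis using zero by auto
  next
    case False
    then obtain w where w: "w \<in> W" "w \<noteq> 0" by auto
    then obtain i where i: "i \<in> Poly_Mapping.keys w" by (metis keys_eq_empty ex_in_conv)
    have basis: "e j \<in> W" for j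
    proof -
      obtain a where a: "a \<in> carrier A" "\<rho> a (e i) = e j"
        "\<And>k. k \<in> Poly_Mapping.keys w \<Longrightarrow> k \<noteq> i \<Longrightarrow> \<rho> a (e k) = 0"
        using sep unfolding separating_def by (metis DiffI finite_keys singletonD)
      have "\<rho> a w = lincomb w (\<lambda>k. \<rho> a (e k))"
        by (metis lincomb_basis lincomb_linear[OF linear[OF a(1)]])
      also have "\<dots> = (\<Sum>k\<in>{i}. scale (Poly_Mapping.lookup w k) (\<rho> a (e k)))"
        unfolding lincomb_def using i a(3) by (intro sum.mono_neutral_right) auto
      finally have "scale (inverse (Poly_Mapping.lookup w i)) (\<rho> a w) = e j"
        using a(2) i by (simp add: in_keys_iff)
      then show ?thesis using smult inv[OF a(1) w(1)] by metis
    qed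
    have "v \<in> W" for v by (rule basis_spans[OF zero add smult basis])
    then show ?thesis by auto
  qed
qed

lemma (in seq_rep) cyclic_if_separating:
  assumes "separating A \<rho>"
  shows "\<exists>a\<in>carrier A. \<rho> a (e i) = v"
proof -
  let ?W = "{\<rho> a (e i) | a. a \<in> carrier A}"
  have "v \<in> ?W"
  proof (rule basis_spans)
    show "0 \<in> ?W" using act_zero[of "e i"] by (metis (mono_tags) mem_Collect_eq zero_closed)
    show "u + v \<in> ?W" if "u \<in> ?W" "v \<in> ?W" for u v
      using that act_add[of _ _ "e i"] a_closed by (smt (verit) mem_Collect_eq)
    show "scale c v \<in> ?W" if "v \<in> ?W" for c v
      using that act_smult[of _ c "e i"] smult_closed by (smt (verit) mem_Collect_eq)
    show "e j \<in> ?W" for j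
    proof -
      obtain a where "a \<in> carrier A" "\<rho> a (e i) = e j"
        using assms unfolding separating_def by (metis finite.emptyI)
      then show ?thesis by force
    qed
  qed
  then show ?thesis by auto
qed

text \<open>
  The sequences are renamed to sets of elements of \<open>A\<close>: the vector \<open>v\<close> becomes the set of all \<open>a\<close> with
  \<open>a e\<^sub>0 = v\<close>, which is a coset of the annihilator of \<open>e\<^sub>0\<close>. These sets are nonempty, hence distinct for
  distinct vectors, because \<open>e\<^sub>0\<close> generates the representation.
\<close>

theorem has_faithful_irreducible_rep_if_faithful_separating_rep:
  fixes A :: "('k::field, 'a) module"
  assumes "faithful_separating_rep A \<rho>"
  shows "has_faithful_irreducible_rep A"
proof -
  interpret seq_rep A \<rho> using assms unfolding faithful_separating_rep_def by blast
  interpret S: k_alg seq_space by (intro k_algI k_algebra_seq_space)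
  have sep: "separating A \<rho>" and faith: "faithful_rep A seq_space \<rho>"
    using assms by (simp_all add: faithful_separating_rep_def)
  define \<phi> where "\<phi> v = {a \<in> carrier A. \<rho> a (e 0) = v}" for v
  have inj: "inj \<phi>"
  proof (rule injI)
    fix u v assume eq: "\<phi> u = \<phi> v"
    obtain a where "a \<in> carrier A" "\<rho> a (e 0) = u" using cyclic_if_separating[OF sep] by blast
    then have "a \<in> \<phi> v" using eq by (auto simp: \<phi>_def)
    then show "u = v" using \<open>\<rho> a (e 0) = u\<close> by (simp add: \<phi>_def)
  qed
  then have inj': "inj_on \<phi> (carrier seq_space)" by simp
  define V where "V = relabel \<phi> (seq_space :: ('k, _) module)"
  define \<rho>' where "\<rho>' a u = \<phi> (\<rho> a (inv_into UNIV \<phi> u))" for a u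
  note ops = S.relabel_ops[OF inj', folded V_def, simplified]
  have \<rho>'[simp]: "\<rho>' a (\<phi> v) = \<phi> (\<rho> a v)" for a v by (simp add: \<rho>'_def inj)
  have eq[simp]: "\<phi> u = \<phi> v \<longleftrightarrow> u = v" for u v using inj by (auto dest: injD)
  have kV: "k_algebra V" unfolding V_def by (rule relabel_iso(1)[OF k_algebra_seq_space inj'])
  then have mV: "module (ring_of_type_algebra :: 'k ring) V" by (simp add: k_algebra_def)
  have "representation A V \<rho>'"
    unfolding representation_def using mV by (auto simp: ops linear_opD[OF linear])
  moreover have "faithful_rep A V \<rho>'"
    using faith by (auto simp: faithful_rep_def ops)
  moreover have "irreducible_rep A V \<rho>'"
    unfolding irreducible_rep_def
  proof (intro conjI allI impI)
    have "\<phi> (e 0) \<noteq> \<phi> 0" using lookup_single_eq[of 0 "1 :: 'k"] by auto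
    then show "carrier V \<noteq> {\<zero>\<^bsub>V\<^esub>}" unfolding ops by blast
  next
    fix W assume W: "submodule W (ring_of_type_algebra :: 'k ring) V \<and> (\<forall>a\<in>carrier A. \<forall>w\<in>W. \<rho>' a w \<in> W)"
    note subE = module.submoduleE[OF mV conjunct1[OF W]]
    let ?W = "\<phi> -` W"
    have im: "W = \<phi> ` ?W" using subE(1) by (auto simp: ops)
    have smult: "scale c v \<in> ?W" if "v \<in> ?W" for c v
      using subE(4)[of c "\<phi> v"] that by (simp add: ops ring_of_type_algebra_def)
    have minus: "\<ominus>\<^bsub>seq_space\<^esub> v = scale (- 1) v" for v :: "nat \<Rightarrow>\<^sub>0 'k"
      using S.minus_one_smult[of v] by simp
    have "submodule ?W (ring_of_type_algebra :: 'k ring) seq_space"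
    proof (rule module.submoduleI[OF module_seq_space])
      obtain v where "v \<in> ?W" using subE(2) im by blast
      then show "\<zero>\<^bsub>seq_space\<^esub> \<in> ?W" using smult[of v 0] by simp
      show "u \<oplus>\<^bsub>seq_space\<^esub> v \<in> ?W" if "u \<in> ?W" "v \<in> ?W" for u v
        using subE(5)[of "\<phi> u" "\<phi> v"] that by (simp add: ops)
      show "\<ominus>\<^bsub>seq_space\<^esub> v \<in> ?W" if "v \<in> ?W" for v
        unfolding minus using that by (rule smult)
      show "c \<odot>\<^bsub>seq_space\<^esub> v \<in> ?W" if "v \<in> ?W" for c v
        unfolding seq_space_simps using that by (rule smult)
    qed simp
    then have "?W = {0} \<or> ?W = UNIV"
      using W by (intro irreducible_if_separating[OF sep]) (auto simp flip: \<rho>')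
    then show "W = {\<zero>\<^bsub>V\<^esub>} \<or> W = carrier V"
      unfolding ops using im by (metis image_empty image_insert)
  qed
  ultimately show ?thesis unfolding has_faithful_irreducible_rep_def by blast
qed


section \<open>The Fock representation of the quantum Heisenberg algebra\<close>

lemma carrier_free_algebra [simp]: "carrier free_algebra = UNIV"
  by (simp add: free_algebra_def monoid_algebra_def)

lemma free_algebra_generated:
  fixes W :: "(gen list \<Rightarrow>\<^sub>0 'k::field) set"
  assumes one: "Poly_Mapping.single [] 1 \<in> W" and add: "\<And>f g. f \<in> W \<Longrightarrow> g \<in> W \<Longrightarrow> f + g \<in> W"
    and smult: "\<And>c f. f \<in> W \<Longrightarrow> scale c f \<in> W"
    and gen: "\<And>v f. f \<in> W \<Longrightarrow> free_gen v \<otimes>\<^bsub>free_algebra\<^esub> f \<in> W"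
  shows "f \<in> W"
proof -
  have word: "Poly_Mapping.single w (1::'k) \<in> W" for w
  proof (induction w)
    case (Cons v w)
    have "Poly_Mapping.single (v # w) (1::'k) = free_gen v \<otimes>\<^bsub>free_algebra\<^esub> Poly_Mapping.single w 1"
      by (simp add: free_gen_def free_algebra_def monoid_algebra_mult_single)
    then show ?case using gen[OF Cons] by simp
  qed (rule one)
  have "Poly_Mapping.single w c \<in> W" for w and c :: 'k
    using smult[OF word[of w], of c] by simp
  moreover have "0 \<in> W" using smult[OF one, of 0] by simp
  ultimately have "(\<Sum>w\<in>S. Poly_Mapping.single w (Poly_Mapping.lookup f w)) \<in> W" for S
    by (induction S rule: infinite_finite_induct) (simp_all add: add)
  then show ?thesis by (metis poly_mapping_sum_single)
qed

text \<open>
  The defining relations hold in the quotient of the free algebra because their differences are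
  in the ideal, and the generation property is inherited from words.
\<close>

lemma q_heisenberg_H_alg:
  fixes p q :: "'k::field"
  assumes "p \<noteq> 0" "q \<noteq> 0" "p * q \<noteq> 1"
  defines "H \<equiv> H_alg p q"
  defines "x \<equiv> H_gen p q GX" and "y \<equiv> H_gen p q GY" and "z \<equiv> H_gen p q GZ"
  shows "q_heisenberg H p q x y z (y \<otimes>\<^bsub>H\<^esub> x \<ominus>\<^bsub>H\<^esub> (inverse p \<odot>\<^bsub>H\<^esub> (x \<otimes>\<^bsub>H\<^esub> y)))"
proof -
  interpret F: k_alg "free_algebra :: ('k, gen list \<Rightarrow>\<^sub>0 'k) module"
    by (intro k_algI k_algebra_free_algebra)
  interpret H: k_alg H unfolding H_def by (intro k_algI k_algebra_H_alg)
  let ?I = "H_ideal p q"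
  let ?F = "free_algebra :: ('k, gen list \<Rightarrow>\<^sub>0 'k) module"
  note I = ideal_H_ideal[of p q]
  note ops = quot_algebra_ops[OF k_algebra_free_algebra I, folded H_alg_def, folded H_def, simplified]
  note xyz = x_def y_def z_def H_gen_def
  have rel: "a \<in> ?I" if "a \<in> H_relations p q" for a
    using that F.genideal_self[of "H_relations p q"] by (auto simp: H_ideal_def)
  have Fadd: "add ?F = (+)" and Fone: "\<one>\<^bsub>?F\<^esub> = Poly_Mapping.single [] 1" and Fsm: "module.smult ?F = scale"
    by (simp_all add: free_algebra_def monoid_algebra_def)
  show ?thesis
  proof (unfold_locales, goal_cases)
    case 4 show ?case unfolding ops xyz by (rule rangeI)
  next
    case 5 show ?case unfolding ops xyz by (rule rangeI)
  next
    case 6 show ?case unfolding ops xyz by (rule rangeI)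
  next
    case 7
    show ?case unfolding xyz ops
      by (rule rel) (simp add: H_relations_def Let_def)
  next
    case 8
    show ?case unfolding xyz ops
      by (rule rel) (simp add: H_relations_def Let_def)
  next
    case 9
    let ?x = "free_gen GX :: gen list \<Rightarrow>\<^sub>0 'k" and ?y = "free_gen GY :: gen list \<Rightarrow>\<^sub>0 'k" and ?z = "free_gen GZ :: gen list \<Rightarrow>\<^sub>0 'k"
    have "?y \<otimes>\<^bsub>?F\<^esub> ?x \<ominus>\<^bsub>?F\<^esub> (q \<odot>\<^bsub>?F\<^esub> (?x \<otimes>\<^bsub>?F\<^esub> ?y)) \<ominus>\<^bsub>?F\<^esub> ?z \<in> ?I"
      by (rule rel) (simp add: H_relations_def Let_def)
    also have "?y \<otimes>\<^bsub>?F\<^esub> ?x \<ominus>\<^bsub>?F\<^esub> (q \<odot>\<^bsub>?F\<^esub> (?x \<otimes>\<^bsub>?F\<^esub> ?y)) \<ominus>\<^bsub>?F\<^esub> ?z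
      = ?y \<otimes>\<^bsub>?F\<^esub> ?x \<ominus>\<^bsub>?F\<^esub> (q \<odot>\<^bsub>?F\<^esub> (?x \<otimes>\<^bsub>?F\<^esub> ?y) \<oplus>\<^bsub>?F\<^esub> ?z)"
      by (simp add: F.minus_eq F.minus_add F.a_assoc)
    finally show ?case unfolding xyz ops .
  next
    case 10 show ?case by simp
  next
    case (11 W)
    have "?I +>\<^bsub>?F\<^esub> f \<in> W" for f
    proof -
      have "f \<in> {f. ?I +>\<^bsub>?F\<^esub> f \<in> W}"
      proof (rule free_algebra_generated)
        show "Poly_Mapping.single [] 1 \<in> {f. ?I +>\<^bsub>?F\<^esub> f \<in> W}" using 11(2) by (simp add: ops Fone)
        show "f + g \<in> {f. ?I +>\<^bsub>?F\<^esub> f \<in> W}"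
          if "f \<in> {f. ?I +>\<^bsub>?F\<^esub> f \<in> W}" "g \<in> {f. ?I +>\<^bsub>?F\<^esub> f \<in> W}" for f g
          using 11(3)[of "?I +>\<^bsub>?F\<^esub> f" "?I +>\<^bsub>?F\<^esub> g"] that by (simp add: ops Fadd)
        show "scale c f \<in> {f. ?I +>\<^bsub>?F\<^esub> f \<in> W}" if "f \<in> {f. ?I +>\<^bsub>?F\<^esub> f \<in> W}" for c f
          using 11(4)[of "?I +>\<^bsub>?F\<^esub> f" c] that by (simp add: ops Fsm)
        show "free_gen v \<otimes>\<^bsub>?F\<^esub> f \<in> {f. ?I +>\<^bsub>?F\<^esub> f \<in> W}" if "f \<in> {f. ?I +>\<^bsub>?F\<^esub> f \<in> W}" for v f
          using 11(5)[of "?I +>\<^bsub>?F\<^esub> f" "?I +>\<^bsub>?F\<^esub> free_gen v"] that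
          by (cases v) (simp_all add: ops xyz)
      qed
      then show ?thesis by simp
    qed
    then show ?case by (auto simp: ops)
  qed (use assms in simp_all)
qed

locale fock =
  fixes p q :: "'k::field_char_0"
  assumes p0: "p \<noteq> 0" and q0: "q \<noteq> 0" and pq: "p * q \<noteq> 1"
begin

text \<open>
  The eigenvalue of \<open>x y\<close> on \<open>e\<^sub>m\<close>. It vanishes for \<open>m = 0\<close>, so that the lowering operator \<open>y\<close> stops
  at \<open>e\<^sub>0\<close>, and it satisfies the recursion that the relation \<open>y x = q x y + z\<close> imposes when \<open>z\<close> acts by
  \<open>p\<^sup>-\<^sup>m\<close> on \<open>e\<^sub>m\<close>.
\<close>

definition weight :: "nat \<Rightarrow> 'k" where
  "weight m = (q ^ m - inverse p ^ m) / (q - inverse p)"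

text \<open>
  For \<open>GY\<close> at \<open>m = 0\<close> the truncated subtraction \<open>m - 1\<close> is harmless, as \<open>weight 0 = 0\<close>.
\<close>

fun gen_basis :: "gen \<Rightarrow> nat \<Rightarrow> (nat \<Rightarrow>\<^sub>0 'k)" where
  "gen_basis GX m = e (Suc m)"
| "gen_basis GY m = scale (weight m) (e (m - 1))"
| "gen_basis GZ m = scale (inverse p ^ m) (e m)"

definition gen_op :: "gen \<Rightarrow> (nat \<Rightarrow>\<^sub>0 'k) \<Rightarrow> (nat \<Rightarrow>\<^sub>0 'k)" where
  "gen_op v u = lincomb u (gen_basis v)"

definition free_act :: "(gen list \<Rightarrow>\<^sub>0 'k) \<Rightarrow> (nat \<Rightarrow>\<^sub>0 'k) \<Rightarrow> (nat \<Rightarrow>\<^sub>0 'k)" where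
  "free_act f v = lincomb f (\<lambda>w. foldr gen_op w v)"

lemma gen_op_basis [simp]: "gen_op v (e m) = gen_basis v m"
  by (simp add: gen_op_def)

lemma linear_gen_op: "linear_op (gen_op v)"
  using linear_op_lincomb[of "gen_basis v"] by (simp add: gen_op_def[abs_def])

lemma linear_word: "linear_op (foldr gen_op w)"
  by (induction w) (simp_all add: linear_op_id[unfolded id_def[symmetric]] linear_op_def linear_opD[OF linear_gen_op])

sublocale F: seq_rep free_algebra free_act
  unfolding free_algebra_def free_act_def[abs_def]
  by (rule seq_rep_monoid_algebra) (auto intro: monoidI simp: linear_word)

lemma free_act_gen [simp]: "free_act (free_gen v) u = gen_op v u"
  by (simp add: free_act_def free_gen_def)

lemma delta0: "q - inverse p \<noteq> 0"
proof
  assume "q - inverse p = 0" then have "q = inverse p" by simp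
  then show False using pq p0 by simp
qed

lemma weight_0 [simp]: "weight 0 = 0" by (simp add: weight_def)

lemma weight_Suc: "weight (Suc m) - q * weight m = inverse p ^ m"
  and weight_Suc': "weight (Suc m) - inverse p * weight m = q ^ m"
proof -
  have w: "weight n * (q - inverse p) = q ^ n - inverse p ^ n" for n
    using delta0 by (simp add: weight_def)
  have "(weight (Suc m) - q * weight m) * (q - inverse p) =
      weight (Suc m) * (q - inverse p) - q * (weight m * (q - inverse p))"
    "(weight (Suc m) - inverse p * weight m) * (q - inverse p) =
      weight (Suc m) * (q - inverse p) - inverse p * (weight m * (q - inverse p))"
    by (simp_all only: left_diff_distrib mult.assoc)
  then have "(weight (Suc m) - q * weight m) * (q - inverse p) = inverse p ^ m * (q - inverse p)"
    "(weight (Suc m) - inverse p * weight m) * (q - inverse p) = q ^ m * (q - inverse p)"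
    unfolding w by (simp_all add: algebra_simps)
  then show "weight (Suc m) - q * weight m = inverse p ^ m"
    "weight (Suc m) - inverse p * weight m = q ^ m"
    using delta0 by simp_all
qed

lemma gen_op_yx: "gen_op GY (gen_op GX (e m)) = scale (weight (Suc m)) (e m)"
  and gen_op_xy: "gen_op GX (gen_op GY (e m)) = scale (weight m) (e m)"
  and gen_op_zx: "gen_op GZ (gen_op GX (e m)) = scale (inverse p) (gen_op GX (gen_op GZ (e m)))"
  and gen_op_zy: "gen_op GZ (gen_op GY (e m)) = scale p (gen_op GY (gen_op GZ (e m)))"
proof -
  note ops = gen_op_basis gen_basis.simps linear_opD(2,3)[OF linear_gen_op] scale_simps(2)
  show "gen_op GY (gen_op GX (e m)) = scale (weight (Suc m)) (e m)"
    "gen_op GZ (gen_op GX (e m)) = scale (inverse p) (gen_op GX (gen_op GZ (e m)))"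
    by (simp_all only: ops diff_Suc_1 power_Suc)
  show "gen_op GX (gen_op GY (e m)) = scale (weight m) (e m)"
    by (cases m) (simp_all only: ops diff_Suc_1 weight_0 scale_simps(4))
  show "gen_op GZ (gen_op GY (e m)) = scale p (gen_op GY (gen_op GZ (e m)))"
  proof (cases m)
    case (Suc n)
    have "weight m * inverse p ^ n = p * (inverse p ^ m * weight m)" using p0 by (simp add: Suc)
    then show ?thesis unfolding Suc by (simp only: ops diff_Suc_1)
  qed (simp_all only: ops weight_0 scale_simps(4,5) mult_zero_right)
qed

lemma H_relations_act:
  assumes "a \<in> H_relations p q" shows "free_act a v = 0"
proof (rule linear_op_eqI[of "free_act a" "\<lambda>_. 0"])
  show "linear_op (free_act a)" by (rule F.linear) simp
  show "linear_op (\<lambda>_. 0)" by (simp add: linear_op_def)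
  fix m
  have yx: "scale (weight (Suc m)) (e m) - scale (q * weight m) (e m) - gen_op GZ (e m) = 0"
    unfolding scale_diff_left[symmetric] weight_Suc by (simp del: scale_simps(6))
  consider
    "a = free_gen GZ \<otimes>\<^bsub>free_algebra\<^esub> free_gen GX \<ominus>\<^bsub>free_algebra\<^esub> (inverse p \<odot>\<^bsub>free_algebra\<^esub> (free_gen GX \<otimes>\<^bsub>free_algebra\<^esub> free_gen GZ))"
    | "a = free_gen GZ \<otimes>\<^bsub>free_algebra\<^esub> free_gen GY \<ominus>\<^bsub>free_algebra\<^esub> (p \<odot>\<^bsub>free_algebra\<^esub> (free_gen GY \<otimes>\<^bsub>free_algebra\<^esub> free_gen GZ))"
    | "a = free_gen GY \<otimes>\<^bsub>free_algebra\<^esub> free_gen GX \<ominus>\<^bsub>free_algebra\<^esub> (q \<odot>\<^bsub>free_algebra\<^esub> (free_gen GX \<otimes>\<^bsub>free_algebra\<^esub> free_gen GY)) \<ominus>\<^bsub>free_algebra\<^esub> free_gen GZ"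
    using assms unfolding H_relations_def Let_def by blast
  then show "free_act a (e m) = 0"
    by cases (use yx in \<open>simp_all add: F.act_minus gen_op_yx gen_op_xy gen_op_zx gen_op_zy
      del: gen_op_basis\<close>)
qed

lemma H_ideal_kernel: "H_ideal p q \<subseteq> F.kernel"
  unfolding H_ideal_def by (rule F.genideal_in_kernel) (simp_all add: H_relations_act)

abbreviation H_act :: "(gen list \<Rightarrow>\<^sub>0 'k) set \<Rightarrow> (nat \<Rightarrow>\<^sub>0 'k) \<Rightarrow> (nat \<Rightarrow>\<^sub>0 'k)" where
  "H_act \<equiv> quot_act free_act"

sublocale H: seq_rep "H_alg p q" H_act
  unfolding H_alg_def by (rule F.seq_rep_quot_algebra[OF ideal_H_ideal H_ideal_kernel])

lemma H_act_gen [simp]: "H_act (H_gen p q v) u = gen_op v u"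
  by (simp add: H_gen_def F.quot_act_coset[OF ideal_H_ideal H_ideal_kernel])

abbreviation "x \<equiv> H_gen p q GX"
abbreviation "y \<equiv> H_gen p q GY"
abbreviation "z \<equiv> H_gen p q GZ"
definition "\<theta> = y \<otimes>\<^bsub>H_alg p q\<^esub> x \<ominus>\<^bsub>H_alg p q\<^esub> (inverse p \<odot>\<^bsub>H_alg p q\<^esub> (x \<otimes>\<^bsub>H_alg p q\<^esub> y))"

sublocale Q: q_heisenberg "H_alg p q" p q x y z \<theta>
  unfolding \<theta>_def by (rule q_heisenberg_H_alg[OF p0 q0 pq])

text \<open>
  The eigenvalue is \<open>weight (m + 1) - p\<^sup>-\<^sup>1 weight m\<close>, the difference of the contributions of
  \<open>y x\<close> and \<open>x y\<close>.
\<close>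

lemma act_\<theta>: "H_act \<theta> (e m) = scale (q ^ m) (e m)"
proof -
  have "H_act \<theta> (e m) = scale (weight (Suc m)) (e m) - scale (inverse p * weight m) (e m)"
    by (simp add: \<theta>_def H.act_minus gen_op_yx gen_op_xy del: gen_op_basis scale_simps(6))
  then show ?thesis unfolding scale_diff_left[symmetric] weight_Suc' .
qed

lemma act_z: "H_act z (e m) = scale (inverse p ^ m) (e m)"
  by simp

end


section \<open>The quotient by the central element\<close>

text \<open>
  The relations give \<open>\<Sum>t. c t (g t)\<^bsup>m0\<^esup> P (g t) = 0\<close> for every polynomial \<open>P\<close>; a polynomial that vanishes at all
  \<open>g u\<close> except at \<open>g t\<close> isolates \<open>c t\<close>.
\<close>

lemma exponentials_independent:
  fixes g c :: "'t \<Rightarrow> 'k::field"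
  assumes T: "finite T" "inj_on g T" and nz: "\<And>t. t \<in> T \<Longrightarrow> g t \<noteq> 0"
    and sum: "\<And>m. m \<ge> m0 \<Longrightarrow> (\<Sum>t\<in>T. c t * g t ^ m) = 0" and t: "t \<in> T"
  shows "c t = 0"
proof -
  have poly: "(\<Sum>t\<in>T. c t * g t ^ m0 * poly P (g t)) = 0" for P
  proof -
    have "(\<Sum>t\<in>T. c t * g t ^ m0 * poly P (g t))
        = (\<Sum>t\<in>T. \<Sum>i\<le>degree P. coeff P i * (c t * g t ^ (m0 + i)))"
      by (simp add: poly_altdef sum_distrib_left power_add mult_ac)
    also have "\<dots> = (\<Sum>i\<le>degree P. coeff P i * (\<Sum>t\<in>T. c t * g t ^ (m0 + i)))"
      by (subst sum.swap) (simp add: sum_distrib_left)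
    finally show ?thesis by (simp add: sum)
  qed
  define P where "P = (\<Prod>u\<in>T - {t}. [:- g u, 1:])"
  have "poly P (g u) = 0" if "u \<in> T - {t}" for u
    using that T(1) by (auto simp: P_def poly_prod)
  then have "(\<Sum>u\<in>T. c u * g u ^ m0 * poly P (g u)) = (\<Sum>u\<in>{t}. c u * g u ^ m0 * poly P (g u))"
    using T(1) t by (intro sum.mono_neutral_right) auto
  then have "c t * g t ^ m0 * poly P (g t) = 0" by (simp add: poly)
  moreover have "poly P (g t) \<noteq> 0"
    using T t by (auto simp: P_def poly_prod inj_on_def)
  ultimately show ?thesis using nz[OF t] by simp
qed

context k_alg begin

definition comb :: "('t \<Rightarrow> 'a) \<Rightarrow> ('t \<Rightarrow>\<^sub>0 'k) \<Rightarrow> 'a" where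
  "comb N f = (\<Oplus>t\<in>Poly_Mapping.keys f. Poly_Mapping.lookup f t \<odot> N t)"

lemma comb_superset:
  assumes "\<And>t. N t \<in> carrier A" "finite S" "Poly_Mapping.keys f \<subseteq> S"
  shows "comb N f = (\<Oplus>t\<in>S. Poly_Mapping.lookup f t \<odot> N t)"
  unfolding comb_def using assms
  by (intro add.finprod_mono_neutral_cong_left) (auto simp: in_keys_iff)

lemma comb_closed: "(\<And>t. N t \<in> carrier A) \<Longrightarrow> comb N f \<in> carrier A"
  unfolding comb_def by (intro finsum_closed) auto

lemma comb_zero: "comb N 0 = \<zero>" by (simp add: comb_def)

lemma comb_single: "(\<And>t. N t \<in> carrier A) \<Longrightarrow> comb N (Poly_Mapping.single t c) = c \<odot> N t"
  by (subst comb_superset[of N "{t}"]) auto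

lemma comb_add:
  assumes N: "\<And>t. N t \<in> carrier A"
  shows "comb N (f + g) = comb N f \<oplus> comb N g"
proof -
  let ?S = "Poly_Mapping.keys f \<union> Poly_Mapping.keys g \<union> Poly_Mapping.keys (f + g)"
  have *: "comb N h = (\<Oplus>t\<in>?S. Poly_Mapping.lookup h t \<odot> N t)" if "h \<in> {f, g, f + g}" for h
    using that by (intro comb_superset N) auto
  have "(\<Oplus>t\<in>?S. Poly_Mapping.lookup (f + g) t \<odot> N t) =
    (\<Oplus>t\<in>?S. Poly_Mapping.lookup f t \<odot> N t \<oplus> Poly_Mapping.lookup g t \<odot> N t)"
    by (intro add.finprod_cong') (auto simp: lookup_add add_smult N)
  then show ?thesis using N by (simp add: * finsum_addf Pi_iff)
qed

lemma comb_smult: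
  assumes N: "\<And>t. N t \<in> carrier A"
  shows "comb N (scale c f) = c \<odot> comb N f"
proof -
  have "comb N (scale c f) = (\<Oplus>t\<in>Poly_Mapping.keys f. Poly_Mapping.lookup (scale c f) t \<odot> N t)"
    by (intro comb_superset N) (auto simp: in_keys_iff lookup_smult)
  also have "\<dots> = (\<Oplus>t\<in>Poly_Mapping.keys f. (c \<odot> \<one>) \<otimes> (Poly_Mapping.lookup f t \<odot> N t))"
    by (intro add.finprod_cong') (auto simp: lookup_smult N mult.commute)
  also have "\<dots> = (c \<odot> \<one>) \<otimes> comb N f"
    unfolding comb_def by (intro finsum_rdistr[symmetric]) (auto simp: N)
  also have "\<dots> = c \<odot> comb N f" using comb_closed[of N f] N by simp
  finally show ?thesis .
qed

end

lemma (in seq_rep) act_finsum: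
  assumes "\<And>t. t \<in> S \<Longrightarrow> N t \<in> carrier A"
  shows "\<rho> (\<Oplus>t\<in>S. N t) v = (\<Sum>t\<in>S. \<rho> (N t) v)"
  using assms by (induction S rule: infinite_finite_induct) (auto simp: Pi_iff)

lemma (in seq_rep) act_comb:
  assumes "\<And>t. N t \<in> carrier A"
  shows "\<rho> (comb N f) v = lincomb f (\<lambda>t. \<rho> (N t) v)"
  unfolding comb_def lincomb_def using assms by (subst act_finsum) auto

text \<open>
  On the Fock space \<open>\<Omega>\<close> acts by \<open>(q\<^sup>r p\<^sup>-\<^sup>s)\<^sup>m = 1\<close> on \<open>e\<^sub>m\<close>, so the quotient by \<open>\<Omega> - 1\<close> acts. As \<open>p\<close> is not a
  root of unity, all weights of positive index are nonzero and \<open>z\<close> has distinct eigenvalues.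
\<close>

locale fock_quotient = fock p q for p q :: "'k::field_char_0" +
  fixes r s :: nat
  assumes rs: "r > 0" "s > 0" "gcd r s = 1" and qp: "q ^ r = p ^ s"
    and not_root: "\<And>m. m > 0 \<Longrightarrow> p ^ m \<noteq> 1"
begin

abbreviation "H \<equiv> H_alg p q"
abbreviation "\<Omega> \<equiv> H_Omega p q r s"
definition "J = {(\<Omega> \<ominus>\<^bsub>H\<^esub> \<one>\<^bsub>H\<^esub>) \<otimes>\<^bsub>H\<^esub> h | h. h \<in> carrier H}"

lemma Omega_eq: "\<Omega> = \<theta> [^]\<^bsub>H\<^esub> r \<otimes>\<^bsub>H\<^esub> z [^]\<^bsub>H\<^esub> s"
  by (simp add: H_Omega_def \<theta>_def Let_def)

lemma Omega_centre: "\<Omega> \<in> H.centre"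
  unfolding Omega_eq by (rule Q.Omega_centre[OF qp])

lemma Omega_closed [simp]: "\<Omega> \<in> carrier H"
  using Omega_centre by (rule H.centreD)

lemma ideal_J: "ideal J H"
proof -
  have "\<Omega> \<ominus>\<^bsub>H\<^esub> \<one>\<^bsub>H\<^esub> \<in> H.centre"
    by (simp add: H.minus_smult H.centre_add Omega_centre H.centre_smult H.centre_one)
  then show ?thesis unfolding J_def by (rule H.ideal_centre_mult)
qed

lemma act_z_theta: "H_act (z [^]\<^bsub>H\<^esub> j \<otimes>\<^bsub>H\<^esub> \<theta> [^]\<^bsub>H\<^esub> k) (e m) = scale ((q ^ k * inverse p ^ j) ^ m) (e m)"
  and act_theta_z: "H_act (\<theta> [^]\<^bsub>H\<^esub> k \<otimes>\<^bsub>H\<^esub> z [^]\<^bsub>H\<^esub> j) (e m) = scale ((q ^ k * inverse p ^ j) ^ m) (e m)"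
proof -
  have "H_act (\<theta> [^]\<^bsub>H\<^esub> k) (e m) = scale ((q ^ m) ^ k) (e m)"
    "H_act (z [^]\<^bsub>H\<^esub> j) (e m) = scale ((inverse p ^ m) ^ j) (e m)"
    using H.act_eigen_pow[OF Q.theta_closed act_\<theta>] H.act_eigen_pow[OF Q.xyz_closed(3) act_z] by auto
  moreover have "(q ^ m) ^ k * (inverse p ^ m) ^ j = (q ^ k * inverse p ^ j) ^ m"
    by (simp add: power_mult_distrib power_mult[symmetric] mult.commute)
  ultimately show "H_act (z [^]\<^bsub>H\<^esub> j \<otimes>\<^bsub>H\<^esub> \<theta> [^]\<^bsub>H\<^esub> k) (e m) = scale ((q ^ k * inverse p ^ j) ^ m) (e m)"
    "H_act (\<theta> [^]\<^bsub>H\<^esub> k \<otimes>\<^bsub>H\<^esub> z [^]\<^bsub>H\<^esub> j) (e m) = scale ((q ^ k * inverse p ^ j) ^ m) (e m)"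
    by (simp_all add: linear_opD(2)[OF H.linear] mult.commute del: scale_simps(6) map_single)
qed

lemma act_Omega: "H_act \<Omega> v = v"
proof (rule linear_op_eqI[of "H_act \<Omega>" "\<lambda>v. v"])
  fix m
  have "q ^ r * inverse p ^ s = 1" using p0 by (simp add: qp power_inverse)
  then show "H_act \<Omega> (e m) = e m" unfolding Omega_eq act_theta_z by simp
qed (simp_all add: linear_op_id H.linear)

lemma J_kernel: "J \<subseteq> H.kernel"
  by (auto simp: J_def H.kernel_def H.act_minus act_Omega)

abbreviation "A \<equiv> A_alg p q r s"
abbreviation "A_act \<equiv> quot_act H_act"

lemma A_alg_eq: "A = quot_algebra H J"
  by (simp add: A_alg_def J_def Let_def)

sublocale A: seq_rep A A_act
  unfolding A_alg_eq by (rule H.seq_rep_quot_algebra[OF ideal_J J_kernel])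

abbreviation coset where "coset h \<equiv> J +>\<^bsub>H\<^esub> h"

lemmas A_ops = quot_algebra_ops[OF H.k_algebra ideal_J, folded A_alg_eq]

lemma A_act_coset: "h \<in> carrier H \<Longrightarrow> A_act (coset h) v = H_act h v"
  by (rule H.quot_act_coset[OF ideal_J J_kernel])

lemma coset_Omega_mult:
  assumes "h \<in> carrier H" shows "coset (\<Omega> \<otimes>\<^bsub>H\<^esub> h) = coset h"
proof -
  have "\<Omega> \<otimes>\<^bsub>H\<^esub> h \<ominus>\<^bsub>H\<^esub> h = (\<Omega> \<ominus>\<^bsub>H\<^esub> \<one>\<^bsub>H\<^esub>) \<otimes>\<^bsub>H\<^esub> h"
    using assms by (simp add: H.minus_smult H.l_distr)
  then have "\<Omega> \<otimes>\<^bsub>H\<^esub> h \<ominus>\<^bsub>H\<^esub> h \<in> J" using assms by (auto simp: J_def)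
  then show ?thesis using assms by (simp add: A_ops(7))
qed

lemma M_shift: "Q.M d (j + s) (k + r) = \<Omega> \<otimes>\<^bsub>H\<^esub> Q.M d j k"
proof -
  have qc: "H.q_commute 1 (z [^]\<^bsub>H\<^esub> s) (\<theta> [^]\<^bsub>H\<^esub> (k + r))"
    using H.q_commute_pow_right[OF _ _ H.q_commute_pow_left[OF _ _ Q.qc_z_theta], of s "k + r"] by simp
  have "z [^]\<^bsub>H\<^esub> (j + s) \<otimes>\<^bsub>H\<^esub> \<theta> [^]\<^bsub>H\<^esub> (k + r) = z [^]\<^bsub>H\<^esub> j \<otimes>\<^bsub>H\<^esub> (z [^]\<^bsub>H\<^esub> s \<otimes>\<^bsub>H\<^esub> \<theta> [^]\<^bsub>H\<^esub> (k + r))"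
    by (simp add: H.nat_pow_mult[symmetric] H.m_assoc)
  also have "z [^]\<^bsub>H\<^esub> s \<otimes>\<^bsub>H\<^esub> \<theta> [^]\<^bsub>H\<^esub> (k + r) = \<theta> [^]\<^bsub>H\<^esub> (k + r) \<otimes>\<^bsub>H\<^esub> z [^]\<^bsub>H\<^esub> s"
    using H.q_commuteD[OF qc] by simp
  also have "\<dots> = \<theta> [^]\<^bsub>H\<^esub> k \<otimes>\<^bsub>H\<^esub> \<Omega>"
    by (simp add: Omega_eq H.nat_pow_mult[symmetric] H.m_assoc)
  finally have "Q.M d (j + s) (k + r) = Q.M d j k \<otimes>\<^bsub>H\<^esub> \<Omega>"
    by (simp add: Q.M_def H.m_assoc)
  then show ?thesis using H.centreD(2)[OF Omega_centre Q.M_closed] by simp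
qed

lemma coset_M_shift: "coset (Q.M d (j + t * s) (k + t * r)) = coset (Q.M d j k)"
proof (induction t)
  case (Suc t)
  have "Q.M d (j + Suc t * s) (k + Suc t * r) = \<Omega> \<otimes>\<^bsub>H\<^esub> Q.M d (j + t * s) (k + t * r)"
    using M_shift[of d "j + t * s" "k + t * r"] by (simp add: add_ac)
  then show ?case using Suc coset_Omega_mult by simp
qed simp

text \<open>
  Modulo \<open>\<Omega> = 1\<close>, shifting the exponents \<open>(j, k)\<close> by \<open>(s, r)\<close> does not change a monomial. As \<open>r\<close> and \<open>s\<close> are
  coprime, two pairs with the same value of \<open>s k - r j\<close> differ by a multiple of \<open>(s, r)\<close>.
\<close>

lemma coset_M_eq:
  assumes "int s * int k - int r * int j = int s * int k' - int r * int j'"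
  shows "coset (Q.M d j k) = coset (Q.M d j' k')"
proof -
  have main: "coset (Q.M d j k) = coset (Q.M d j' k')"
    if eq: "int s * int k - int r * int j = int s * int k' - int r * int j'" and le: "j' \<le> j" for j k j' k'
  proof -
    have e: "int s * (int k - int k') = int r * (int j - int j')" using eq by (simp add: algebra_simps)
    have "coprime (int s) (int r)" using rs(3) by (simp add: coprime_iff_gcd_eq_1 gcd.commute)
    then have "int s dvd int j - int j'" using e by (metis coprime_dvd_mult_right_iff dvd_triv_left)
    then obtain t where t: "int j - int j' = int s * t" by (auto simp: dvd_def)
    then have "t \<ge> 0" using le rs(2) by (metis of_nat_0_less_iff of_nat_mono diff_ge_0_iff_ge zero_le_mult_iff not_less)
    then obtain u where u: "t = int u" using nonneg_int_cases by blast
    have "int s * (int k - int k') = int s * (int r * int u)" using e t u by simp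
    then have "int k - int k' = int r * int u" using rs(2) by simp
    then have "k = k' + u * r" "j = j' + u * s"
      using t u by (simp_all flip: of_nat_mult of_nat_add add: algebra_simps)
    then show ?thesis using coset_M_shift by simp
  qed
  show ?thesis using main[OF assms] main[OF assms[symmetric]] by (cases "j' \<le> j") simp_all
qed

text \<open>
  A solution in integers, from Bezout, is made nonnegative by adding a multiple of \<open>(s, r)\<close>.
\<close>

lemma exponent_exists: "\<exists>j k. int s * int k - int r * int j = n"
proof -
  have "coprime (int s) (int r)" using rs(3) by (simp add: coprime_iff_gcd_eq_1 gcd.commute)
  then obtain u v where uv: "u * int s + v * int r = 1"
    using bezout_int[of "int s" "int r"] by (auto simp: coprime_iff_gcd_eq_1)
  define t where "t = \<bar>n * u\<bar> + \<bar>n * v\<bar>"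
  have "t \<ge> 0" "int r \<ge> 1" "int s \<ge> 1" using rs by (simp_all add: t_def)
  then have "t \<le> t * int r" "t \<le> t * int s" by (simp_all add: mult_le_cancel_left1)
  then have nn: "n * u + t * int r \<ge> 0" "- (n * v) + t * int s \<ge> 0"
  proof -
    have "- (n * u) \<le> t" "n * v \<le> t" by (simp_all add: t_def abs_if)
    then show "n * u + t * int r \<ge> 0" "- (n * v) + t * int s \<ge> 0"
      using \<open>t \<le> t * int r\<close> \<open>t \<le> t * int s\<close> by linarith+
  qed
  have "int s * (n * u + t * int r) - int r * (- (n * v) + t * int s) = n * (u * int s + v * int r)"
    by (simp add: algebra_simps)
  then have "int s * int (nat (n * u + t * int r)) - int r * int (nat (- (n * v) + t * int s)) = n"
    using nn uv by simp
  then show ?thesis by blast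
qed

definition exponents :: "int \<Rightarrow> nat \<times> nat" where
  "exponents n = (SOME (j, k). int s * int k - int r * int j = n)"

lemma exponents: "int s * int (snd (exponents n)) - int r * int (fst (exponents n)) = n"
proof -
  have "\<exists>t. (\<lambda>(j, k). int s * int k - int r * int j = n) t" using exponent_exists by auto
  from someI_ex[OF this] show ?thesis unfolding exponents_def by (simp add: case_prod_unfold)
qed

text \<open>
  The scalar by which \<open>z\<^sup>j \<theta>\<^sup>k\<close> with \<open>s k - r j = n\<close> acts on \<open>e\<^sub>1\<close>; on \<open>e\<^sub>m\<close> it acts by the \<open>m\<close>-th power.
  These exponentials in \<open>m\<close> distinguish the monomials of one degree.
\<close>

definition \<mu> :: "int \<Rightarrow> 'k" where
  "\<mu> n = q ^ snd (exponents n) * inverse p ^ fst (exponents n)"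

lemma mu_nonzero: "\<mu> n \<noteq> 0" using p0 q0 by (simp add: \<mu>_def)

lemma p_power_inj: "p ^ a = p ^ b \<Longrightarrow> a = b"
proof -
  have main: "a = b" if "p ^ a = p ^ b" "a \<le> b" for a b
  proof (rule ccontr)
    assume "a \<noteq> b"
    then have "b - a > 0" using that by simp
    moreover have "p ^ b = p ^ a * p ^ (b - a)" using that(2) by (simp flip: power_add)
    ultimately show False using that(1) not_root[of "b - a"] p0 by simp
  qed
  assume "p ^ a = p ^ b"
  then show "a = b" using main[of a b] main[of b a] by (cases "a \<le> b") simp_all
qed

text \<open>
  The \<open>r\<close>-th power of \<open>\<mu> n = q\<^sup>k p\<^sup>-\<^sup>j\<close> is \<open>p\<^sup>n\<close>, because \<open>q\<^sup>r = p\<^sup>s\<close> and \<open>n = s k - r j\<close>.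
\<close>

lemma mu_inj: "inj \<mu>"
proof (rule injI)
  fix n n' assume "\<mu> n = \<mu> n'"
  then obtain j k j' k' where exps: "exponents n = (j, k)" "exponents n' = (j', k')"
    and eq: "q ^ k * inverse p ^ j = q ^ k' * inverse p ^ j'"
    unfolding \<mu>_def by (metis prod.collapse)
  have "q ^ k * p ^ j' = (q ^ k * inverse p ^ j) * (p ^ j * p ^ j')" using p0 by (simp add: power_inverse)
  also have "\<dots> = q ^ k' * p ^ j" unfolding eq using p0 by (simp add: power_inverse)
  finally have "(q ^ k * p ^ j') ^ r = (q ^ k' * p ^ j) ^ r" by simp
  then have "(q ^ r) ^ k * p ^ (j' * r) = (q ^ r) ^ k' * p ^ (j * r)"
    by (simp add: power_mult_distrib power_mult[symmetric] mult.commute)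
  then have "p ^ (s * k + j' * r) = p ^ (s * k' + j * r)"
    by (simp add: qp power_mult power_add)
  then have "s * k + j' * r = s * k' + j * r" by (rule p_power_inj)
  then have "int s * int k + int j' * int r = int s * int k' + int j * int r"
    by (metis of_nat_add of_nat_mult)
  then show "n = n'" using exponents[of n] exponents[of n'] exps by (simp add: algebra_simps)
qed

text \<open>
  A zero weight means \<open>(p q)\<^sup>m = 1\<close>; raised to the power \<open>r\<close> this reads \<open>p\<^bsup>(r + s) m\<^esup> = 1\<close>.
\<close>

lemma weight_nonzero:
  assumes "m > 0" shows "weight m \<noteq> 0"
proof
  assume "weight m = 0"
  then have "q ^ m = inverse p ^ m" using delta0 by (simp add: weight_def)
  then have "(p * q) ^ m = 1" using p0 by (simp add: power_mult_distrib power_inverse)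
  then have "((p * q) ^ m) ^ r = 1" by simp
  then have "(p ^ r * q ^ r) ^ m = 1"
    by (simp add: power_mult_distrib power_mult[symmetric] mult.commute)
  then have "p ^ ((r + s) * m) = 1" by (simp add: qp power_add[symmetric] power_mult[symmetric])
  then show False using not_root[of "(r + s) * m"] assms rs by simp
qed

lemma act_B:
  assumes "nat \<bar>d\<bar> \<le> m"
  shows "\<exists>\<kappa>. \<kappa> \<noteq> 0 \<and> H_act (Q.B d) (e m) = scale \<kappa> (e (nat (int m + d)))"
proof (cases d rule: Q.int_dest)
  case (1 n)
  have "H_act (x [^]\<^bsub>H\<^esub> n) (e m) = e (m + n)" for m
    by (induction n arbitrary: m) (simp_all del: single_one)
  then have "H_act (Q.B d) (e m) = scale 1 (e (nat (int m + d)))"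
    unfolding 1 Q.B_of_nat by (simp add: nat_int_add del: scale_simps(6) map_single)
  then show ?thesis by (intro exI[of _ 1]) simp
next
  case (2 n')
  define n where "n = Suc n'"
  have lower: "\<exists>\<kappa>. \<kappa> \<noteq> 0 \<and> H_act (y [^]\<^bsub>H\<^esub> n) (e m) = scale \<kappa> (e (m - n))" if "n \<le> m" for m
    using that
  proof (induction n arbitrary: m)
    case 0
    show ?case by (intro exI[of _ 1]) simp
  next
    case (Suc n)
    then obtain \<kappa> where \<kappa>: "\<kappa> \<noteq> 0" "H_act (y [^]\<^bsub>H\<^esub> n) (e (m - Suc 0)) = scale \<kappa> (e (m - Suc 0 - n))"
      by (metis One_nat_def Suc_le_eq le_diff_conv2 Suc_eq_plus1 add_leD2 plus_1_eq_Suc)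
    have "H_act (y [^]\<^bsub>H\<^esub> Suc n) (e m) = scale (weight m) (scale \<kappa> (e (m - 1 - n)))"
      by (simp add: linear_opD(2)[OF H.linear] \<kappa>(2) del: scale_simps(2,6) map_single)
    then have "H_act (y [^]\<^bsub>H\<^esub> Suc n) (e m) = scale (weight m * \<kappa>) (e (m - Suc n))"
      by (simp del: scale_simps(6) map_single)
    then show ?case using \<kappa>(1) weight_nonzero[of m] Suc.prems by (intro exI[of _ "weight m * \<kappa>"]) simp
  qed
  have "n \<le> m" using assms 2 by (simp add: n_def)
  then obtain \<kappa> where "\<kappa> \<noteq> 0" "H_act (y [^]\<^bsub>H\<^esub> n) (e m) = scale \<kappa> (e (m - n))"
    using lower by blast
  moreover have "nat (int m + d) = m - n" using 2 by (simp add: n_def)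
  ultimately show ?thesis unfolding 2 n_def[symmetric] Q.B_of_nat by auto
qed

definition \<kappa> :: "int \<Rightarrow> nat \<Rightarrow> 'k" where
  "\<kappa> d m = (SOME c. c \<noteq> 0 \<and> H_act (Q.B d) (e m) = scale c (e (nat (int m + d))))"

lemma kappa:
  assumes "nat \<bar>d\<bar> \<le> m"
  shows "\<kappa> d m \<noteq> 0" "H_act (Q.B d) (e m) = scale (\<kappa> d m) (e (nat (int m + d)))"
  using someI_ex[OF act_B[OF assms]] by (simp_all add: \<kappa>_def)

text \<open>
  The classes of monomials in the quotient, indexed by the degree \<open>d\<close> and by \<open>n = s k - r j\<close>, on which
  alone they depend.
\<close>

definition N :: "int \<times> int \<Rightarrow> (gen list \<Rightarrow>\<^sub>0 'k) set set" where
  "N = (\<lambda>(d, n). coset (Q.M d (fst (exponents n)) (snd (exponents n))))"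

lemma N_closed: "N t \<in> carrier A"
  by (cases t) (simp add: N_def A_ops)

lemma coset_M: "coset (Q.M d j k) = N (d, int s * int k - int r * int j)"
  unfolding N_def prod.case by (rule coset_M_eq) (simp add: exponents)

lemma act_N:
  assumes "nat \<bar>d\<bar> \<le> m"
  shows "A_act (N (d, n)) (e m) = scale (\<mu> n ^ m * \<kappa> d m) (e (nat (int m + d)))"
  by (simp add: N_def A_act_coset Q.M_def act_z_theta linear_opD(2)[OF H.linear] kappa(2)[OF assms] \<mu>_def
      del: scale_simps(6) map_single)

lemma A_comb:
  assumes "a \<in> carrier A" shows "\<exists>f. a = A.comb N f"
proof -
  from assms obtain h where h: "h \<in> carrier H" "a = coset h" by (auto simp: A_ops)
  from h(1) have "h \<in> H.lin_span Q.monomials" by (simp add: Q.span_monomials)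
  then have "h \<in> carrier H \<and> (\<exists>f. coset h = A.comb N f)"
  proof induction
    case zero
    have "coset \<zero>\<^bsub>H\<^esub> = coset (0 \<odot>\<^bsub>H\<^esub> \<zero>\<^bsub>H\<^esub>)" by simp
    also have "\<dots> = 0 \<odot>\<^bsub>A\<^esub> coset \<zero>\<^bsub>H\<^esub>" by (rule A_ops(4)[symmetric]) simp
    also have "\<dots> = \<zero>\<^bsub>A\<^esub>" by (rule A.zero_smult) (simp add: A_ops(1))
    also have "\<dots> = A.comb N 0" by (simp add: A.comb_zero)
    finally show ?case by auto
  next
    case (base h)
    then obtain d j k where "h = Q.M d j k" by (auto simp: Q.monomials_def)
    then have "h \<in> carrier H" "coset h = A.comb N (Poly_Mapping.single (d, int s * int k - int r * int j) 1)"
      by (simp_all add: coset_M A.comb_single N_closed)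
    then show ?case by blast
  next
    case (add h h')
    then obtain f f' where "coset h = A.comb N f" "coset h' = A.comb N f'" by auto
    then have "coset (h \<oplus>\<^bsub>H\<^esub> h') = A.comb N (f + f')"
      using add by (simp add: A.comb_add N_closed A_ops(3)[symmetric])
    then show ?case using add by auto
  next
    case (smult h c)
    then obtain f where "coset h = A.comb N f" by auto
    then have "coset (c \<odot>\<^bsub>H\<^esub> h) = A.comb N (scale c f)"
      using smult by (simp add: A.comb_smult N_closed A_ops(4)[symmetric])
    then show ?case using smult by auto
  qed
  then show ?thesis using h by auto
qed

text \<open>
  Let a combination of the \<open>N (d, n)\<close> act by zero. The coefficient of \<open>e\<^bsub>m + d\<^esub>\<close> in the image of \<open>e\<^sub>m\<close> is,
  up to a nonzero factor, the sum over \<open>n\<close> of the coefficients of degree \<open>d\<close> times \<open>(\<mu> n)\<^sup>m\<close>. It vanishes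
  for all large \<open>m\<close>, so that all coefficients vanish by the independence of exponentials.
\<close>

theorem faithful_A_act: "faithful_rep A seq_space A_act"
  unfolding faithful_rep_def
proof (intro ballI impI)
  fix a assume a: "a \<in> carrier A" and "\<forall>v\<in>carrier seq_space. A_act a v = \<zero>\<^bsub>seq_space\<^esub>"
  then have zero: "A_act a v = 0" for v by simp
  obtain f where f: "a = A.comb N f" using A_comb a by blast
  \<comment> \<open>A bound beyond which no lowering operator in the combination reaches below \<open>e\<^sub>0\<close>.\<close>
  define m0 where "m0 = (\<Sum>t\<in>Poly_Mapping.keys f. nat \<bar>fst t\<bar>)"
  have m0: "nat \<bar>fst t\<bar> \<le> m0" if "t \<in> Poly_Mapping.keys f" for t
    unfolding m0_def using that by (intro member_le_sum) auto
  have "Poly_Mapping.lookup f t = 0" if t: "t \<in> Poly_Mapping.keys f" for t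
  proof -
    define T where "T = {u \<in> Poly_Mapping.keys f. fst u = fst t}"
    have "(\<Sum>u\<in>T. Poly_Mapping.lookup f u * \<mu> (snd u) ^ m) = 0" if m: "m \<ge> m0" for m
    proof -
      let ?i = "nat (int m + fst t)"
      have "0 = Poly_Mapping.lookup (A_act a (e m)) ?i" by (simp add: zero)
      also have "\<dots> = (\<Sum>u\<in>Poly_Mapping.keys f. Poly_Mapping.lookup f u * Poly_Mapping.lookup (A_act (N u) (e m)) ?i)"
        unfolding f by (simp add: A.act_comb[OF N_closed] lookup_lincomb)
      also have "\<dots> = (\<Sum>u\<in>Poly_Mapping.keys f. if fst u = fst t
          then Poly_Mapping.lookup f u * \<mu> (snd u) ^ m * \<kappa> (fst t) m else 0)"
      proof (rule sum.cong[OF refl])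
        fix u assume u: "u \<in> Poly_Mapping.keys f"
        have "nat \<bar>fst u\<bar> \<le> m" "nat \<bar>fst t\<bar> \<le> m" using m0[OF u] m0[OF t] m by simp_all
        moreover from this have "nat (int m + fst u) = ?i \<longleftrightarrow> fst u = fst t" by auto
        ultimately show "Poly_Mapping.lookup f u * Poly_Mapping.lookup (A_act (N u) (e m)) ?i = (if fst u = fst t
          then Poly_Mapping.lookup f u * \<mu> (snd u) ^ m * \<kappa> (fst t) m else 0)"
          using act_N[of "fst u" m "snd u"] by (simp add: lookup_single when_def)
      qed
      also have "\<dots> = (\<Sum>u\<in>T. Poly_Mapping.lookup f u * \<mu> (snd u) ^ m) * \<kappa> (fst t) m"
        unfolding T_def sum_distrib_right
        by (intro sum.mono_neutral_cong_right) auto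
      finally show ?thesis using kappa(1)[of "fst t" m] m0[OF t] m by simp
    qed
    moreover have "inj_on (\<lambda>u. \<mu> (snd u)) T"
      using injD[OF mu_inj] by (auto simp: inj_on_def T_def prod_eq_iff)
    moreover have "finite T" "t \<in> T" using t by (auto simp: T_def)
    ultimately show ?thesis
      using exponentials_independent[of T "\<lambda>u. \<mu> (snd u)" m0 "Poly_Mapping.lookup f" t] mu_nonzero by blast
  qed
  then have "f = 0" by (metis in_keys_iff keys_eq_empty all_not_in_conv)
  then show "a = \<zero>\<^bsub>A\<^esub>" by (simp add: f A.comb_zero)
qed

text \<open>
  The raising and lowering operators connect any two basis vectors. An element that moves \<open>e\<^sub>i\<close> as
  required is then corrected, for one unwanted index \<open>l\<close> after the other, by the factor
  \<open>z - p\<^sup>-\<^sup>l\<close>, which annihilates \<open>e\<^sub>l\<close> and is nonzero on \<open>e\<^sub>i\<close>.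
\<close>

theorem separating_A_act: "separating A A_act"
  unfolding separating_def
proof (intro allI impI)
  define gx gy gz where "gx = coset x" and "gy = coset y" and "gz = coset z"
  have closed: "gx \<in> carrier A" "gy \<in> carrier A" "gz \<in> carrier A" by (auto simp: gx_def gy_def gz_def A_ops)
  have gx: "A_act gx (e m) = e (Suc m)" and gy: "A_act gy (e m) = scale (weight m) (e (m - 1))"
    and gz: "A_act gz (e m) = scale (inverse p ^ m) (e m)" for m
    by (simp_all add: gx_def gy_def gz_def A_act_coset del: scale_simps(6) map_single)
  define R where "R i j \<longleftrightarrow> (\<exists>a\<in>carrier A. A_act a (e i) = e j)" for i j
  have R_trans: "R i k" if "R i j" "R j k" for i j k
  proof -
    from that obtain a b where "a \<in> carrier A" "A_act a (e i) = e j" "b \<in> carrier A" "A_act b (e j) = e k"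
      by (auto simp: R_def)
    then have "A_act (b \<otimes>\<^bsub>A\<^esub> a) (e i) = e k" "b \<otimes>\<^bsub>A\<^esub> a \<in> carrier A" by simp_all
    then show ?thesis by (auto simp: R_def)
  qed
  have R_refl: "R i i" for i unfolding R_def by (rule bexI[of _ "\<one>\<^bsub>A\<^esub>"]) simp_all
  have up: "R i (Suc i)" for i using gx closed by (auto simp: R_def)
  have down: "R (Suc i) i" for i
    unfolding R_def
    by (rule bexI[of _ "inverse (weight (Suc i)) \<odot>\<^bsub>A\<^esub> gy"]) (use closed weight_nonzero[of "Suc i"] in \<open>simp_all add: gy\<close>)
  have "R i 0" "R 0 i" for i
    by (induction i) (blast intro: R_refl R_trans[OF down] R_trans[OF _ up])+
  then have R: "R i j" for i j by (blast intro: R_trans)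
  fix S :: "nat set" and i j assume "finite S"
  then show "\<exists>a\<in>carrier A. A_act a (e i) = e j \<and> (\<forall>k\<in>S - {i}. A_act a (e k) = 0)"
  proof induction
    case empty
    then show ?case using R[of i j] by (auto simp: R_def)
  next
    case (insert l S)
    then obtain a where a: "a \<in> carrier A" "A_act a (e i) = e j" "\<forall>k\<in>S - {i}. A_act a (e k) = 0" by blast
    show ?case
    proof (cases "l = i")
      case True
      then show ?thesis using a by auto
    next
      case False
      define c where "c = inverse p ^ i - inverse p ^ l"
      have "c \<noteq> 0" using p_power_inj[of i l] False by (auto simp: c_def power_inverse)
      define b where "b = inverse c \<odot>\<^bsub>A\<^esub> (a \<otimes>\<^bsub>A\<^esub> (gz \<ominus>\<^bsub>A\<^esub> (inverse p ^ l \<odot>\<^bsub>A\<^esub> \<one>\<^bsub>A\<^esub>)))"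
      have b: "b \<in> carrier A" using a(1) closed by (simp add: b_def A.minus_smult)
      have act: "A_act b (e k) = scale (inverse c * (inverse p ^ k - inverse p ^ l)) (A_act a (e k))" for k
        using a(1) closed
        by (simp add: b_def A.act_minus gz scale_diff_left[symmetric] A.minus_smult[symmetric]
            linear_opD(2)[OF A.linear] del: scale_simps(6) map_single)
      have "A_act b (e i) = e j" using \<open>c \<noteq> 0\<close> by (simp add: act a(2) c_def)
      moreover have "\<forall>k\<in>insert l S - {i}. A_act b (e k) = 0"
      proof
        fix k assume "k \<in> insert l S - {i}"
        then consider "k = l" | "k \<in> S - {i}" by blast
        then show "A_act b (e k) = 0" using a(3) by cases (simp_all add: act del: map_single)
      qed
      ultimately show ?thesis using b by blast
    qed
  qed
qed

theorem faithful_separating_rep_A: "faithful_separating_rep A A_act"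
  using faithful_A_act separating_A_act A.seq_rep_axioms by (simp add: faithful_separating_rep_def)

end


section \<open>Tensor products of representations\<close>

text \<open>
  The tensor product of two sequences, again as a sequence, with the basis vectors \<open>e\<^sub>i \<otimes> e\<^sub>j\<close>
  numbered by the pairing function.
\<close>

lift_definition vec_tensor :: "(nat \<Rightarrow>\<^sub>0 'k::field) \<Rightarrow> (nat \<Rightarrow>\<^sub>0 'k) \<Rightarrow> (nat \<Rightarrow>\<^sub>0 'k)"
  is "\<lambda>u v n. u (fst (prod_decode n)) * v (snd (prod_decode n))"
proof -
  fix u v :: "nat \<Rightarrow> 'k" assume fin: "finite {n. u n \<noteq> 0}" "finite {n. v n \<noteq> 0}"
  have "{n. u (fst (prod_decode n)) * v (snd (prod_decode n)) \<noteq> 0}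
      \<subseteq> prod_encode ` ({n. u n \<noteq> 0} \<times> {n. v n \<noteq> 0})"
  proof
    fix n assume "n \<in> {n. u (fst (prod_decode n)) * v (snd (prod_decode n)) \<noteq> 0}"
    then have "prod_decode n \<in> {n. u n \<noteq> 0} \<times> {n. v n \<noteq> 0}" by (auto simp: mem_Times_iff)
    then show "n \<in> prod_encode ` ({n. u n \<noteq> 0} \<times> {n. v n \<noteq> 0})"
      by (metis imageI prod_decode_inverse)
  qed
  then show "finite {n. u (fst (prod_decode n)) * v (snd (prod_decode n)) \<noteq> 0}"
    using fin by (meson finite_SigmaI finite_imageI finite_subset)
qed

lemma lookup_vec_tensor: "Poly_Mapping.lookup (vec_tensor u v) n =
    Poly_Mapping.lookup u (fst (prod_decode n)) * Poly_Mapping.lookup v (snd (prod_decode n))"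
  by transfer simp

lemma vec_tensor_bilinear:
  "vec_tensor (u + u') v = vec_tensor u v + vec_tensor u' v" "vec_tensor u (v + v') = vec_tensor u v + vec_tensor u v'"
  "vec_tensor (scale c u) v = scale c (vec_tensor u v)" "vec_tensor u (scale c v) = scale c (vec_tensor u v)"
  "vec_tensor 0 v = 0" "vec_tensor u 0 = 0"
  by (rule poly_mapping_eqI; simp add: lookup_vec_tensor lookup_add lookup_smult algebra_simps)+

lemma vec_tensor_basis: "vec_tensor (e i) (e j) = e (prod_encode (i, j))"
proof (rule poly_mapping_eqI)
  fix n
  have "prod_encode (i, j) = n \<longleftrightarrow> i = fst (prod_decode n) \<and> j = snd (prod_decode n)"
    by (metis fst_conv prod.collapse prod_decode_inverse prod_encode_inverse snd_conv)
  then show "Poly_Mapping.lookup (vec_tensor (e i) (e j)) n = Poly_Mapping.lookup (e (prod_encode (i, j))) n"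
    by (auto simp: lookup_vec_tensor lookup_single when_def)
qed

definition op_tensor ::
    "((nat \<Rightarrow>\<^sub>0 'k::field) \<Rightarrow> (nat \<Rightarrow>\<^sub>0 'k)) \<Rightarrow> ((nat \<Rightarrow>\<^sub>0 'k) \<Rightarrow> (nat \<Rightarrow>\<^sub>0 'k)) \<Rightarrow> (nat \<Rightarrow>\<^sub>0 'k) \<Rightarrow> (nat \<Rightarrow>\<^sub>0 'k)" where
  "op_tensor S T v = lincomb v (\<lambda>n. vec_tensor (S (e (fst (prod_decode n)))) (T (e (snd (prod_decode n)))))"

lemma linear_op_tensor: "linear_op (op_tensor S T)"
  unfolding op_tensor_def[abs_def] by (rule linear_op_lincomb)

lemma op_tensor_basis: "op_tensor S T (e n) = vec_tensor (S (e (fst (prod_decode n)))) (T (e (snd (prod_decode n))))"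
  by (simp add: op_tensor_def)

lemma linear_op_vec_tensor:
  assumes "linear_op T"
  shows "linear_op (\<lambda>v. vec_tensor u (T v))" "linear_op (\<lambda>v. vec_tensor (T v) u)"
  by (simp_all only: linear_op_def vec_tensor_bilinear linear_opD[OF assms] simp_thms)

lemma op_tensor_vec_tensor:
  assumes S: "linear_op S" and T: "linear_op T"
  shows "op_tensor S T (vec_tensor u v) = vec_tensor (S u) (T v)"
proof -
  have basis: "op_tensor S T (vec_tensor (e i) (e j)) = vec_tensor (S (e i)) (T (e j))" for i j
    unfolding vec_tensor_basis op_tensor_basis by simp
  have right: "linear_op (\<lambda>v. op_tensor S T (vec_tensor w v))" for w
    by (rule linear_op_comp[OF linear_op_tensor linear_op_vec_tensor(1)[OF linear_op_id]])
  have left: "linear_op (\<lambda>u. op_tensor S T (vec_tensor u w))" for w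
    by (rule linear_op_comp[OF linear_op_tensor linear_op_vec_tensor(2)[OF linear_op_id]])
  have "op_tensor S T (vec_tensor (e i) v) = vec_tensor (S (e i)) (T v)" for i
    by (rule linear_op_eqI[OF right linear_op_vec_tensor(1)[OF T] basis])
  then show ?thesis
    by (rule linear_op_eqI[OF left linear_op_vec_tensor(2)[OF S]])
qed

lemma linear_op_vec_tensor_eqI:
  assumes "linear_op S" "linear_op T" "\<And>i j. S (vec_tensor (e i) (e j)) = T (vec_tensor (e i) (e j))"
  shows "S v = T v"
proof (rule linear_op_eqI[OF assms(1,2)])
  fix n
  have "vec_tensor (e (fst (prod_decode n))) (e (snd (prod_decode n))) = (e n :: nat \<Rightarrow>\<^sub>0 'a)"
    by (simp add: vec_tensor_basis)
  then show "S (e n) = T (e n)" using assms(3) by metis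
qed

lemma lincomb_minus: "lincomb (f - g) h = lincomb f h - lincomb g h"
  using lincomb_add[of "f - g" g h] by simp

text \<open>
  The action of \<open>b \<otimes> a\<close> on \<open>v \<otimes> w\<close> is \<open>b v \<otimes> a w\<close>. It is first defined for the monoid algebra of pairs,
  whose quotient by the bilinearity relations is the tensor product.
\<close>

locale tensor_rep = B: seq_rep B \<rho> + A: seq_rep A \<tau>
  for B :: "('k::field, 'b) module" and \<rho> and A :: "('k, 'a) module" and \<tau>
begin

abbreviation F :: "('k, 'b \<times> 'a \<Rightarrow>\<^sub>0 'k) module" where
  "F \<equiv> monoid_algebra (B \<times>\<times> A)"

definition I where "I = Idl\<^bsub>F\<^esub> (bilinear_relations B A)"

abbreviation T where "T \<equiv> tensor B A"

lemma T_eq: "T = quot_algebra F I"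
  by (simp add: tensor_def I_def Let_def)

definition pair_act :: "'b \<times> 'a \<Rightarrow> (nat \<Rightarrow>\<^sub>0 'k) \<Rightarrow> (nat \<Rightarrow>\<^sub>0 'k)" where
  "pair_act u = op_tensor (\<rho> (fst u)) (\<tau> (snd u))"

definition F_act where "F_act f v = lincomb f (\<lambda>u. pair_act u v)"

lemma pair_act_vec_tensor:
  "b \<in> carrier B \<Longrightarrow> a \<in> carrier A \<Longrightarrow> pair_act (b, a) (vec_tensor u v) = vec_tensor (\<rho> b u) (\<tau> a v)"
  by (simp add: pair_act_def op_tensor_vec_tensor B.linear A.linear)

lemma linear_pair_act: "linear_op (pair_act u)"
  unfolding pair_act_def by (rule linear_op_tensor)

lemma monoid_pairs: "Group.monoid (B \<times>\<times> A)"
  by (intro DirProd_monoid) unfold_locales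

sublocale F: seq_rep F F_act
  unfolding F_act_def[abs_def]
proof (rule seq_rep_monoid_algebra[OF monoid_pairs linear_pair_act])
  fix u w v assume "u \<in> carrier (B \<times>\<times> A)" "w \<in> carrier (B \<times>\<times> A)"
  then obtain b a b' a' where uw: "u = (b, a)" "w = (b', a')"
    "b \<in> carrier B" "a \<in> carrier A" "b' \<in> carrier B" "a' \<in> carrier A" by auto
  show "pair_act (u \<otimes>\<^bsub>B \<times>\<times> A\<^esub> w) v = pair_act u (pair_act w v)"
    by (rule linear_op_vec_tensor_eqI[of "pair_act (u \<otimes>\<^bsub>B \<times>\<times> A\<^esub> w)" "\<lambda>v. pair_act u (pair_act w v)"])
      (use uw in \<open>simp_all add: linear_pair_act linear_op_comp pair_act_vec_tensor\<close>)
next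
  show "pair_act \<one>\<^bsub>B \<times>\<times> A\<^esub> v = v" for v
    by (rule linear_op_vec_tensor_eqI[of "pair_act \<one>\<^bsub>B \<times>\<times> A\<^esub>" "\<lambda>v. v"])
      (simp_all add: linear_pair_act linear_op_id pair_act_vec_tensor one_DirProd)
qed

lemma single_closed: "b \<in> carrier B \<Longrightarrow> a \<in> carrier A \<Longrightarrow> Poly_Mapping.single (b, a) c \<in> carrier F"
  by (simp add: monoid_algebra_def)

lemma F_ops: "add F = (+)" "module.smult F = scale" "carrier F = {f. Poly_Mapping.keys f \<subseteq> carrier B \<times> carrier A}"
  by (simp_all add: monoid_algebra_def)

lemma F_diff: "f \<in> carrier F \<Longrightarrow> g \<in> carrier F \<Longrightarrow> f - g \<in> carrier F"
  using keys_diff[of f g] by (auto simp: F_ops)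

lemma F_minus: "f \<in> carrier F \<Longrightarrow> g \<in> carrier F \<Longrightarrow> f \<ominus>\<^bsub>F\<^esub> g = f - g"
  by (simp add: F.minus_smult F_ops) (rule poly_mapping_eqI, simp add: lookup_add lookup_smult lookup_minus)

lemma relations_closed: "bilinear_relations B A \<subseteq> carrier F"
  unfolding bilinear_relations_def Let_def
  by (auto intro!: F_diff single_closed)

lemma pair_act_linear:
  assumes "b \<in> carrier B" "a \<in> carrier A"
  shows "b' \<in> carrier B \<Longrightarrow> pair_act (b \<oplus>\<^bsub>B\<^esub> b', a) v = pair_act (b, a) v + pair_act (b', a) v"
    and "a' \<in> carrier A \<Longrightarrow> pair_act (b, a \<oplus>\<^bsub>A\<^esub> a') v = pair_act (b, a) v + pair_act (b, a') v"
    and "pair_act (c \<odot>\<^bsub>B\<^esub> b, a) v = scale c (pair_act (b, a) v)"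
    and "pair_act (b, c \<odot>\<^bsub>A\<^esub> a) v = scale c (pair_act (b, a) v)"
proof -
  note [simp] = assms vec_tensor_bilinear pair_act_vec_tensor linear_pair_act linear_opD[OF linear_pair_act]
  show "pair_act (b \<oplus>\<^bsub>B\<^esub> b', a) v = pair_act (b, a) v + pair_act (b', a) v" if [simp]: "b' \<in> carrier B"
    by (rule linear_op_vec_tensor_eqI[of "pair_act (b \<oplus>\<^bsub>B\<^esub> b', a)" "\<lambda>v. pair_act (b, a) v + pair_act (b', a) v"])
      (simp, simp add: linear_op_def add_ac, simp)
  show "pair_act (b, a \<oplus>\<^bsub>A\<^esub> a') v = pair_act (b, a) v + pair_act (b, a') v" if [simp]: "a' \<in> carrier A"
    by (rule linear_op_vec_tensor_eqI[of "pair_act (b, a \<oplus>\<^bsub>A\<^esub> a')" "\<lambda>v. pair_act (b, a) v + pair_act (b, a') v"])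
      (simp, simp add: linear_op_def add_ac, simp)
  show "pair_act (c \<odot>\<^bsub>B\<^esub> b, a) v = scale c (pair_act (b, a) v)"
    by (rule linear_op_vec_tensor_eqI[of "pair_act (c \<odot>\<^bsub>B\<^esub> b, a)" "\<lambda>v. scale c (pair_act (b, a) v)"])
      (simp, simp add: linear_op_def mult.commute, simp)
  show "pair_act (b, c \<odot>\<^bsub>A\<^esub> a) v = scale c (pair_act (b, a) v)"
    by (rule linear_op_vec_tensor_eqI[of "pair_act (b, c \<odot>\<^bsub>A\<^esub> a)" "\<lambda>v. scale c (pair_act (b, a) v)"])
      (simp, simp add: linear_op_def mult.commute, simp)
qed

lemma relations_act: "f \<in> bilinear_relations B A \<Longrightarrow> F_act f v = 0"
  unfolding bilinear_relations_def Let_def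
  by (auto simp: F_act_def lincomb_minus lincomb_smult pair_act_linear simp del: map_single scale_simps(6))

lemma ideal_I: "ideal I F"
  unfolding I_def by (rule ideal_bilinear[OF B.k_algebra A.k_algebra])

lemma I_kernel: "I \<subseteq> F.kernel"
  unfolding I_def by (rule F.genideal_in_kernel[OF relations_closed relations_act])

abbreviation "T_act \<equiv> quot_act F_act"

sublocale T: seq_rep T T_act
  unfolding T_eq by (rule F.seq_rep_quot_algebra[OF ideal_I I_kernel])

lemmas T_ops = quot_algebra_ops[OF F.k_algebra ideal_I, folded T_eq]

definition pure :: "'b \<Rightarrow> 'a \<Rightarrow> ('b \<times> 'a \<Rightarrow>\<^sub>0 'k) set" where
  "pure b a = I +>\<^bsub>F\<^esub> Poly_Mapping.single (b, a) 1"

lemma pure_closed: "b \<in> carrier B \<Longrightarrow> a \<in> carrier A \<Longrightarrow> pure b a \<in> carrier T"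
  by (simp add: pure_def T_ops single_closed)

lemma act_pure:
  assumes "b \<in> carrier B" "a \<in> carrier A"
  shows "T_act (pure b a) v = pair_act (b, a) v"
  using F.quot_act_coset[OF ideal_I I_kernel single_closed[OF assms], of 1 v]
  by (simp add: pure_def F_act_def)

lemma coset_eqI:
  assumes "f \<in> carrier F" "g \<in> carrier F" "f - g \<in> bilinear_relations B A"
  shows "I +>\<^bsub>F\<^esub> f = I +>\<^bsub>F\<^esub> g"
proof -
  have "f - g \<in> I" unfolding I_def using F.genideal_self[OF relations_closed] assms(3) by blast
  then show ?thesis using assms by (simp add: T_ops(7) F_minus)
qed

lemma pure_bilinear:
  assumes "b \<in> carrier B" "a \<in> carrier A"
  shows "b' \<in> carrier B \<Longrightarrow> pure (b \<oplus>\<^bsub>B\<^esub> b') a = pure b a \<oplus>\<^bsub>T\<^esub> pure b' a"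
    and "a' \<in> carrier A \<Longrightarrow> pure b (a \<oplus>\<^bsub>A\<^esub> a') = pure b a \<oplus>\<^bsub>T\<^esub> pure b a'"
    and "pure (c \<odot>\<^bsub>B\<^esub> b) a = c \<odot>\<^bsub>T\<^esub> pure b a"
    and "pure b (c \<odot>\<^bsub>A\<^esub> a) = c \<odot>\<^bsub>T\<^esub> pure b a"
proof -
  let ?s = "\<lambda>b a. Poly_Mapping.single (b, a) (1 :: 'k)"
  note cl = single_closed F.a_closed F.smult_closed
  show "pure (b \<oplus>\<^bsub>B\<^esub> b') a = pure b a \<oplus>\<^bsub>T\<^esub> pure b' a" if "b' \<in> carrier B"
  proof -
    have "?s (b \<oplus>\<^bsub>B\<^esub> b') a - ?s b a - ?s b' a \<in> bilinear_relations B A"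
      unfolding bilinear_relations_def Let_def using assms that by blast
    then have "?s (b \<oplus>\<^bsub>B\<^esub> b') a - (?s b a \<oplus>\<^bsub>F\<^esub> ?s b' a) \<in> bilinear_relations B A"
      by (simp add: F_ops diff_diff_eq)
    then show ?thesis using coset_eqI assms that by (simp add: pure_def T_ops single_closed)
  qed
  show "pure b (a \<oplus>\<^bsub>A\<^esub> a') = pure b a \<oplus>\<^bsub>T\<^esub> pure b a'" if "a' \<in> carrier A"
  proof -
    have "?s b (a \<oplus>\<^bsub>A\<^esub> a') - ?s b a - ?s b a' \<in> bilinear_relations B A"
      unfolding bilinear_relations_def Let_def using assms that by blast
    then have "?s b (a \<oplus>\<^bsub>A\<^esub> a') - (?s b a \<oplus>\<^bsub>F\<^esub> ?s b a') \<in> bilinear_relations B A"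
      by (simp add: F_ops diff_diff_eq)
    then show ?thesis using coset_eqI assms that by (simp add: pure_def T_ops single_closed)
  qed
  have "?s (c \<odot>\<^bsub>B\<^esub> b) a - c \<odot>\<^bsub>F\<^esub> ?s b a \<in> bilinear_relations B A"
    unfolding F_ops bilinear_relations_def Let_def using assms by blast
  then show "pure (c \<odot>\<^bsub>B\<^esub> b) a = c \<odot>\<^bsub>T\<^esub> pure b a"
    using coset_eqI assms by (simp add: pure_def T_ops single_closed)
  have "?s b (c \<odot>\<^bsub>A\<^esub> a) - c \<odot>\<^bsub>F\<^esub> ?s b a \<in> bilinear_relations B A"
    unfolding F_ops bilinear_relations_def Let_def using assms by blast
  then show "pure b (c \<odot>\<^bsub>A\<^esub> a) = c \<odot>\<^bsub>T\<^esub> pure b a"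
    using coset_eqI assms by (simp add: pure_def T_ops single_closed)
qed

lemma pure_zero:
  assumes "a \<in> carrier A" shows "pure \<zero>\<^bsub>B\<^esub> a = \<zero>\<^bsub>T\<^esub>"
  using pure_bilinear(3)[OF B.zero_closed assms, of 0] pure_closed[OF B.zero_closed assms] by simp

lemma pure_zero_right:
  assumes "b \<in> carrier B" shows "pure b \<zero>\<^bsub>A\<^esub> = \<zero>\<^bsub>T\<^esub>"
  using pure_bilinear(4)[OF assms A.zero_closed, of 0] pure_closed[OF assms A.zero_closed] by simp

text \<open>
  Every tensor is a sum of pure tensors; the sum is represented by the list of its terms, so that
  tensors can be treated by induction on the number of terms.
\<close>

primrec pures :: "('b \<times> 'a) list \<Rightarrow> ('b \<times> 'a \<Rightarrow>\<^sub>0 'k) set" where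
  "pures [] = \<zero>\<^bsub>T\<^esub>"
| "pures (u # us) = pure (fst u) (snd u) \<oplus>\<^bsub>T\<^esub> pures us"

abbreviation "pairs \<equiv> lists (carrier B \<times> carrier A)"

lemma pures_closed: "us \<in> pairs \<Longrightarrow> pures us \<in> carrier T"
  by (induction us) (auto simp: pure_closed)

lemma ex_pures:
  assumes "t \<in> carrier T" shows "\<exists>us\<in>pairs. t = pures us"
proof -
  from assms obtain f where f: "f \<in> carrier F" "t = I +>\<^bsub>F\<^esub> f" by (auto simp: T_ops)
  have "(\<Sum>u\<in>K. Poly_Mapping.single u (Poly_Mapping.lookup f u)) \<in> carrier F \<and>
      (\<exists>us\<in>pairs. I +>\<^bsub>F\<^esub> (\<Sum>u\<in>K. Poly_Mapping.single u (Poly_Mapping.lookup f u)) = pures us)"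
    if "finite K" "K \<subseteq> carrier B \<times> carrier A" for K
    using that
  proof induction
    case empty
    have "I +>\<^bsub>F\<^esub> \<zero>\<^bsub>F\<^esub> = 0 \<odot>\<^bsub>T\<^esub> (I +>\<^bsub>F\<^esub> \<zero>\<^bsub>F\<^esub>)" by (simp add: T_ops(4))
    also have "\<dots> = \<zero>\<^bsub>T\<^esub>" by (rule T.zero_smult) (simp add: T_ops(1))
    finally have "I +>\<^bsub>F\<^esub> 0 = pures []" by (simp add: monoid_algebra_def)
    moreover have "[] \<in> pairs" by simp
    ultimately show ?case unfolding sum.empty F_ops by (metis (mono_tags, lifting) keys_zero empty_subsetI mem_Collect_eq)
  next
    case (insert u K)
    let ?c = "Poly_Mapping.lookup f u"
    obtain b a where u: "u = (b, a)" "b \<in> carrier B" "a \<in> carrier A" using insert.prems by auto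
    from insert obtain us where us: "us \<in> pairs"
      "I +>\<^bsub>F\<^esub> (\<Sum>u\<in>K. Poly_Mapping.single u (Poly_Mapping.lookup f u)) = pures us" by auto
    have "I +>\<^bsub>F\<^esub> Poly_Mapping.single u ?c = ?c \<odot>\<^bsub>T\<^esub> pure b a"
      using u by (simp add: pure_def T_ops(4) single_closed F_ops)
    also have "\<dots> = pure (?c \<odot>\<^bsub>B\<^esub> b) a" using u by (simp add: pure_bilinear)
    finally have "I +>\<^bsub>F\<^esub> (Poly_Mapping.single u ?c \<oplus>\<^bsub>F\<^esub> (\<Sum>u\<in>K. Poly_Mapping.single u (Poly_Mapping.lookup f u)))
      = pures ((?c \<odot>\<^bsub>B\<^esub> b, a) # us)"
      using insert u us by (subst T_ops(3)[symmetric]) (auto simp: single_closed)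
    moreover have "(?c \<odot>\<^bsub>B\<^esub> b, a) # us \<in> pairs" using u us by simp
    moreover have "Poly_Mapping.single u ?c \<oplus>\<^bsub>F\<^esub> (\<Sum>u\<in>K. Poly_Mapping.single u (Poly_Mapping.lookup f u)) \<in> carrier F"
      using insert u by (intro F.a_closed) (auto simp: single_closed)
    ultimately show ?case unfolding F_ops(1) sum.insert[OF insert.hyps(1,2)] by blast
  qed
  from this[OF finite_keys, of f] f show ?thesis
    by (auto simp: F_ops simp flip: poly_mapping_sum_single)
qed

definition A_sum :: "('b \<Rightarrow> 'k) \<Rightarrow> ('b \<times> 'a) list \<Rightarrow> 'a" where
  "A_sum g us = foldr (\<lambda>(b, a) s. (g b \<odot>\<^bsub>A\<^esub> a) \<oplus>\<^bsub>A\<^esub> s) us \<zero>\<^bsub>A\<^esub>"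

lemma A_sum_simps: "A_sum g [] = \<zero>\<^bsub>A\<^esub>" "A_sum g ((b, a) # us) = (g b \<odot>\<^bsub>A\<^esub> a) \<oplus>\<^bsub>A\<^esub> A_sum g us"
  by (simp_all add: A_sum_def)

lemma A_sum_closed: "us \<in> pairs \<Longrightarrow> A_sum g us \<in> carrier A"
  by (induction us) (auto simp: A_sum_simps)

text \<open>
  A coordinate in the first factor turns \<open>\<Sum> b\<^sub>i v \<otimes> a\<^sub>i w\<close> into the action on \<open>w\<close> of a linear combination of
  the \<open>a\<^sub>i\<close>.
\<close>

lemma lookup_act_pures:
  assumes "us \<in> pairs"
  shows "Poly_Mapping.lookup (T_act (pures us) (vec_tensor v w)) (prod_encode (i, j)) =
    Poly_Mapping.lookup (\<tau> (A_sum (\<lambda>b. Poly_Mapping.lookup (\<rho> b v) i) us) w) j"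
  using assms
proof (induction us)
  case (Cons u us)
  obtain b a where u: "u = (b, a)" "b \<in> carrier B" "a \<in> carrier A" using Cons by auto
  then show ?case using Cons
    by (simp add: pures_closed A_sum_closed pure_closed act_pure pair_act_vec_tensor A_sum_simps
        lookup_add lookup_vec_tensor lookup_smult)
qed (simp add: A_sum_simps)

text \<open>
  If \<open>a\<close> is a combination of the \<open>a\<^sub>i\<close>, the term \<open>b' \<otimes> a\<close> can be absorbed into \<open>\<Sum> b\<^sub>i \<otimes> a\<^sub>i\<close> without new
  terms.
\<close>

lemma pures_absorb:
  assumes "us \<in> pairs" "b' \<in> carrier B"
  shows "pure b' (A_sum g us) \<oplus>\<^bsub>T\<^esub> pures us = pures (map (\<lambda>(b, a). (b \<oplus>\<^bsub>B\<^esub> g b \<odot>\<^bsub>B\<^esub> b', a)) us)"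
  using assms
proof (induction us)
  case Nil
  then show ?case by (simp add: A_sum_simps pure_zero_right)
next
  case (Cons u us)
  obtain b a where u: "u = (b, a)" "b \<in> carrier B" "a \<in> carrier A" using Cons by auto
  have us: "us \<in> pairs" using Cons by simp
  have "pure b' (A_sum g (u # us)) \<oplus>\<^bsub>T\<^esub> pures (u # us)
    = (pure b a \<oplus>\<^bsub>T\<^esub> pure (g b \<odot>\<^bsub>B\<^esub> b') a) \<oplus>\<^bsub>T\<^esub> (pure b' (A_sum g us) \<oplus>\<^bsub>T\<^esub> pures us)"
    using u us Cons.prems
    by (simp add: A_sum_simps pure_bilinear A_sum_closed pure_closed pures_closed T.a_ac)
  then show ?case using u us Cons by (simp add: pure_bilinear)
qed

text \<open>
  Induction on the number of terms of \<open>\<Sum> b\<^sub>i \<otimes> a\<^sub>i\<close>. If \<open>b\<^sub>1 \<noteq> 0\<close>, some matrix coefficient \<open>\<gamma>\<close> of the faithful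
  action of \<open>B\<close> is nonzero at \<open>b\<^sub>1\<close>. Taking this coefficient, \<open>\<Sum> \<gamma>(b\<^sub>i) a\<^sub>i\<close> acts by zero, hence is zero, and
  \<open>a\<^sub>1\<close> is a combination of the other \<open>a\<^sub>i\<close>. So the first term can be absorbed by the others.
\<close>

lemma pures_act_zero:
  assumes faith: "faithful_rep B seq_space \<rho>" "faithful_rep A seq_space \<tau>"
  shows "us \<in> pairs \<Longrightarrow> (\<And>v. T_act (pures us) v = 0) \<Longrightarrow> pures us = \<zero>\<^bsub>T\<^esub>"
proof (induction "length us" arbitrary: us)
  case (Suc n)
  then obtain b1 a1 us' where us: "us = (b1, a1) # us'" "n = length us'"
    by (metis length_Suc_conv surj_pair)
  have cl: "b1 \<in> carrier B" "a1 \<in> carrier A" "us' \<in> pairs" using Suc.prems us by auto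
  show ?case
  proof (cases "b1 = \<zero>\<^bsub>B\<^esub>")
    case True
    then have "pures us = pures us'" using cl us by (simp add: pure_zero pures_closed)
    then show ?thesis using Suc us cl by metis
  next
    case False
    then obtain v where "\<rho> b1 v \<noteq> 0" using faith(1) cl by (auto simp: faithful_rep_def)
    then obtain i where i: "Poly_Mapping.lookup (\<rho> b1 v) i \<noteq> 0"
      by (metis lookup_zero poly_mapping_eqI)
    define \<gamma> where "\<gamma> b = Poly_Mapping.lookup (\<rho> b v) i" for b
    \<comment> \<open>The coefficients that express \<open>a\<^sub>1\<close> by the other \<open>a\<^sub>i\<close>.\<close>
    define g where "g b = - \<gamma> b / \<gamma> b1" for b
    have "\<tau> (A_sum \<gamma> us) w = 0" for w
      using lookup_act_pures[OF Suc.prems(1), of v w i] Suc.prems(2)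
      by (intro poly_mapping_eqI) (simp add: \<gamma>_def[abs_def])
    then have "A_sum \<gamma> us = \<zero>\<^bsub>A\<^esub>"
      using faith(2) A_sum_closed[OF Suc.prems(1)] by (auto simp: faithful_rep_def)
    then have *: "\<gamma> b1 \<odot>\<^bsub>A\<^esub> a1 \<oplus>\<^bsub>A\<^esub> A_sum \<gamma> us' = \<zero>\<^bsub>A\<^esub>" by (simp add: us A_sum_simps)
    have scale: "A_sum g vs = (- inverse (\<gamma> b1)) \<odot>\<^bsub>A\<^esub> A_sum \<gamma> vs" if "vs \<in> pairs" for vs
      using that
    proof (induction vs)
      case (Cons u vs)
      obtain b a where u: "u = (b, a)" "a \<in> carrier A" using Cons by auto
      have vs: "A_sum \<gamma> vs \<in> carrier A" using Cons A_sum_closed by simp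
      have "- inverse (\<gamma> b1) * \<gamma> b = g b" by (simp add: g_def field_simps)
      then show ?case using u vs Cons by (simp add: A_sum_simps A.smult_add)
    qed (simp add: A_sum_simps)
    have "a1 = inverse (\<gamma> b1) \<odot>\<^bsub>A\<^esub> (\<gamma> b1 \<odot>\<^bsub>A\<^esub> a1)"
      using cl i by (simp add: \<gamma>_def)
    also have "\<gamma> b1 \<odot>\<^bsub>A\<^esub> a1 = \<ominus>\<^bsub>A\<^esub> A_sum \<gamma> us'"
      using * cl A_sum_closed[OF cl(3)] by (intro A.minus_equality[symmetric]) simp_all
    also have "inverse (\<gamma> b1) \<odot>\<^bsub>A\<^esub> \<dots> = A_sum g us'"
      using A_sum_closed[OF cl(3)] by (simp add: scale[OF cl(3)] A.minus_one_smult[symmetric])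
    finally have "pures us = pure b1 (A_sum g us') \<oplus>\<^bsub>T\<^esub> pures us'" by (simp add: us)
    also have "\<dots> = pures (map (\<lambda>(b, a). (b \<oplus>\<^bsub>B\<^esub> g b \<odot>\<^bsub>B\<^esub> b1, a)) us')"
      by (rule pures_absorb[OF cl(3,1)])
    finally have eq: "pures us = pures (map (\<lambda>(b, a). (b \<oplus>\<^bsub>B\<^esub> g b \<odot>\<^bsub>B\<^esub> b1, a)) us')" (is "_ = pures ?vs") .
    have "pures ?vs = \<zero>\<^bsub>T\<^esub>"
    proof (rule Suc.hyps(1))
      show "n = length ?vs" using us by simp
      show "?vs \<in> pairs" using cl by (fastforce intro!: B.a_closed B.smult_closed)
      show "T_act (pures ?vs) v = 0" for v using Suc.prems(2) eq by simp
    qed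
    then show ?thesis using eq by simp
  qed
qed simp

lemma faithful_tensor:
  assumes "faithful_rep B seq_space \<rho>" "faithful_rep A seq_space \<tau>"
  shows "faithful_rep T seq_space T_act"
  unfolding faithful_rep_def
proof (intro ballI impI)
  fix t assume "t \<in> carrier T" "\<forall>v\<in>carrier seq_space. T_act t v = \<zero>\<^bsub>seq_space\<^esub>"
  moreover from this obtain us where "us \<in> pairs" "t = pures us" using ex_pures by blast
  ultimately show "t = \<zero>\<^bsub>T\<^esub>" using pures_act_zero[OF assms] by simp
qed

text \<open>
  If \<open>k \<noteq> i\<close> then one coordinate of the pair numbered \<open>k\<close> differs from that of \<open>i\<close>, and the element chosen for
  that factor annihilates the corresponding basis vector.
\<close>

lemma separating_tensor:
  assumes "separating B \<rho>" "separating A \<tau>"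
  shows "separating T T_act"
  unfolding separating_def
proof (intro allI impI)
  fix S :: "nat set" and i j assume S: "finite S"
  let ?d = prod_decode
  obtain b where b: "b \<in> carrier B" "\<rho> b (e (fst (?d i))) = e (fst (?d j))"
    "\<And>k. k \<in> fst ` ?d ` S \<Longrightarrow> k \<noteq> fst (?d i) \<Longrightarrow> \<rho> b (e k) = 0"
    using assms(1)[unfolded separating_def, rule_format, of "fst ` ?d ` S" "fst (?d i)" "fst (?d j)"] S by auto
  obtain a where a: "a \<in> carrier A" "\<tau> a (e (snd (?d i))) = e (snd (?d j))"
    "\<And>k. k \<in> snd ` ?d ` S \<Longrightarrow> k \<noteq> snd (?d i) \<Longrightarrow> \<tau> a (e k) = 0"
    using assms(2)[unfolded separating_def, rule_format, of "snd ` ?d ` S" "snd (?d i)" "snd (?d j)"] S by auto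
  have act: "T_act (pure b a) (e k) = vec_tensor (\<rho> b (e (fst (?d k)))) (\<tau> a (e (snd (?d k))))" for k
    using a(1) b(1) by (simp add: act_pure pair_act_def op_tensor_basis)
  show "\<exists>t\<in>carrier T. T_act t (e i) = e j \<and> (\<forall>k\<in>S - {i}. T_act t (e k) = 0)"
  proof (intro bexI conjI ballI)
    show "pure b a \<in> carrier T" using a b by (simp add: pure_closed)
    show "T_act (pure b a) (e i) = e j" by (simp add: act a(2) b(2) vec_tensor_basis)
    fix k assume k: "k \<in> S - {i}"
    then have "?d k \<noteq> ?d i" by (metis DiffD2 insertI1 prod_decode_inverse)
    then have "fst (?d k) \<noteq> fst (?d i) \<or> snd (?d k) \<noteq> snd (?d i)" by (simp add: prod_eq_iff)
    then show "T_act (pure b a) (e k) = 0"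
      using a(3)[of "snd (?d k)"] b(3)[of "fst (?d k)"] k by (auto simp: act vec_tensor_bilinear)
  qed
qed

end

theorem faithful_separating_rep_tensor:
  assumes "faithful_separating_rep B \<rho>" "faithful_separating_rep A \<tau>"
  shows "\<exists>\<sigma>. faithful_separating_rep (tensor B A) \<sigma>"
proof -
  interpret B: seq_rep B \<rho> using assms by (simp add: faithful_separating_rep_def)
  interpret A: seq_rep A \<tau> using assms by (simp add: faithful_separating_rep_def)
  interpret tensor_rep B \<rho> A \<tau> ..
  have "faithful_separating_rep T T_act"
    using assms T.seq_rep_axioms faithful_tensor separating_tensor by (simp add: faithful_separating_rep_def)
  then show ?thesis by blast
qed

theorem faithful_separating_rep_tensor_power:
  assumes "faithful_separating_rep A \<rho>" "n \<ge> 1"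
  shows "\<exists>\<sigma>. faithful_separating_rep (tensor_power A n) \<sigma>"
  using assms(2)
proof (induction n rule: nat_induct_at_least)
  case base
  then show ?case using faithful_separating_rep_relabel[OF assms(1) inj_on_Base] by auto
next
  case (Suc n)
  have A: "k_algebra A" using assms(1) by (simp add: faithful_separating_rep_def seq_rep_def k_alg_def k_alg_axioms_def)
  from Suc obtain \<sigma> where "faithful_separating_rep (tensor_power A n) \<sigma>" by blast
  then obtain \<sigma>' where "faithful_separating_rep (tensor (tensor_power A n) A) \<sigma>'"
    using faithful_separating_rep_tensor assms(1) by blast
  then have "faithful_separating_rep (relabel tensor_name (tensor (tensor_power A n) A))
      (\<lambda>u. \<sigma>' (inv_into (carrier (tensor (tensor_power A n) A)) tensor_name u))"
    by (rule faithful_separating_rep_relabel) (intro inj_on_tensor_name_tensor k_algebra_tensor_power A)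
  then show ?case using Suc.hyps by auto
qed

section \<open>Faithful irreducible representations of the tensor powers\<close>

theorem proposition6p5:
  fixes p q :: "'k::{alg_closed_field, field_char_0}" and r s :: nat
  assumes "uncountable (UNIV :: 'k set)"
    and "p \<noteq> 0" and "q \<noteq> 0"
    and "r > 0" and "s > 0" and "gcd r s = 1"
    and "q ^ r = p ^ s" and "p * q \<noteq> 1"
    and "\<not> PI_ring (H_alg p q)"
  shows "\<forall>n\<ge>1. has_faithful_irreducible_rep (tensor_power (A_alg p q r s) n)"
proof (intro allI impI)
  fix n :: nat assume n: "n \<ge> 1"
  \<comment> \<open>If \<open>p\<close> is a root of unity then so is \<open>q\<close>, as \<open>q\<^sup>r = p\<^sup>s\<close>.\<close>
  have not_root: "p ^ m \<noteq> 1" if "m > 0" for m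
  proof
    assume p: "p ^ m = 1"
    have "p ^ (r * m) = 1" using p by (metis mult.commute power_mult power_one)
    moreover have "q ^ (r * m) = 1"
    proof -
      have "q ^ (r * m) = (p ^ m) ^ s" by (simp add: power_mult assms(7)) (simp flip: power_mult add: mult.commute)
      then show ?thesis using p by simp
    qed
    ultimately have "PI_ring (H_alg p q)"
      using that assms(4) PI_ring_if_roots_of_unity[OF q_heisenberg_H_alg[OF assms(2,3,8)], of "r * m"] by simp
    then show False using assms(9) by simp
  qed
  interpret fock_quotient p q r s
    by unfold_locales (use assms not_root in auto)
  obtain \<sigma> where "faithful_separating_rep (tensor_power (A_alg p q r s) n) \<sigma>"
    using faithful_separating_rep_tensor_power[OF faithful_separating_rep_A n] by blast
  then show "has_faithful_irreducible_rep (tensor_power (A_alg p q r s) n)"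
    by (rule has_faithful_irreducible_rep_if_faithful_separating_rep)
qed

end
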